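(* Let $\mathbb{C}$ be a double category. Given a lax double presheaf $X\colon\mathbb{C}^{\mathrm{op}}\to\mathbb{C}\mathrm{at}$ and objects $\hat x$ in $\mathbb{C}$ and $\hat x_-$ in $X\hat x$, then $X$ is represented by $(\hat x,\hat x_-)$ if and only if the object $(\hat x,\hat x_-)$ is double terminal in the Grothendieck construction $\int\!\!\!\int_{\mathbb{C}}X$.
   Context: **Double categories.** A (strict) double category $\mathbb{C}$ has objects; horizontal morphisms $f\colon x\to y$ (composition $g\circ f$, identities $1_x$); vertical morphisms $u\colon x\nrightarrow x'$ (composition $u'\bullet u$, identities $e_x$); and squares $\alpha\colon[u\,{}^{f}_{f'}\,v]$ with left boundary $u\colon x\nrightarrow x'$, right boundary $v\colon y\nrightarrow y'$, top $f\colon x\to y$ and bottom $f'\colon x'\to y'$. Squares compose horizontally ($\beta\circ\alpha$, along a common vertical morphism, identities $1_u$) and vertically ($\alpha'\bullet\alpha$, along a common horizontal morphism, identities $e_f$). All compositions are strictly associative and unital, satisfy interchange, and $e_g\circ e_f=e_{g\circ f}$, $1_{u'}\bullet 1_u=1_{u'\bullet u}$, $e_{1_x}=1_{e_x}$. $\mathbb{C}^{\mathrm{op}}$ is obtained by reversing horizontal morphisms and squares horizontally. **Profunctors.** A profunctor $U\colon \mathcal{A}\nrightarrow\mathcal{A}'$ is a functor $\mathcal{A}^{\mathrm{op}}\times\mathcal{A}'\to\mathrm{Set}$. Composition: $(U'\bullet U)(a,a'')=\int^{a'}U'(a',a'')\times U(a,a')$; the class of $(s',s)$ is $[s',s]$.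 The identity profunctor is the hom functor, and one chooses $U\bullet e_{\mathcal{A}}=U=e_{\mathcal{A}'}\bullet U$ via the co-Yoneda isomorphisms. $\mathbb{C}\mathrm{at}$ is the weak double category of small categories, functors (horizontal), profunctors (vertical), with squares $[U\,{}^{F}_{F'}\,V]$ the natural transformations $U\Rightarrow V(F^{\mathrm{op}}\times F')$. **Lax double presheaves.** A lax double presheaf over $\mathbb{C}$ is a normal lax double functor $X\colon\mathbb{C}^{\mathrm{op}}\to\mathbb{C}\mathrm{at}$. Explicitly: a category $Xx$ for each object $x$; a functor $Xf\colon Xy\to Xx$ for each horizontal $f\colon x\to y$; a profunctor $Xu\colon Xx^{\mathrm{op}}\times Xx'\to\mathrm{Set}$ for each vertical $u\colon x\nrightarrow x'$; a natural transformation $X\alpha\colon Xv\Rightarrow Xu(Xf^{\mathrm{op}}\times Xf')$ for each square $\alpha\colon[u\,{}^{f}_{f'}\,v]$; and a natural transformation $\mu_{u,u'}\colon Xu'\bullet Xu\Rightarrow X(u'\bullet u)$ for all composable vertical $u,u'$; such that (i) horizontal compositions and identities (of horizontal morphisms and of squares) are preserved strictly; (ii) $\mu$ is natural: $X(\alpha'\bullet\alpha)\circ\mu_{v,v'}=\mu_{u,u'}(Xf^{\mathrm{op}}\times Xf'')\circ(X\alpha'\bullet X\alpha)$ for vertically composable squares $\alpha\colon[u\,{}^{f}_{f'}\,v]$, $\alpha'\colon[u'\,{}^{f'}_{f''}\,v']$, and associative: $\mu_{u,u''\bullet u'}\circ(\mu_{u',u''}\bullet Xu)=\mu_{u'\bullet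 u,u''}\circ(Xu''\bullet\mu_{u,u'})$ up to the associator of profunctor composition; (iii) normality: $Xe_x$ is the hom functor of $Xx$, $Xe_f$ is the action of $Xf$ on homs, and $\mu_{e_x,u}$, $\mu_{u,e_{x'}}$ are identities at $Xu$. For a globular square $\eta\colon[e_x\,{}^{g}_{g'}\,e_{\hat x}]$, $X\eta$ is identified with the natural transformation $Xg\Rightarrow Xg'\colon X\hat x\to Xx$ with component $(X\eta)_{a,a}(1_a)$ at $a$. Horizontal transformations $F\colon X\Rightarrow Y$: functors $F_x\colon Xx\to Yx$ and natural transformations $F_u\colon Xu\Rightarrow Yu(F_x^{\mathrm{op}}\times F_{x'})$ such that $F_x\circ Xf=Yf\circ F_y$ for $f\colon x\to y$; $F_u(Xf^{\mathrm{op}}\times Xf')\circ X\alpha=Y\alpha(F_y^{\mathrm{op}}\times F_{y'})\circ F_v$ for each square $\alpha\colon[u\,{}^{f}_{f'}\,v]$; $F_{u'\bullet u}\circ\mu_{u,u'}=\mu_{u,u'}(F_x^{\mathrm{op}}\times F_{x''})\circ(F_{u'}\bullet F_u)$; and $F_{e_x}$ is the action of $F_x$ on homs. **Representables.** $\mathbb{C}(-,\hat x)\colon\mathbb{C}^{\mathrm{op}}\to\mathbb{C}\mathrm{at}$ sends $x$ to the category $\mathbb{C}(x,\hat x)$ of horizontal morphisms $g\colon x\to\hat x$ and squares $[e_x\,{}^{g}_{g'}\,e_{\hat x}]$ under vertical composition; $f\colon x\to y$ to precomposition with $f$ and $e_f$; $u\colon x\nrightarrow x'$ to the profunctor with $\mathbb{C}(u,\hat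 x)(g,g')$ the set of squares $[u\,{}^{g}_{g'}\,e_{\hat x}]$, acted on by vertical composition; a square $\alpha$ to $\eta\mapsto\eta\circ\alpha$; and $\mu_{u,u'}$ is $[\alpha',\alpha]\mapsto\alpha'\bullet\alpha$. For $\hat x_-\in X\hat x$, the horizontal transformation $\Phi_{\hat x,X}(\hat x_-)\colon\mathbb{C}(-,\hat x)\Rightarrow X$ has component at $x$ the functor $\mathbb{C}(x,\hat x)\to Xx$, $g\mapsto Xg(\hat x_-)$, $\eta\mapsto(X\eta)_{\hat x_-}$, and component at $u\colon x\nrightarrow x'$ given by the maps $\mathbb{C}(u,\hat x)(g,g')\to Xu(Xg(\hat x_-),Xg'(\hat x_-))$, $\eta\mapsto(X\eta)_{\hat x_-,\hat x_-}(1_{\hat x_-})$. The lax double presheaf $X$ is represented by $(\hat x,\hat x_-)$ if $\Phi_{\hat x,X}(\hat x_-)$ is invertible. **Grothendieck construction.** $\int\!\!\!\int_{\mathbb{C}}X$ is the double category with objects $(x,x_-)$, $x\in\mathbb{C}$, $x_-\in Xx$; horizontal morphisms $(x,x_-)\to(y,y_-)$ the horizontal $f\colon x\to y$ in $\mathbb{C}$ with $x_-=Xf(y_-)$; vertical morphisms $(x,x_-)\nrightarrow(x',x'_-)$ the pairs $(u,u_-)$ with $u\colon x\nrightarrow x'$ and $u_-\in Xu(x_-,x'_-)$; squares $[(u,u_-)\,{}^{f}_{f'}\,(v,v_-)]$ from left objects $(x,x_-),(x',x'_-)$ to right objects $(y,y_-),(y',y'_-)$ the squares $\alpha\colon[u\,{}^{f}_{f'}\,v]$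 of $\mathbb{C}$ with $u_-=(X\alpha)_{y_-,y'_-}(v_-)$. Compositions and identities of horizontal morphisms and squares are those of $\mathbb{C}$; $(u',u'_-)\bullet(u,u_-)=(u'\bullet u,(\mu_{u,u'})_{x_-,x''_-}([u'_-,u_-]))$; vertical identities are $(e_x,1_{x_-})$. **Double terminal objects.** For an object $\hat e$ of a double category $\mathbb{E}$, the slice $\mathbb{E}/\hat e$ is the double category with objects $(e,g\colon e\to\hat e)$; horizontal morphisms $(e,g)\to(d,h)$ the horizontal $f\colon e\to d$ with $g=h\circ f$; vertical morphisms $(e,g)\nrightarrow(e',g')$ the pairs $(u,\eta)$ with $u\colon e\nrightarrow e'$ and $\eta\colon[u\,{}^{g}_{g'}\,e_{\hat e}]$; squares $[(u,\eta)\,{}^{f}_{f'}\,(v,\theta)]$ the squares $\alpha\colon[u\,{}^{f}_{f'}\,v]$ with $\eta=\theta\circ\alpha$. The object $\hat e$ is double terminal if the projection $\mathbb{E}/\hat e\to\mathbb{E}$ is an isomorphism of double categories (equivalently: every object $e$ has a unique horizontal morphism $t_e\colon e\to\hat e$, and every vertical $u\colon e\nrightarrow e'$ has a unique square $[u\,{}^{t_e}_{t_{e'}}\,e_{\hat e}]$). *)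

theory Defs
  imports Main
begin

section \<open>Categories, functors and profunctors\<close>

record ('a, 'm) cat =
  Obj :: "'a set"
  Arr :: "'m set"
  Dom :: "'m \<Rightarrow> 'a"
  Cod :: "'m \<Rightarrow> 'a"
  Cmp :: "'m \<Rightarrow> 'm \<Rightarrow> 'm"  \<comment> \<open>\<open>Cmp A g f\<close> is ``\<open>g\<close> after \<open>f\<close>''\<close>
  Idt :: "'a \<Rightarrow> 'm"

definition hom :: "('a, 'm) cat \<Rightarrow> 'a \<Rightarrow> 'a \<Rightarrow> 'm set" where
  "hom A a b = {f \<in> Arr A. Dom A f = a \<and> Cod A f = b}"

locale category =
  fixes A :: "('a, 'm) cat"
  assumes Dom_in: "f \<in> Arr A \<Longrightarrow> Dom A f \<in> Obj A"
    and Cod_in: "f \<in> Arr A \<Longrightarrow> Cod A f \<in> Obj A"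
    and Idt_in: "a \<in> Obj A \<Longrightarrow> Idt A a \<in> hom A a a"
    and Cmp_in: "f \<in> hom A a b \<Longrightarrow> g \<in> hom A b c \<Longrightarrow> Cmp A g f \<in> hom A a c"
    and Cmp_Idt: "f \<in> hom A a b \<Longrightarrow> Cmp A f (Idt A a) = f"
    and Idt_Cmp: "f \<in> hom A a b \<Longrightarrow> Cmp A (Idt A b) f = f"
    and Cmp_assoc: "f \<in> hom A a b \<Longrightarrow> g \<in> hom A b c \<Longrightarrow> h \<in> hom A c d \<Longrightarrow>
      Cmp A h (Cmp A g f) = Cmp A (Cmp A h g) f"

record ('a, 'm, 'b, 'n) func =
  fo :: "'a \<Rightarrow> 'b"
  fa :: "'m \<Rightarrow> 'n"

locale cat_functor =
  fixes A :: "('a, 'm) cat" and B :: "('b, 'n) cat" and F :: "('a, 'm, 'b, 'n) func"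
  assumes source: "category A" and target: "category B"
    and fo_in: "a \<in> Obj A \<Longrightarrow> fo F a \<in> Obj B"
    and fa_in: "f \<in> hom A a b \<Longrightarrow> fa F f \<in> hom B (fo F a) (fo F b)"
    and fa_Idt: "a \<in> Obj A \<Longrightarrow> fa F (Idt A a) = Idt B (fo F a)"
    and fa_Cmp: "f \<in> hom A a b \<Longrightarrow> g \<in> hom A b c \<Longrightarrow>
      fa F (Cmp A g f) = Cmp B (fa F g) (fa F f)"

definition func_id :: "('a, 'm, 'a, 'm) func" where
  "func_id = \<lparr>fo = (\<lambda>a. a), fa = (\<lambda>f. f)\<rparr>"

definition func_comp ::
  "('b, 'n, 'c, 'k) func \<Rightarrow> ('a, 'm, 'b, 'n) func \<Rightarrow> ('a, 'm, 'c, 'k) func" where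
  "func_comp G F = \<lparr>fo = (\<lambda>a. fo G (fo F a)), fa = (\<lambda>f. fa G (fa F f))\<rparr>"

text \<open>Functors are total HOL functions that matter only on the carriers of their source; equality of
functors is therefore agreement on the carriers.  The same convention is used for profunctors,
transformations and double functors below.\<close>

definition func_eq :: "('a, 'm) cat \<Rightarrow> ('a, 'm, 'b, 'n) func \<Rightarrow> ('a, 'm, 'b, 'n) func \<Rightarrow> bool" where
  "func_eq A F G \<longleftrightarrow> (\<forall>a\<in>Obj A. fo F a = fo G a) \<and> (\<forall>f\<in>Arr A. fa F f = fa G f)"

text \<open>\<open>El U a a'\<close> is the set \<open>U(a, a')\<close>, and \<open>Act U f f'\<close> is the map
\<open>U(f, f') : U(a, a') \<Rightarrow> U(b, b')\<close> for \<open>f : b \<rightarrow> a\<close> and \<open>f' : a' \<rightarrow> b'\<close>.\<close>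

record ('a, 'm, 'e) prof =
  El :: "'a \<Rightarrow> 'a \<Rightarrow> 'e set"
  Act :: "'m \<Rightarrow> 'm \<Rightarrow> 'e \<Rightarrow> 'e"

locale profunctor =
  fixes A A' :: "('a, 'm) cat" and U :: "('a, 'm, 'e) prof"
  assumes source: "category A" and target: "category A'"
    and Act_in: "f \<in> hom A b a \<Longrightarrow> f' \<in> hom A' a' b' \<Longrightarrow> s \<in> El U a a' \<Longrightarrow>
      Act U f f' s \<in> El U b b'"
    and Act_Idt: "a \<in> Obj A \<Longrightarrow> a' \<in> Obj A' \<Longrightarrow> s \<in> El U a a' \<Longrightarrow>
      Act U (Idt A a) (Idt A' a') s = s"
    and Act_Cmp: "g \<in> hom A c b \<Longrightarrow> f \<in> hom A b a \<Longrightarrow>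
      f' \<in> hom A' a' b' \<Longrightarrow> g' \<in> hom A' b' c' \<Longrightarrow> s \<in> El U a a' \<Longrightarrow>
      Act U (Cmp A f g) (Cmp A' g' f') s = Act U g g' (Act U f f' s)"

definition hom_prof :: "('a, 'm) cat \<Rightarrow> ('a, 'm, 'm) prof" where
  "hom_prof A = \<lparr>El = hom A, Act = (\<lambda>f f' s. Cmp A f' (Cmp A s f))\<rparr>"

definition prof_eq ::
  "('a, 'm) cat \<Rightarrow> ('a, 'm) cat \<Rightarrow> ('a, 'm, 'e) prof \<Rightarrow> ('a, 'm, 'e) prof \<Rightarrow> bool" where
  "prof_eq A A' U V \<longleftrightarrow>
     (\<forall>a\<in>Obj A. \<forall>a'\<in>Obj A'. El U a a' = El V a a') \<and>
     (\<forall>f\<in>Arr A. \<forall>f'\<in>Arr A'. \<forall>s\<in>El U (Cod A f) (Dom A' f'). Act U f f' s = Act V f f' s)"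

text \<open>A natural transformation \<open>U \<Rightarrow> V(F\<^sup>o\<^sup>p \<times> F')\<close> of functors
\<open>A\<^sup>o\<^sup>p \<times> A' \<rightarrow> Set\<close>; its component at \<open>(a, a')\<close> is \<open>\<phi> a a'\<close>.\<close>

definition prof_nat ::
  "('a, 'm) cat \<Rightarrow> ('a, 'm) cat \<Rightarrow> ('a, 'm, 'b, 'n) func \<Rightarrow> ('a, 'm, 'b, 'n) func \<Rightarrow>
   ('a, 'm, 'e) prof \<Rightarrow> ('b, 'n, 'd) prof \<Rightarrow> ('a \<Rightarrow> 'a \<Rightarrow> 'e \<Rightarrow> 'd) \<Rightarrow> bool" where
  "prof_nat A A' F F' U V \<phi> \<longleftrightarrow>
     (\<forall>a\<in>Obj A. \<forall>a'\<in>Obj A'. \<forall>s\<in>El U a a'. \<phi> a a' s \<in> El V (fo F a) (fo F' a')) \<and>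
     (\<forall>f\<in>Arr A. \<forall>f'\<in>Arr A'. \<forall>s\<in>El U (Cod A f) (Dom A' f').
        \<phi> (Dom A f) (Cod A' f') (Act U f f' s) =
        Act V (fa F f) (fa F' f') (\<phi> (Cod A f) (Dom A' f') s))"

text \<open>The coend \<open>(U' \<bullet> U)(a, a'')\<close> is the quotient of the set of triples \<open>(a', s', s)\<close> with
\<open>s' \<in> U'(a', a'')\<close> and \<open>s \<in> U(a, a')\<close> by the equivalence relation generated by
\<open>(b', s', U(1, k) s) ~ (b, U'(k, 1) s', s)\<close> for \<open>k : b \<rightarrow> b'\<close>.\<close>

definition coend_pairs ::
  "('a, 'm) cat \<Rightarrow> ('a, 'm, 'e) prof \<Rightarrow> ('a, 'm, 'e) prof \<Rightarrow> 'a \<Rightarrow> 'a \<Rightarrow> ('a \<times> 'e \<times> 'e) set" where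
  "coend_pairs A' U' U a a'' = {(a', s', s). a' \<in> Obj A' \<and> s' \<in> El U' a' a'' \<and> s \<in> El U a a'}"

definition coend_gen ::
  "('a, 'm) cat \<Rightarrow> ('a, 'm) cat \<Rightarrow> ('a, 'm) cat \<Rightarrow> ('a, 'm, 'e) prof \<Rightarrow> ('a, 'm, 'e) prof \<Rightarrow>
   'a \<Rightarrow> 'a \<Rightarrow> (('a \<times> 'e \<times> 'e) \<times> ('a \<times> 'e \<times> 'e)) set" where
  "coend_gen A A' A'' U' U a a'' =
     {((b', s', Act U (Idt A a) k s), (b, Act U' k (Idt A'' a'') s', s)) | b b' k s' s.
        k \<in> hom A' b b' \<and> s' \<in> El U' b' a'' \<and> s \<in> El U a b}"

definition coend_rel ::
  "('a, 'm) cat \<Rightarrow> ('a, 'm) cat \<Rightarrow> ('a, 'm) cat \<Rightarrow> ('a, 'm, 'e) prof \<Rightarrow> ('a, 'm, 'e) prof \<Rightarrow>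
   'a \<Rightarrow> 'a \<Rightarrow> (('a \<times> 'e \<times> 'e) \<times> ('a \<times> 'e \<times> 'e)) set" where
  "coend_rel A A' A'' U' U a a'' =
     (coend_gen A A' A'' U' U a a'' \<union> (coend_gen A A' A'' U' U a a'')\<inverse>)\<^sup>*"

definition coend_class ::
  "('a, 'm) cat \<Rightarrow> ('a, 'm) cat \<Rightarrow> ('a, 'm) cat \<Rightarrow> ('a, 'm, 'e) prof \<Rightarrow> ('a, 'm, 'e) prof \<Rightarrow>
   'a \<Rightarrow> 'a \<Rightarrow> 'a \<times> 'e \<times> 'e \<Rightarrow> ('a \<times> 'e \<times> 'e) set" where
  "coend_class A A' A'' U' U a a'' p = coend_rel A A' A'' U' U a a'' `` {p}"

text \<open>The action sends the class of \<open>(a', s', s)\<close> to the class of \<open>(a', U'(1, f'') s', U(f, 1) s)\<close>;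
the union is over equal classes.\<close>

definition prof_comp ::
  "('a, 'm) cat \<Rightarrow> ('a, 'm) cat \<Rightarrow> ('a, 'm) cat \<Rightarrow> ('a, 'm, 'e) prof \<Rightarrow> ('a, 'm, 'e) prof \<Rightarrow>
   ('a, 'm, ('a \<times> 'e \<times> 'e) set) prof" where
  "prof_comp A A' A'' U' U =
     \<lparr>El = (\<lambda>a a''. coend_pairs A' U' U a a'' // coend_rel A A' A'' U' U a a''),
      Act = (\<lambda>f f'' c. \<Union>(a', s', s)\<in>c. coend_class A A' A'' U' U (Dom A f) (Cod A'' f'')
         (a', Act U' (Idt A' a') f'' s', Act U f (Idt A' a') s))\<rparr>"


section \<open>Double categories\<close>

text \<open>Horizontal morphisms compose by \<open>hcmp\<close>, vertical morphisms by \<open>vcmp\<close>, squares horizontally by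
\<open>hsq\<close> and vertically by \<open>vsq\<close> (the second argument comes first in diagrammatic order, as for \<open>Cmp\<close>).
\<open>hsqid u\<close> is \<open>1\<^sub>u\<close> and \<open>vsqid f\<close> is \<open>e\<^sub>f\<close>.\<close>

record ('o, 'h, 'v, 's) dblcat =
  Ob :: "'o set"
  Hor :: "'h set"
  Ver :: "'v set"
  Sq :: "'s set"
  hdom :: "'h \<Rightarrow> 'o"
  hcod :: "'h \<Rightarrow> 'o"
  hcmp :: "'h \<Rightarrow> 'h \<Rightarrow> 'h"
  hid :: "'o \<Rightarrow> 'h"
  vdom :: "'v \<Rightarrow> 'o"
  vcod :: "'v \<Rightarrow> 'o"
  vcmp :: "'v \<Rightarrow> 'v \<Rightarrow> 'v"
  vid :: "'o \<Rightarrow> 'v"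
  sleft :: "'s \<Rightarrow> 'v"
  sright :: "'s \<Rightarrow> 'v"
  stop :: "'s \<Rightarrow> 'h"
  sbot :: "'s \<Rightarrow> 'h"
  hsq :: "'s \<Rightarrow> 's \<Rightarrow> 's"
  hsqid :: "'v \<Rightarrow> 's"
  vsq :: "'s \<Rightarrow> 's \<Rightarrow> 's"
  vsqid :: "'h \<Rightarrow> 's"

definition hcat :: "('o, 'h, 'v, 's) dblcat \<Rightarrow> ('o, 'h) cat" where
  "hcat C = \<lparr>Obj = Ob C, Arr = Hor C, Dom = hdom C, Cod = hcod C, Cmp = hcmp C, Idt = hid C\<rparr>"

definition vcat :: "('o, 'h, 'v, 's) dblcat \<Rightarrow> ('o, 'v) cat" where
  "vcat C = \<lparr>Obj = Ob C, Arr = Ver C, Dom = vdom C, Cod = vcod C, Cmp = vcmp C, Idt = vid C\<rparr>"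

definition hsqcat :: "('o, 'h, 'v, 's) dblcat \<Rightarrow> ('v, 's) cat" where
  "hsqcat C = \<lparr>Obj = Ver C, Arr = Sq C, Dom = sleft C, Cod = sright C, Cmp = hsq C, Idt = hsqid C\<rparr>"

definition vsqcat :: "('o, 'h, 'v, 's) dblcat \<Rightarrow> ('h, 's) cat" where
  "vsqcat C = \<lparr>Obj = Hor C, Arr = Sq C, Dom = stop C, Cod = sbot C, Cmp = vsq C, Idt = vsqid C\<rparr>"

definition hhom :: "('o, 'h, 'v, 's) dblcat \<Rightarrow> 'o \<Rightarrow> 'o \<Rightarrow> 'h set" where
  "hhom C x y = {f \<in> Hor C. hdom C f = x \<and> hcod C f = y}"

definition vhom :: "('o, 'h, 'v, 's) dblcat \<Rightarrow> 'o \<Rightarrow> 'o \<Rightarrow> 'v set" where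
  "vhom C x x' = {u \<in> Ver C. vdom C u = x \<and> vcod C u = x'}"

definition squares :: "('o, 'h, 'v, 's) dblcat \<Rightarrow> 'v \<Rightarrow> 'h \<Rightarrow> 'h \<Rightarrow> 'v \<Rightarrow> 's set" where
  "squares C u f f' v =
     {\<alpha> \<in> Sq C. sleft C \<alpha> = u \<and> stop C \<alpha> = f \<and> sbot C \<alpha> = f' \<and> sright C \<alpha> = v}"

locale double_category =
  fixes C :: "('o, 'h, 'v, 's) dblcat"
  assumes hcat: "category (hcat C)"
    and vcat: "category (vcat C)"
    and hsqcat: "category (hsqcat C)"
    and vsqcat: "category (vsqcat C)"
    and corners: "\<alpha> \<in> Sq C \<Longrightarrow>
      hdom C (stop C \<alpha>) = vdom C (sleft C \<alpha>) \<and> hcod C (stop C \<alpha>) = vdom C (sright C \<alpha>) \<and>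
      hdom C (sbot C \<alpha>) = vcod C (sleft C \<alpha>) \<and> hcod C (sbot C \<alpha>) = vcod C (sright C \<alpha>)"
    and hsq_boundary: "\<alpha> \<in> squares C u f f' v \<Longrightarrow> \<beta> \<in> squares C v g g' w \<Longrightarrow>
      hsq C \<beta> \<alpha> \<in> squares C u (hcmp C g f) (hcmp C g' f') w"
    and vsq_boundary: "\<alpha> \<in> squares C u f f' v \<Longrightarrow> \<alpha>' \<in> squares C u' f' f'' v' \<Longrightarrow>
      vsq C \<alpha>' \<alpha> \<in> squares C (vcmp C u' u) f f'' (vcmp C v' v)"
    and hsqid_boundary: "u \<in> vhom C x x' \<Longrightarrow> hsqid C u \<in> squares C u (hid C x) (hid C x') u"
    and vsqid_boundary: "f \<in> hhom C x y \<Longrightarrow> vsqid C f \<in> squares C (vid C x) f f (vid C y)"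
    and interchange:
      "\<alpha> \<in> squares C u f f' v \<Longrightarrow> \<beta> \<in> squares C v g g' w \<Longrightarrow>
       \<alpha>' \<in> squares C u' f' f'' v' \<Longrightarrow> \<beta>' \<in> squares C v' g' g'' w' \<Longrightarrow>
       vsq C (hsq C \<beta>' \<alpha>') (hsq C \<beta> \<alpha>) = hsq C (vsq C \<beta>' \<beta>) (vsq C \<alpha>' \<alpha>)"
    and vsqid_hcmp: "f \<in> hhom C x y \<Longrightarrow> g \<in> hhom C y z \<Longrightarrow>
      hsq C (vsqid C g) (vsqid C f) = vsqid C (hcmp C g f)"
    and hsqid_vcmp: "u \<in> vhom C x x' \<Longrightarrow> u' \<in> vhom C x' x'' \<Longrightarrow>
      vsq C (hsqid C u') (hsqid C u) = hsqid C (vcmp C u' u)"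
    and vsqid_hid: "x \<in> Ob C \<Longrightarrow> vsqid C (hid C x) = hsqid C (vid C x)"

record ('o1, 'h1, 'v1, 's1, 'o2, 'h2, 'v2, 's2) dblfun =
  dfo :: "'o1 \<Rightarrow> 'o2"
  dfh :: "'h1 \<Rightarrow> 'h2"
  dfv :: "'v1 \<Rightarrow> 'v2"
  dfs :: "'s1 \<Rightarrow> 's2"

locale double_functor =
  fixes D :: "('o1, 'h1, 'v1, 's1) dblcat" and E :: "('o2, 'h2, 'v2, 's2) dblcat"
    and P :: "('o1, 'h1, 'v1, 's1, 'o2, 'h2, 'v2, 's2) dblfun"
  assumes source: "double_category D" and target: "double_category E"
    and hor: "cat_functor (hcat D) (hcat E) \<lparr>fo = dfo P, fa = dfh P\<rparr>"
    and ver: "cat_functor (vcat D) (vcat E) \<lparr>fo = dfo P, fa = dfv P\<rparr>"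
    and hsq: "cat_functor (hsqcat D) (hsqcat E) \<lparr>fo = dfv P, fa = dfs P\<rparr>"
    and vsq: "cat_functor (vsqcat D) (vsqcat E) \<lparr>fo = dfh P, fa = dfs P\<rparr>"

definition dblcat_iso ::
  "('o1, 'h1, 'v1, 's1) dblcat \<Rightarrow> ('o2, 'h2, 'v2, 's2) dblcat \<Rightarrow>
   ('o1, 'h1, 'v1, 's1, 'o2, 'h2, 'v2, 's2) dblfun \<Rightarrow> bool" where
  "dblcat_iso D E P \<longleftrightarrow> double_functor D E P \<and>
     (\<exists>Q. double_functor E D Q \<and>
        (\<forall>x\<in>Ob D. dfo Q (dfo P x) = x) \<and> (\<forall>f\<in>Hor D. dfh Q (dfh P f) = f) \<and>
        (\<forall>u\<in>Ver D. dfv Q (dfv P u) = u) \<and> (\<forall>\<alpha>\<in>Sq D. dfs Q (dfs P \<alpha>) = \<alpha>) \<and>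
        (\<forall>x\<in>Ob E. dfo P (dfo Q x) = x) \<and> (\<forall>f\<in>Hor E. dfh P (dfh Q f) = f) \<and>
        (\<forall>u\<in>Ver E. dfv P (dfv Q u) = u) \<and> (\<forall>\<alpha>\<in>Sq E. dfs P (dfs Q \<alpha>) = \<alpha>))"

text \<open>In a slice the same \<open>f\<close> may be a morphism between several pairs of objects.  Since morphisms
must determine their boundary, horizontal and vertical morphisms are stored as triples (source, datum,
target), and a square as a triple (left vertical morphism, square, right vertical morphism).\<close>

definition slice ::
  "('o, 'h, 'v, 's) dblcat \<Rightarrow> 'o \<Rightarrow>
   ('o \<times> 'h,
    ('o \<times> 'h) \<times> 'h \<times> ('o \<times> 'h),
    ('o \<times> 'h) \<times> ('v \<times> 's) \<times> ('o \<times> 'h),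
    (('o \<times> 'h) \<times> ('v \<times> 's) \<times> ('o \<times> 'h)) \<times> 's \<times> (('o \<times> 'h) \<times> ('v \<times> 's) \<times> ('o \<times> 'h))) dblcat"
where
  "slice E t =
     (let obs = {(e, g). e \<in> Ob E \<and> g \<in> hhom E e t};
          hors = {((e, g), f, (d, h)). (e, g) \<in> obs \<and> (d, h) \<in> obs \<and>
                    f \<in> hhom E e d \<and> g = hcmp E h f};
          vers = {((e, g), (u, \<eta>), (e', g')). (e, g) \<in> obs \<and> (e', g') \<in> obs \<and>
                    u \<in> vhom E e e' \<and> \<eta> \<in> squares E u g g' (vid E t)};
          sqs = {((p, (u, \<eta>), p'), \<alpha>, (q, (v, \<theta>), q')).
                    (p, (u, \<eta>), p') \<in> vers \<and> (q, (v, \<theta>), q') \<in> vers \<and>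
                    (p, stop E \<alpha>, q) \<in> hors \<and> (p', sbot E \<alpha>, q') \<in> hors \<and>
                    \<alpha> \<in> squares E u (stop E \<alpha>) (sbot E \<alpha>) v \<and> \<eta> = hsq E \<theta> \<alpha>}
      in
      \<lparr>Ob = obs, Hor = hors, Ver = vers, Sq = sqs,
       hdom = (\<lambda>(p, f, q). p), hcod = (\<lambda>(p, f, q). q),
       hcmp = (\<lambda>(q', g, r) (p, f, q). (p, hcmp E g f, r)),
       hid = (\<lambda>(e, g). ((e, g), hid E e, (e, g))),
       vdom = (\<lambda>(p, w, p'). p), vcod = (\<lambda>(p, w, p'). p'),
       vcmp = (\<lambda>(q, (u', \<eta>'), p'') (p, (u, \<eta>), p'). (p, (vcmp E u' u, vsq E \<eta>' \<eta>), p'')),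
       vid = (\<lambda>(e, g). ((e, g), (vid E e, vsqid E g), (e, g))),
       sleft = (\<lambda>(l, \<alpha>, r). l), sright = (\<lambda>(l, \<alpha>, r). r),
       stop = (\<lambda>((p, w, p'), \<alpha>, (q, z, q')). (p, stop E \<alpha>, q)),
       sbot = (\<lambda>((p, w, p'), \<alpha>, (q, z, q')). (p', sbot E \<alpha>, q')),
       hsq = (\<lambda>(m, \<beta>, r) (l, \<alpha>, m'). (l, hsq E \<beta> \<alpha>, r)),
       hsqid = (\<lambda>(p, (u, \<eta>), p'). ((p, (u, \<eta>), p'), hsqid E u, (p, (u, \<eta>), p'))),
       vsq = (\<lambda>((q, (u', \<eta>'), p''), \<alpha>', (r, (v', \<theta>'), r'')) ((p, (u, \<eta>), p'), \<alpha>, (s, (v, \<theta>), s')).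
                ((p, (vcmp E u' u, vsq E \<eta>' \<eta>), p''), vsq E \<alpha>' \<alpha>,
                 (s, (vcmp E v' v, vsq E \<theta>' \<theta>), r''))),
       vsqid = (\<lambda>((e, g), f, (d, h)).
                (((e, g), (vid E e, vsqid E g), (e, g)), vsqid E f,
                 ((d, h), (vid E d, vsqid E h), (d, h))))\<rparr>)"

definition slice_proj ::
  "('o \<times> 'h,
    ('o \<times> 'h) \<times> 'h \<times> ('o \<times> 'h),
    ('o \<times> 'h) \<times> ('v \<times> 's) \<times> ('o \<times> 'h),
    (('o \<times> 'h) \<times> ('v \<times> 's) \<times> ('o \<times> 'h)) \<times> 's \<times> (('o \<times> 'h) \<times> ('v \<times> 's) \<times> ('o \<times> 'h)),
    'o, 'h, 'v, 's) dblfun" where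
  "slice_proj =
     \<lparr>dfo = (\<lambda>(e, g). e), dfh = (\<lambda>(p, f, q). f), dfv = (\<lambda>(p, (u, \<eta>), p'). u),
      dfs = (\<lambda>(l, \<alpha>, r). \<alpha>)\<rparr>"

definition double_terminal :: "('o, 'h, 'v, 's) dblcat \<Rightarrow> 'o \<Rightarrow> bool" where
  "double_terminal E t \<longleftrightarrow> t \<in> Ob E \<and> dblcat_iso (slice E t) E slice_proj"


section \<open>Lax double presheaves\<close>

text \<open>Because \<open>X e\<^sub>x\<close> is the hom functor of \<open>X x\<close>, the elements of the profunctors \<open>X u\<close> have the same
type \<open>'m\<close> as the morphisms of the categories \<open>X x\<close>.\<close>

record ('o, 'h, 'v, 's, 'a, 'm) presheaf =
  pcat :: "'o \<Rightarrow> ('a, 'm) cat"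
  pfun :: "'h \<Rightarrow> ('a, 'm, 'a, 'm) func"
  pprof :: "'v \<Rightarrow> ('a, 'm, 'm) prof"
  psq :: "'s \<Rightarrow> 'a \<Rightarrow> 'a \<Rightarrow> 'm \<Rightarrow> 'm"
  pmu :: "'v \<Rightarrow> 'v \<Rightarrow> 'a \<Rightarrow> 'a \<Rightarrow> ('a \<times> 'm \<times> 'm) set \<Rightarrow> 'm"

text \<open>\<open>pclass C X u u' a a'' a' s' s\<close> is the class \<open>[s', s]\<close> in \<open>(X u' \<bullet> X u)(a, a'')\<close> of
\<open>s' \<in> X u'(a', a'')\<close> and \<open>s \<in> X u(a, a')\<close>.\<close>

definition pclass ::
  "('o, 'h, 'v, 's) dblcat \<Rightarrow> ('o, 'h, 'v, 's, 'a, 'm) presheaf \<Rightarrow> 'v \<Rightarrow> 'v \<Rightarrow>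
   'a \<Rightarrow> 'a \<Rightarrow> 'a \<Rightarrow> 'm \<Rightarrow> 'm \<Rightarrow> ('a \<times> 'm \<times> 'm) set" where
  "pclass C X u u' a a'' a' s' s =
     coend_class (pcat X (vdom C u)) (pcat X (vcod C u)) (pcat X (vcod C u'))
       (pprof X u') (pprof X u) a a'' (a', s', s)"

text \<open>The equations involving \<open>pmu\<close> are stated on the classes \<open>[s', s]\<close>, which exhaust the coends.
\<open>mu_assoc\<close> is evaluated at \<open>[[s'', s'], s]\<close>, which the associator sends to \<open>[s'', [s', s]]\<close>.
\<open>mu_unit_left\<close> and \<open>mu_unit_right\<close> say that \<open>\<mu>\<close> is the co-Yoneda isomorphism, which is the
identity under the convention \<open>U \<bullet> e = U = e \<bullet> U\<close>.\<close>

locale lax_double_presheaf =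
  fixes C :: "('o, 'h, 'v, 's) dblcat" and X :: "('o, 'h, 'v, 's, 'a, 'm) presheaf"
  assumes base: "double_category C"
    and cat: "x \<in> Ob C \<Longrightarrow> category (pcat X x)"
    and functors: "f \<in> hhom C x y \<Longrightarrow> cat_functor (pcat X y) (pcat X x) (pfun X f)"
    and profunctors: "u \<in> vhom C x x' \<Longrightarrow> profunctor (pcat X x) (pcat X x') (pprof X u)"
    and sq_nat: "\<alpha> \<in> squares C u f f' v \<Longrightarrow>
      prof_nat (pcat X (vdom C v)) (pcat X (vcod C v)) (pfun X f) (pfun X f')
        (pprof X v) (pprof X u) (psq X \<alpha>)"
    and mu_nat: "u \<in> vhom C x x' \<Longrightarrow> u' \<in> vhom C x' x'' \<Longrightarrow>
      prof_nat (pcat X x) (pcat X x'') func_id func_id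
        (prof_comp (pcat X x) (pcat X x') (pcat X x'') (pprof X u') (pprof X u))
        (pprof X (vcmp C u' u)) (pmu X u u')"
    and fun_hcmp: "f \<in> hhom C x y \<Longrightarrow> g \<in> hhom C y z \<Longrightarrow>
      func_eq (pcat X z) (pfun X (hcmp C g f)) (func_comp (pfun X f) (pfun X g))"
    and fun_hid: "x \<in> Ob C \<Longrightarrow> func_eq (pcat X x) (pfun X (hid C x)) func_id"
    and sq_hsq: "\<alpha> \<in> squares C u f f' v \<Longrightarrow> \<beta> \<in> squares C v g g' w \<Longrightarrow>
      c \<in> Obj (pcat X (vdom C w)) \<Longrightarrow> c' \<in> Obj (pcat X (vcod C w)) \<Longrightarrow>
      s \<in> El (pprof X w) c c' \<Longrightarrow>
      psq X (hsq C \<beta> \<alpha>) c c' s = psq X \<alpha> (fo (pfun X g) c) (fo (pfun X g') c') (psq X \<beta> c c' s)"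
    and sq_hsqid: "u \<in> vhom C x x' \<Longrightarrow>
      a \<in> Obj (pcat X x) \<Longrightarrow> a' \<in> Obj (pcat X x') \<Longrightarrow> s \<in> El (pprof X u) a a' \<Longrightarrow>
      psq X (hsqid C u) a a' s = s"
    and mu_sq: "\<alpha> \<in> squares C u f f' v \<Longrightarrow> \<alpha>' \<in> squares C u' f' f'' v' \<Longrightarrow>
      b \<in> Obj (pcat X (vdom C v)) \<Longrightarrow> b' \<in> Obj (pcat X (vcod C v)) \<Longrightarrow>
      b'' \<in> Obj (pcat X (vcod C v')) \<Longrightarrow>
      s \<in> El (pprof X v) b b' \<Longrightarrow> s' \<in> El (pprof X v') b' b'' \<Longrightarrow>
      psq X (vsq C \<alpha>' \<alpha>) b b'' (pmu X v v' b b'' (pclass C X v v' b b'' b' s' s)) =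
      pmu X u u' (fo (pfun X f) b) (fo (pfun X f'') b'')
        (pclass C X u u' (fo (pfun X f) b) (fo (pfun X f'') b'') (fo (pfun X f') b')
          (psq X \<alpha>' b' b'' s') (psq X \<alpha> b b' s))"
    and mu_assoc: "u \<in> vhom C x x' \<Longrightarrow> u' \<in> vhom C x' x'' \<Longrightarrow> u'' \<in> vhom C x'' x''' \<Longrightarrow>
      a \<in> Obj (pcat X x) \<Longrightarrow> a' \<in> Obj (pcat X x') \<Longrightarrow>
      a'' \<in> Obj (pcat X x'') \<Longrightarrow> a''' \<in> Obj (pcat X x''') \<Longrightarrow>
      s \<in> El (pprof X u) a a' \<Longrightarrow> s' \<in> El (pprof X u') a' a'' \<Longrightarrow> s'' \<in> El (pprof X u'') a'' a''' \<Longrightarrow>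
      pmu X u (vcmp C u'' u') a a''' (pclass C X u (vcmp C u'' u') a a''' a'
        (pmu X u' u'' a' a''' (pclass C X u' u'' a' a''' a'' s'' s')) s) =
      pmu X (vcmp C u' u) u'' a a''' (pclass C X (vcmp C u' u) u'' a a''' a''
        s'' (pmu X u u' a a'' (pclass C X u u' a a'' a' s' s)))"
    and prof_vid: "x \<in> Ob C \<Longrightarrow>
      prof_eq (pcat X x) (pcat X x) (pprof X (vid C x)) (hom_prof (pcat X x))"
    and sq_vsqid: "f \<in> hhom C x y \<Longrightarrow> k \<in> hom (pcat X y) b b' \<Longrightarrow>
      psq X (vsqid C f) b b' k = fa (pfun X f) k"
    and mu_unit_left: "u \<in> vhom C x x' \<Longrightarrow> k \<in> hom (pcat X x) a b \<Longrightarrow>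
      a' \<in> Obj (pcat X x') \<Longrightarrow> s \<in> El (pprof X u) b a' \<Longrightarrow>
      pmu X (vid C x) u a a' (pclass C X (vid C x) u a a' b s k) =
      Act (pprof X u) k (Idt (pcat X x') a') s"
    and mu_unit_right: "u \<in> vhom C x x' \<Longrightarrow> a \<in> Obj (pcat X x) \<Longrightarrow>
      k' \<in> hom (pcat X x') b' a' \<Longrightarrow> s \<in> El (pprof X u) a b' \<Longrightarrow>
      pmu X u (vid C x') a a' (pclass C X u (vid C x') a a' b' k' s) =
      Act (pprof X u) (Idt (pcat X x) a) k' s"

record ('o, 'v, 'a, 'm, 'b, 'n) htrans =
  tob :: "'o \<Rightarrow> ('a, 'm, 'b, 'n) func"
  tver :: "'v \<Rightarrow> 'a \<Rightarrow> 'a \<Rightarrow> 'm \<Rightarrow> 'n"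

locale horizontal_transformation =
  fixes C :: "('o, 'h, 'v, 's) dblcat" and X :: "('o, 'h, 'v, 's, 'a, 'm) presheaf"
    and Y :: "('o, 'h, 'v, 's, 'b, 'n) presheaf" and F :: "('o, 'v, 'a, 'm, 'b, 'n) htrans"
  assumes source: "lax_double_presheaf C X" and target: "lax_double_presheaf C Y"
    and tob_functor: "x \<in> Ob C \<Longrightarrow> cat_functor (pcat X x) (pcat Y x) (tob F x)"
    and tver_nat: "u \<in> vhom C x x' \<Longrightarrow>
      prof_nat (pcat X x) (pcat X x') (tob F x) (tob F x') (pprof X u) (pprof Y u) (tver F u)"
    and tob_fun: "f \<in> hhom C x y \<Longrightarrow>
      func_eq (pcat X y) (func_comp (tob F x) (pfun X f)) (func_comp (pfun Y f) (tob F y))"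
    and tver_sq: "\<alpha> \<in> squares C u f f' v \<Longrightarrow>
      b \<in> Obj (pcat X (vdom C v)) \<Longrightarrow> b' \<in> Obj (pcat X (vcod C v)) \<Longrightarrow>
      s \<in> El (pprof X v) b b' \<Longrightarrow>
      tver F u (fo (pfun X f) b) (fo (pfun X f') b') (psq X \<alpha> b b' s) =
      psq Y \<alpha> (fo (tob F (vdom C v)) b) (fo (tob F (vcod C v)) b') (tver F v b b' s)"
    and tver_mu: "u \<in> vhom C x x' \<Longrightarrow> u' \<in> vhom C x' x'' \<Longrightarrow>
      a \<in> Obj (pcat X x) \<Longrightarrow> a' \<in> Obj (pcat X x') \<Longrightarrow> a'' \<in> Obj (pcat X x'') \<Longrightarrow>
      s \<in> El (pprof X u) a a' \<Longrightarrow> s' \<in> El (pprof X u') a' a'' \<Longrightarrow>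
      tver F (vcmp C u' u) a a'' (pmu X u u' a a'' (pclass C X u u' a a'' a' s' s)) =
      pmu Y u u' (fo (tob F x) a) (fo (tob F x'') a'')
        (pclass C Y u u' (fo (tob F x) a) (fo (tob F x'') a'') (fo (tob F x') a')
          (tver F u' a' a'' s') (tver F u a a' s))"
    and tver_vid: "x \<in> Ob C \<Longrightarrow> k \<in> hom (pcat X x) a b \<Longrightarrow>
      tver F (vid C x) a b k = fa (tob F x) k"

definition htrans_id :: "('o, 'v, 'a, 'm, 'a, 'm) htrans" where
  "htrans_id = \<lparr>tob = (\<lambda>x. func_id), tver = (\<lambda>u a a' s. s)\<rparr>"

definition htrans_comp ::
  "('o, 'h, 'v, 's) dblcat \<Rightarrow> ('o, 'v, 'b, 'n, 'c, 'k) htrans \<Rightarrow> ('o, 'v, 'a, 'm, 'b, 'n) htrans \<Rightarrow>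
   ('o, 'v, 'a, 'm, 'c, 'k) htrans" where
  "htrans_comp C G F =
     \<lparr>tob = (\<lambda>x. func_comp (tob G x) (tob F x)),
      tver = (\<lambda>u a a' s.
        tver G u (fo (tob F (vdom C u)) a) (fo (tob F (vcod C u)) a') (tver F u a a' s))\<rparr>"

definition htrans_eq ::
  "('o, 'h, 'v, 's) dblcat \<Rightarrow> ('o, 'h, 'v, 's, 'a, 'm) presheaf \<Rightarrow>
   ('o, 'v, 'a, 'm, 'b, 'n) htrans \<Rightarrow> ('o, 'v, 'a, 'm, 'b, 'n) htrans \<Rightarrow> bool" where
  "htrans_eq C X F G \<longleftrightarrow>
     (\<forall>x\<in>Ob C. func_eq (pcat X x) (tob F x) (tob G x)) \<and>
     (\<forall>u\<in>Ver C. \<forall>a\<in>Obj (pcat X (vdom C u)). \<forall>a'\<in>Obj (pcat X (vcod C u)).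
        \<forall>s\<in>El (pprof X u) a a'. tver F u a a' s = tver G u a a' s)"

definition htrans_invertible ::
  "('o, 'h, 'v, 's) dblcat \<Rightarrow> ('o, 'h, 'v, 's, 'a, 'm) presheaf \<Rightarrow>
   ('o, 'h, 'v, 's, 'b, 'n) presheaf \<Rightarrow> ('o, 'v, 'a, 'm, 'b, 'n) htrans \<Rightarrow> bool" where
  "htrans_invertible C X Y F \<longleftrightarrow> horizontal_transformation C X Y F \<and>
     (\<exists>G. horizontal_transformation C Y X G \<and>
        htrans_eq C X (htrans_comp C G F) htrans_id \<and> htrans_eq C Y (htrans_comp C F G) htrans_id)"

text \<open>All representatives \<open>(g', \<alpha>', \<alpha>)\<close> of a class have the same composite \<open>\<alpha>' \<bullet> \<alpha>\<close>,
which is what \<open>pmu\<close> extracts.\<close>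

definition representable ::
  "('o, 'h, 'v, 's) dblcat \<Rightarrow> 'o \<Rightarrow> ('o, 'h, 'v, 's, 'h, 's) presheaf" where
  "representable C t =
     \<lparr>pcat = (\<lambda>x. \<lparr>Obj = hhom C x t,
                   Arr = {\<eta> \<in> Sq C. sleft C \<eta> = vid C x \<and> sright C \<eta> = vid C t},
                   Dom = stop C, Cod = sbot C, Cmp = vsq C, Idt = vsqid C\<rparr>),
      pfun = (\<lambda>f. \<lparr>fo = (\<lambda>g. hcmp C g f), fa = (\<lambda>\<eta>. hsq C \<eta> (vsqid C f))\<rparr>),
      pprof = (\<lambda>u. \<lparr>El = (\<lambda>g g'. squares C u g g' (vid C t)),
                    Act = (\<lambda>\<kappa> \<kappa>' \<eta>. vsq C \<kappa>' (vsq C \<eta> \<kappa>))\<rparr>),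
      psq = (\<lambda>\<alpha> g g' \<eta>. hsq C \<eta> \<alpha>),
      pmu = (\<lambda>u u' g g'' c. the_elem ((\<lambda>(g', \<alpha>', \<alpha>). vsq C \<alpha>' \<alpha>) ` c))\<rparr>"

text \<open>The transformation \<open>\<Phi>\<close> determined by an object \<open>a\<close> of \<open>X t\<close>.  For globular \<open>\<eta>\<close>,
\<open>psq X \<eta> a a (Idt (pcat X t) a)\<close> is the component at \<open>a\<close> of the natural transformation
identified with \<open>X \<eta>\<close>.\<close>

definition yoneda_trans ::
  "('o, 'h, 'v, 's, 'a, 'm) presheaf \<Rightarrow> 'o \<Rightarrow> 'a \<Rightarrow> ('o, 'v, 'h, 's, 'a, 'm) htrans" where
  "yoneda_trans X t a =
     \<lparr>tob = (\<lambda>x. \<lparr>fo = (\<lambda>g. fo (pfun X g) a), fa = (\<lambda>\<eta>. psq X \<eta> a a (Idt (pcat X t) a))\<rparr>),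
      tver = (\<lambda>u g g' \<eta>. psq X \<eta> a a (Idt (pcat X t) a))\<rparr>"

definition represented_by ::
  "('o, 'h, 'v, 's) dblcat \<Rightarrow> ('o, 'h, 'v, 's, 'a, 'm) presheaf \<Rightarrow> 'o \<Rightarrow> 'a \<Rightarrow> bool" where
  "represented_by C X t a \<longleftrightarrow>
     htrans_invertible C (representable C t) X (yoneda_trans X t a)"


section \<open>The Grothendieck construction\<close>

text \<open>Morphisms and squares carry their boundary, as in \<open>slice\<close>.\<close>

definition grothendieck ::
  "('o, 'h, 'v, 's) dblcat \<Rightarrow> ('o, 'h, 'v, 's, 'a, 'm) presheaf \<Rightarrow>
   ('o \<times> 'a,
    ('o \<times> 'a) \<times> 'h \<times> ('o \<times> 'a),
    ('o \<times> 'a) \<times> ('v \<times> 'm) \<times> ('o \<times> 'a),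
    (('o \<times> 'a) \<times> ('v \<times> 'm) \<times> ('o \<times> 'a)) \<times> 's \<times> (('o \<times> 'a) \<times> ('v \<times> 'm) \<times> ('o \<times> 'a))) dblcat"
where
  "grothendieck C X =
     (let obs = {(x, a). x \<in> Ob C \<and> a \<in> Obj (pcat X x)};
          hors = {((x, a), f, (y, b)). (x, a) \<in> obs \<and> (y, b) \<in> obs \<and>
                    f \<in> hhom C x y \<and> a = fo (pfun X f) b};
          vers = {((x, a), (u, s), (x', a')). (x, a) \<in> obs \<and> (x', a') \<in> obs \<and>
                    u \<in> vhom C x x' \<and> s \<in> El (pprof X u) a a'};
          sqs = {(((x, a), (u, s), (x', a')), \<alpha>, ((y, b), (v, r), (y', b'))).
                    ((x, a), (u, s), (x', a')) \<in> vers \<and> ((y, b), (v, r), (y', b')) \<in> vers \<and>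
                    ((x, a), stop C \<alpha>, (y, b)) \<in> hors \<and> ((x', a'), sbot C \<alpha>, (y', b')) \<in> hors \<and>
                    \<alpha> \<in> squares C u (stop C \<alpha>) (sbot C \<alpha>) v \<and> s = psq X \<alpha> b b' r};
          vcomp = (\<lambda>((y, b), (u', s'), (x'', a'')) ((x, a), (u, s), (x', a')).
                    ((x, a), (vcmp C u' u, pmu X u u' a a'' (pclass C X u u' a a'' a' s' s)),
                     (x'', a'')));
          vident = (\<lambda>(x, a). ((x, a), (vid C x, Idt (pcat X x) a), (x, a)))
      in
      \<lparr>Ob = obs, Hor = hors, Ver = vers, Sq = sqs,
       hdom = (\<lambda>(p, f, q). p), hcod = (\<lambda>(p, f, q). q),
       hcmp = (\<lambda>(q', g, r) (p, f, q). (p, hcmp C g f, r)),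
       hid = (\<lambda>(x, a). ((x, a), hid C x, (x, a))),
       vdom = (\<lambda>(p, w, p'). p), vcod = (\<lambda>(p, w, p'). p'),
       vcmp = vcomp,
       vid = vident,
       sleft = (\<lambda>(l, \<alpha>, r). l), sright = (\<lambda>(l, \<alpha>, r). r),
       stop = (\<lambda>((p, w, p'), \<alpha>, (q, z, q')). (p, stop C \<alpha>, q)),
       sbot = (\<lambda>((p, w, p'), \<alpha>, (q, z, q')). (p', sbot C \<alpha>, q')),
       hsq = (\<lambda>(m, \<beta>, r) (l, \<alpha>, m'). (l, hsq C \<beta> \<alpha>, r)),
       hsqid = (\<lambda>(p, (u, s), p'). ((p, (u, s), p'), hsqid C u, (p, (u, s), p'))),
       vsq = (\<lambda>(l', \<alpha>', r') (l, \<alpha>, r). (vcomp l' l, vsq C \<alpha>' \<alpha>, vcomp r' r)),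
       vsqid = (\<lambda>(p, f, q). (vident p, vsqid C f, vident q))\<rparr>)"

end

theory Submission
  imports Defs
begin

text \<open>
Both sides are the same pointwise condition on the transformation \<open>\<Phi>\<close> that sends a horizontal
\<open>g : x \<rightarrow> t\<close> to \<open>X g(a)\<close> and a square \<open>\<eta> : [u, g, g', e\<^sub>t]\<close> to the element
\<open>(X \<eta>)(1\<^sub>a)\<close> of \<open>X u(X g(a), X g'(a))\<close>: it is a bijection on objects over every
\<open>x\<close>, and a bijection from squares to elements over every \<open>u\<close> and all \<open>g\<close>, \<open>g'\<close>.

On the side of the Grothendieck construction, a horizontal morphism \<open>(x, b) \<rightarrow> (t, a)\<close> is a
\<open>g\<close> with \<open>X g(a) = b\<close>, and a square from \<open>(u, s)\<close> to the vertical identity of \<open>(t, a)\<close>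
is an \<open>\<eta>\<close> with \<open>(X \<eta>)(1\<^sub>a) = s\<close>.  Unique existence of these is precisely bijectivity of
\<open>\<Phi>\<close> (\<open>double_terminal_grothendieck_iff\<close>).  That double terminality, defined by an isomorphism of
double categories, amounts to unique existence is \<open>double_terminal_iff\<close>: a double functor that is
bijective on cells of all four kinds has an inverse double functor, and the uniqueness of horizontal
morphisms and squares into \<open>t\<close> makes all commutation conditions of the slice automatic.

On the side of representability, a horizontal transformation is invertible iff its components are
bijective on objects and on profunctor elements (\<open>htrans_invertible_iff_bij\<close>).  Bijectivity on
morphisms comes for free: normality identifies the morphisms of \<open>X x\<close> with the elements of
\<open>X e\<^sub>x\<close>.

For these criteria to apply, all structures involved must be what they claim to be.  Representables are
lax double presheaves because pasting of squares is constant on coend classes; the Grothendieck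
construction is a double category by the laws of \<open>\<mu>\<close>; the slice is the Grothendieck construction
of a representable, hence also a double category; and \<open>\<Phi>\<close> is a horizontal transformation because
\<open>1\<^sub>a = \<mu>[1\<^sub>a, 1\<^sub>a]\<close> turns the naturality of \<open>\<mu>\<close> into compatibility of \<open>\<Phi>\<close>
with vertical pasting.\<close>

section \<open>Typed laws of a double category\<close>

context double_category begin

lemma hhom_obs: "f \<in> hhom C x y \<Longrightarrow> x \<in> Ob C \<and> y \<in> Ob C"
  using category.Dom_in[OF hcat, of f] category.Cod_in[OF hcat, of f]
  by (auto simp: hcat_def hhom_def)

lemma vhom_obs: "u \<in> vhom C x y \<Longrightarrow> x \<in> Ob C \<and> y \<in> Ob C"
  using category.Dom_in[OF vcat, of u] category.Cod_in[OF vcat, of u]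
  by (auto simp: vcat_def vhom_def)

lemma hcmp_in: "f \<in> hhom C x y \<Longrightarrow> g \<in> hhom C y z \<Longrightarrow> hcmp C g f \<in> hhom C x z"
  using category.Cmp_in[OF hcat, of f x y g z]
  by (simp add: hcat_def hom_def hhom_def)

lemma hcmp_assoc: "f \<in> hhom C x y \<Longrightarrow> g \<in> hhom C y z \<Longrightarrow> h \<in> hhom C z w \<Longrightarrow>
   hcmp C h (hcmp C g f) = hcmp C (hcmp C h g) f"
  using category.Cmp_assoc[OF hcat, of f x y g z h w]
  by (simp add: hcat_def hom_def hhom_def)

lemma hid_in: "x \<in> Ob C \<Longrightarrow> hid C x \<in> hhom C x x"
  using category.Idt_in[OF hcat, of x] by (simp add: hcat_def hom_def hhom_def)

lemma hcmp_hid: "f \<in> hhom C x y \<Longrightarrow> hcmp C f (hid C x) = f"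
  using category.Cmp_Idt[OF hcat, of f x y] by (simp add: hcat_def hom_def hhom_def)

lemma hid_hcmp: "f \<in> hhom C x y \<Longrightarrow> hcmp C (hid C y) f = f"
  using category.Idt_Cmp[OF hcat, of f x y] by (simp add: hcat_def hom_def hhom_def)

lemma vcmp_in: "u \<in> vhom C x y \<Longrightarrow> v \<in> vhom C y z \<Longrightarrow> vcmp C v u \<in> vhom C x z"
  using category.Cmp_in[OF vcat, of u x y v z]
  by (simp add: vcat_def hom_def vhom_def)

lemma vcmp_assoc: "u \<in> vhom C x y \<Longrightarrow> v \<in> vhom C y z \<Longrightarrow> w \<in> vhom C z z' \<Longrightarrow>
   vcmp C w (vcmp C v u) = vcmp C (vcmp C w v) u"
  using category.Cmp_assoc[OF vcat, of u x y v z w z']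
  by (simp add: vcat_def hom_def vhom_def)

lemma vid_in: "x \<in> Ob C \<Longrightarrow> vid C x \<in> vhom C x x"
  using category.Idt_in[OF vcat, of x] by (simp add: vcat_def hom_def vhom_def)

lemma vcmp_vid: "u \<in> vhom C x y \<Longrightarrow> vcmp C u (vid C x) = u"
  using category.Cmp_Idt[OF vcat, of u x y] by (simp add: vcat_def hom_def vhom_def)

lemma vid_vcmp: "u \<in> vhom C x y \<Longrightarrow> vcmp C (vid C y) u = u"
  using category.Idt_Cmp[OF vcat, of u x y] by (simp add: vcat_def hom_def vhom_def)

lemma vid_vcmp_vid: "x \<in> Ob C \<Longrightarrow> vcmp C (vid C x) (vid C x) = vid C x"
  by (rule vcmp_vid[OF vid_in])

lemma Ver_vhom: "u \<in> Ver C \<Longrightarrow> u \<in> vhom C (vdom C u) (vcod C u)"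
  by (simp add: vhom_def)

lemma Hor_hhom: "f \<in> Hor C \<Longrightarrow> f \<in> hhom C (hdom C f) (hcod C f)"
  by (simp add: hhom_def)

lemma squares_left: "\<alpha> \<in> squares C u f f' v \<Longrightarrow> u \<in> Ver C"
  using category.Dom_in[OF hsqcat, of \<alpha>] by (auto simp: hsqcat_def squares_def)

lemma squares_right: "\<alpha> \<in> squares C u f f' v \<Longrightarrow> v \<in> Ver C"
  using category.Cod_in[OF hsqcat, of \<alpha>] by (auto simp: hsqcat_def squares_def)

lemma squares_top: "\<alpha> \<in> squares C u f f' v \<Longrightarrow> f \<in> hhom C (vdom C u) (vdom C v)"
  using category.Dom_in[OF vsqcat, of \<alpha>] corners[of \<alpha>]
  by (auto simp: vsqcat_def squares_def hhom_def)

lemma squares_bot: "\<alpha> \<in> squares C u f f' v \<Longrightarrow> f' \<in> hhom C (vcod C u) (vcod C v)"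
  using category.Cod_in[OF vsqcat, of \<alpha>] corners[of \<alpha>]
  by (auto simp: vsqcat_def squares_def hhom_def)

lemma Sq_squares: "\<alpha> \<in> Sq C \<Longrightarrow> \<alpha> \<in> squares C (sleft C \<alpha>) (stop C \<alpha>) (sbot C \<alpha>) (sright C \<alpha>)"
  by (simp add: squares_def)

lemma hsq_assoc:
  "\<alpha> \<in> squares C u f f' v \<Longrightarrow> \<beta> \<in> squares C v g g' w \<Longrightarrow> \<gamma> \<in> squares C w h h' z \<Longrightarrow>
   hsq C \<gamma> (hsq C \<beta> \<alpha>) = hsq C (hsq C \<gamma> \<beta>) \<alpha>"
  using category.Cmp_assoc[OF hsqcat, of \<alpha> u v \<beta> w \<gamma> z]
  by (simp add: hsqcat_def hom_def squares_def)

lemma hsq_hsqid: "\<alpha> \<in> squares C u f f' v \<Longrightarrow> hsq C \<alpha> (hsqid C u) = \<alpha>"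
  using category.Cmp_Idt[OF hsqcat, of \<alpha> u v] by (simp add: hsqcat_def hom_def squares_def)

lemma hsqid_hsq: "\<alpha> \<in> squares C u f f' v \<Longrightarrow> hsq C (hsqid C v) \<alpha> = \<alpha>"
  using category.Idt_Cmp[OF hsqcat, of \<alpha> u v] by (simp add: hsqcat_def hom_def squares_def)

lemma vsq_assoc:
  "\<alpha> \<in> squares C u f f' v \<Longrightarrow> \<beta> \<in> squares C u' f' f'' v' \<Longrightarrow> \<gamma> \<in> squares C u'' f'' f''' v'' \<Longrightarrow>
   vsq C \<gamma> (vsq C \<beta> \<alpha>) = vsq C (vsq C \<gamma> \<beta>) \<alpha>"
  using category.Cmp_assoc[OF vsqcat, of \<alpha> f f' \<beta> f'' \<gamma> f''']
  by (simp add: vsqcat_def hom_def squares_def)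

lemma vsq_vsqid: "\<alpha> \<in> squares C u f f' v \<Longrightarrow> vsq C \<alpha> (vsqid C f) = \<alpha>"
  using category.Cmp_Idt[OF vsqcat, of \<alpha> f f'] by (simp add: vsqcat_def hom_def squares_def)

lemma vsqid_vsq: "\<alpha> \<in> squares C u f f' v \<Longrightarrow> vsq C (vsqid C f') \<alpha> = \<alpha>"
  using category.Idt_Cmp[OF vsqcat, of \<alpha> f f'] by (simp add: vsqcat_def hom_def squares_def)

text \<open>Squares into a vertical identity are closed under vertical pasting because
\<open>e\<^sub>t \<bullet> e\<^sub>t = e\<^sub>t\<close>.\<close>

lemma vsq_over_vid:
  "t \<in> Ob C \<Longrightarrow> \<eta> \<in> squares C u g g' (vid C t) \<Longrightarrow> \<eta>' \<in> squares C u' g' g'' (vid C t) \<Longrightarrow>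
   vsq C \<eta>' \<eta> \<in> squares C (vcmp C u' u) g g'' (vid C t)"
  using vsq_boundary[of \<eta> u g g' "vid C t" \<eta>' u' g'' "vid C t"] by (simp add: vid_vcmp_vid)

lemma vsq_whisker:
  assumes "t \<in> Ob C" "u \<in> vhom C x x'" "\<eta> \<in> squares C u g g' (vid C t)"
    "\<kappa> \<in> squares C (vid C x) h g (vid C t)" "\<kappa>' \<in> squares C (vid C x') g' h' (vid C t)"
  shows "vsq C \<kappa>' (vsq C \<eta> \<kappa>) \<in> squares C u h h' (vid C t)"
  using vsq_over_vid[OF assms(1) vsq_over_vid[OF assms(1,4,3)] assms(5)] assms(2)
  by (simp add: vcmp_vid vid_vcmp)

lemma vsq_vsqid_vsqid: "f \<in> hhom C x y \<Longrightarrow> vsq C (vsqid C f) (vsqid C f) = vsqid C f"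
  using vsq_vsqid[OF vsqid_boundary] .

end

section \<open>Representables are lax double presheaves\<close>

lemma pclass_refl: "(a', s', s) \<in> pclass C X u u' a a'' a' s' s"
  unfolding pclass_def coend_class_def coend_rel_def
  by (rule ImageI[OF rtrancl.rtrancl_refl singletonI])

context double_category begin

lemma hom_representable:
  "hom (pcat (representable C t) x) g g' = squares C (vid C x) g g' (vid C t)"
  by (auto simp: hom_def representable_def squares_def)

lemma Obj_representable: "Obj (pcat (representable C t) x) = hhom C x t"
  by (simp add: representable_def)

lemma Arr_representable:
  "f \<in> Arr (pcat (representable C t) x) \<longleftrightarrow> f \<in> squares C (vid C x) (stop C f) (sbot C f) (vid C t)"
  by (auto simp: representable_def squares_def)

lemma representable_simps:
  "Idt (pcat (representable C t) x) g = vsqid C g"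
  "Cmp (pcat (representable C t) x) \<alpha> \<beta> = vsq C \<alpha> \<beta>"
  "Dom (pcat (representable C t) x) = stop C"
  "Cod (pcat (representable C t) x) = sbot C"
  "fo (pfun (representable C t) f) g = hcmp C g f"
  "fa (pfun (representable C t) f) \<eta> = hsq C \<eta> (vsqid C f)"
  "El (pprof (representable C t) u) g g' = squares C u g g' (vid C t)"
  "Act (pprof (representable C t) u) \<kappa> \<kappa>' \<eta> = vsq C \<kappa>' (vsq C \<eta> \<kappa>)"
  "psq (representable C t) \<alpha> g g' \<eta> = hsq C \<eta> \<alpha>"
  "pmu (representable C t) u u' g g'' c = the_elem ((\<lambda>(g', \<alpha>', \<alpha>). vsq C \<alpha>' \<alpha>) ` c)"
  by (simp_all add: representable_def)

lemmas rep_simps = hom_representable Obj_representable Arr_representable representable_simps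

lemma category_representable:
  assumes t: "t \<in> Ob C" and x: "x \<in> Ob C"
  shows "category (pcat (representable C t) x)"
proof unfold_locales
  have v: "vdom C (vid C z) = z" "vcod C (vid C z) = z" if "z \<in> Ob C" for z
    using vid_in[OF that] by (auto simp: vhom_def)
  fix f assume "f \<in> Arr (pcat (representable C t) x)"
  then show "Dom (pcat (representable C t) x) f \<in> Obj (pcat (representable C t) x)"
    "Cod (pcat (representable C t) x) f \<in> Obj (pcat (representable C t) x)"
    using squares_top squares_bot v t x by (metis rep_simps(2,3,6,7))+
next
  fix g assume "g \<in> Obj (pcat (representable C t) x)"
  then show "Idt (pcat (representable C t) x) g \<in> hom (pcat (representable C t) x) g g"
    by (simp add: rep_simps vsqid_boundary)
next
  fix f a b g c
  assume "f \<in> hom (pcat (representable C t) x) a b" "g \<in> hom (pcat (representable C t) x) b c"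
  then show "Cmp (pcat (representable C t) x) g f \<in> hom (pcat (representable C t) x) a c"
    using vsq_over_vid[OF t] vid_vcmp_vid[OF x] by (fastforce simp: rep_simps)
qed (auto simp: rep_simps vsq_vsqid vsqid_vsq intro: vsq_assoc)

lemma cat_functor_representable:
  assumes t: "t \<in> Ob C" and f: "f \<in> hhom C x y"
  shows "cat_functor (pcat (representable C t) y) (pcat (representable C t) x)
           (pfun (representable C t) f)"
proof -
  have xy: "x \<in> Ob C" "y \<in> Ob C" using hhom_obs[OF f] by auto
  show ?thesis
    by (intro cat_functor.intro)
      (auto simp: category_representable t xy rep_simps
        intro: hcmp_in[OF f] hsq_boundary[OF vsqid_boundary[OF f]]
          vsqid_hcmp[OF f] interchange[OF vsqid_boundary[OF f] _ vsqid_boundary[OF f], symmetric,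
             unfolded vsq_vsqid_vsqid[OF f]])
qed

lemma profunctor_representable:
  assumes t: "t \<in> Ob C" and u: "u \<in> vhom C x x'"
  shows "profunctor (pcat (representable C t) x) (pcat (representable C t) x')
           (pprof (representable C t) u)"
proof -
  have xx: "x \<in> Ob C" "x' \<in> Ob C" using vhom_obs[OF u] by auto
  show ?thesis
  proof (intro profunctor.intro)
    fix g c b f a f' a' b' g' c' s
    assume "g \<in> hom (pcat (representable C t) x) c b" "f \<in> hom (pcat (representable C t) x) b a"
      "f' \<in> hom (pcat (representable C t) x') a' b'" "g' \<in> hom (pcat (representable C t) x') b' c'"
      "s \<in> El (pprof (representable C t) u) a a'"
    then have *: "g \<in> squares C (vid C x) c b (vid C t)" "f \<in> squares C (vid C x) b a (vid C t)"
      "f' \<in> squares C (vid C x') a' b' (vid C t)" "g' \<in> squares C (vid C x') b' c' (vid C t)"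
      "s \<in> squares C u a a' (vid C t)" by (simp_all add: rep_simps)
    have 1: "vsq C (vsq C g' f') (vsq C s (vsq C f g)) = vsq C g' (vsq C f' (vsq C s (vsq C f g)))"
      by (rule vsq_assoc[symmetric]) (use * in \<open>blast intro: vsq_over_vid[OF t]\<close>)+
    have 2: "vsq C s (vsq C f g) = vsq C (vsq C s f) g"
      by (rule vsq_assoc) (use * in \<open>blast intro: vsq_over_vid[OF t]\<close>)+
    have 3: "vsq C f' (vsq C (vsq C s f) g) = vsq C (vsq C f' (vsq C s f)) g"
      by (rule vsq_assoc) (use * in \<open>blast intro: vsq_over_vid[OF t]\<close>)+
    show "Act (pprof (representable C t) u) (Cmp (pcat (representable C t) x) f g)
        (Cmp (pcat (representable C t) x') g' f') s =
       Act (pprof (representable C t) u) g g' (Act (pprof (representable C t) u) f f' s)"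
      unfolding representable_simps 1 unfolding 2 unfolding 3 ..
  qed (auto simp: category_representable t xx rep_simps vsq_vsqid vsqid_vsq
      intro: vsq_whisker[OF t u])
qed

text \<open>Generators of the coend relation move a square over \<open>e\<^sub>x\<^sub>'\<close> from one factor to the other; by
associativity this does not change the pasting of the two factors.  Hence the pasting is constant on
classes and \<open>pmu\<close> of a representable is pasting.\<close>

lemma representable_class:
  assumes t: "t \<in> Ob C" and u: "u \<in> vhom C x x'" and u': "u' \<in> vhom C x' x''"
    and s: "s \<in> squares C u g g' (vid C t)" and s': "s' \<in> squares C u' g' g'' (vid C t)"
    and p: "(h, r', r) \<in> pclass C (representable C t) u u' g g'' g' s' s"
  shows "r' \<in> squares C u' h g'' (vid C t) \<and> r \<in> squares C u g h (vid C t) \<and>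
    vsq C r' r = vsq C s' s"
proof -
  let ?R = "coend_gen (pcat (representable C t) x) (pcat (representable C t) x')
     (pcat (representable C t) x'') (pprof (representable C t) u') (pprof (representable C t) u) g g''"
  let ?P = "\<lambda>(h, r', r). r' \<in> squares C u' h g'' (vid C t) \<and> r \<in> squares C u g h (vid C t) \<and>
    vsq C r' r = vsq C s' s"
  have d: "vdom C u = x" "vcod C u = x'" "vcod C u' = x''" using u u' by (auto simp: vhom_def)
  have inv: "?P q \<longleftrightarrow> ?P p" if pq_gen: "(p, q) \<in> ?R" for p q
  proof -
    obtain b b' k m' m where pq: "p = (b', m', vsq C k (vsq C m (vsqid C g)))"
      "q = (b, vsq C (vsqid C g'') (vsq C m' k), m)" and
      k: "k \<in> squares C (vid C x') b b' (vid C t)" and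
      m': "m' \<in> squares C u' b' g'' (vid C t)" and m: "m \<in> squares C u g b (vid C t)"
      using pq_gen by (auto simp: coend_gen_def rep_simps)
    have "vsq C k m \<in> squares C u g b' (vid C t)"
      using vsq_over_vid[OF t m k] u by (simp add: vid_vcmp)
    moreover have m'k: "vsq C m' k \<in> squares C u' b g'' (vid C t)"
      using vsq_over_vid[OF t k m'] u' by (simp add: vcmp_vid)
    moreover have "vsq C m' (vsq C k m) = vsq C (vsq C m' k) m"
      by (rule vsq_assoc[OF m k m'])
    ultimately show ?thesis using m m' by (simp add: pq vsq_vsqid[OF m] vsqid_vsq[OF m'k])
  qed
  have "((g', s', s), (h, r', r)) \<in> (?R \<union> ?R\<inverse>)\<^sup>*"
    using p by (simp add: pclass_def coend_class_def coend_rel_def d)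
  then have "?P (h, r', r)"
  proof (induction rule: rtrancl_induct)
    case base then show ?case using s s' by simp
  next
    case (step y z)
    have "?P y \<longleftrightarrow> ?P z" using step.hyps(2)
    proof (rule UnE)
      assume "(y, z) \<in> ?R" then show ?thesis by (rule inv[symmetric])
    next
      assume "(y, z) \<in> ?R\<inverse>"
      then have "(z, y) \<in> ?R" by (rule converseD)
      then show ?thesis by (rule inv)
    qed
    then show ?case using step.IH by (rule iffD1)
  qed
  then show ?thesis by simp
qed

lemma pmu_representable:
  assumes t: "t \<in> Ob C" and u: "u \<in> vhom C x x'" and u': "u' \<in> vhom C x' x''"
    and s: "s \<in> squares C u g g' (vid C t)" and s': "s' \<in> squares C u' g' g'' (vid C t)"
  shows "pmu (representable C t) u u' h h' (pclass C (representable C t) u u' g g'' g' s' s) =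
    vsq C s' s"
proof -
  let ?c = "pclass C (representable C t) u u' g g'' g' s' s"
  have "(\<lambda>(g', \<alpha>', \<alpha>). vsq C \<alpha>' \<alpha>) ` ?c = (\<lambda>_. vsq C s' s) ` ?c"
  proof (rule image_cong[OF refl])
    fix p assume p: "p \<in> ?c"
    obtain h r' r where "p = (h, r', r)" by (cases p)
    then show "(\<lambda>(g', \<alpha>', \<alpha>). vsq C \<alpha>' \<alpha>) p = vsq C s' s"
      using representable_class[OF t u u' s s', of h r' r] p by simp
  qed
  also have "\<dots> = {vsq C s' s}" by (rule image_constant[OF pclass_refl])
  finally show ?thesis by (simp add: rep_simps)
qed

text \<open>The action on a coend is a union of classes over all representatives.  Each of these classes consists
of factorizations of the same pasting, so \<open>pmu\<close> reads off that pasting from the whole union.\<close>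

lemma representable_pmu_nat:
  assumes t: "t \<in> Ob C" and u: "u \<in> vhom C x x'" and u': "u' \<in> vhom C x' x''"
  defines "X \<equiv> representable C t"
  shows "prof_nat (pcat X x) (pcat X x'') func_id func_id
        (prof_comp (pcat X x) (pcat X x') (pcat X x'') (pprof X u') (pprof X u))
        (pprof X (vcmp C u' u)) (pmu X u u')"
proof -
  let ?U = "prof_comp (pcat X x) (pcat X x') (pcat X x'') (pprof X u') (pprof X u)"
  have d: "vdom C u = x" "vcod C u = x'" "vcod C u' = x''" using u u' by (auto simp: vhom_def)
  have ex: "\<exists>g' s' s. c = pclass C X u u' g g'' g' s' s \<and> s \<in> squares C u g g' (vid C t) \<and>
      s' \<in> squares C u' g' g'' (vid C t)" if "c \<in> El ?U g g''" for c g g''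
    using that
    by (auto simp: prof_comp_def pclass_def coend_class_def d quotient_def coend_pairs_def X_def rep_simps)
  show ?thesis unfolding prof_nat_def
  proof (intro conjI ballI)
    fix g g'' c assume "c \<in> El ?U g g''"
    then obtain g' s' s where "c = pclass C X u u' g g'' g' s' s" 
      "s \<in> squares C u g g' (vid C t)" "s' \<in> squares C u' g' g'' (vid C t)" using ex by blast
    then show "pmu X u u' g g'' c \<in> El (pprof X (vcmp C u' u)) (fo func_id g) (fo func_id g'')"
      using pmu_representable[OF t u u'] vsq_over_vid[OF t]
      by (simp add: X_def func_id_def rep_simps(10))
  next
    fix f f'' c assume f: "f \<in> Arr (pcat X x)" and f'': "f'' \<in> Arr (pcat X x'')"
      and "c \<in> El ?U (Cod (pcat X x) f) (Dom (pcat X x'') f'')"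
    then obtain g' s' s where c: "c = pclass C X u u' (sbot C f) (stop C f'') g' s' s"
      and s: "s \<in> squares C u (sbot C f) g' (vid C t)"
      and s': "s' \<in> squares C u' g' (stop C f'') (vid C t)"
      using ex unfolding X_def rep_simps by blast
    have f: "f \<in> squares C (vid C x) (stop C f) (sbot C f) (vid C t)"
      and f'': "f'' \<in> squares C (vid C x'') (stop C f'') (sbot C f'') (vid C t)"
      using f f'' by (simp_all only: X_def rep_simps)
    have vs: "vsq C q' q = vsq C f'' (vsq C (vsq C s' s) f)"
      if h: "(h, r', r) \<in> c" and q: "(k, q', q) \<in> pclass C X u u' (stop C f) (sbot C f'') h
         (vsq C f'' (vsq C r' (vsqid C h))) (vsq C (vsqid C h) (vsq C r f))" for h r' r k q' q
    proof -
      have r: "r' \<in> squares C u' h (stop C f'') (vid C t)" "r \<in> squares C u (sbot C f) h (vid C t)"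
        "vsq C r' r = vsq C s' s"
        using representable_class[OF t u u' s s'] h unfolding c X_def by blast+
      have fr': "vsq C f'' r' \<in> squares C u' h (sbot C f'') (vid C t)"
        using vsq_over_vid[OF t r(1) f''] u' by (simp add: vid_vcmp)
      have rf: "vsq C r f \<in> squares C u (stop C f) h (vid C t)"
        using vsq_over_vid[OF t f r(2)] u by (simp add: vcmp_vid)
      have "vsq C q' q = vsq C (vsq C f'' r') (vsq C r f)"
        using representable_class[OF t u u' rf fr', of k q' q] q
        by (simp add: X_def vsq_vsqid[OF r(1)] vsqid_vsq[OF rf])
      also have "\<dots> = vsq C f'' (vsq C r' (vsq C r f))"
        by (rule vsq_assoc[OF rf r(1) f'', symmetric])
      also have "vsq C r' (vsq C r f) = vsq C (vsq C r' r) f"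
        by (rule vsq_assoc[OF f r(2) r(1)])
      finally show ?thesis by (simp add: r)
    qed
    have ne: "(g', s', s) \<in> c"
      unfolding c by (rule pclass_refl)
    let ?I = "\<lambda>c. (\<lambda>(g', \<alpha>', \<alpha>). vsq C \<alpha>' \<alpha>) ` c"
    have act: "Act ?U f f'' c = (\<Union>(h, r', r)\<in>c. pclass C X u u' (stop C f) (sbot C f'') h
         (vsq C f'' (vsq C r' (vsqid C h))) (vsq C (vsqid C h) (vsq C r f)))"
      by (simp add: prof_comp_def X_def rep_simps pclass_def d)
    have "?I (Act ?U f f'' c) \<subseteq> {vsq C f'' (vsq C (vsq C s' s) f)}"
    proof
      fix z assume "z \<in> ?I (Act ?U f f'' c)"
      then obtain p where p: "p \<in> Act ?U f f'' c" and z: "z = (\<lambda>(g', \<alpha>', \<alpha>). vsq C \<alpha>' \<alpha>) p"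
        by (rule imageE)
      obtain k q' q where p': "p = (k, q', q)" by (cases p)
      obtain w where w: "w \<in> c" and pw: "p \<in> (\<lambda>(h, r', r). pclass C X u u' (stop C f) (sbot C f'') h
          (vsq C f'' (vsq C r' (vsqid C h))) (vsq C (vsqid C h) (vsq C r f))) w"
        using p unfolding act by (rule UN_E)
      obtain h r' r where w': "w = (h, r', r)" by (cases w)
      have h: "(h, r', r) \<in> c" using w unfolding w' .
      have q: "(k, q', q) \<in> pclass C X u u' (stop C f) (sbot C f'') h
          (vsq C f'' (vsq C r' (vsqid C h))) (vsq C (vsqid C h) (vsq C r f))"
        using pw unfolding w' p' prod.case .
      have z: "z = vsq C q' q" using z unfolding p' prod.case .
      show "z \<in> {vsq C f'' (vsq C (vsq C s' s) f)}" unfolding z vs[OF h q] by simp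
    qed
    moreover have "(g', vsq C f'' (vsq C s' (vsqid C g')), vsq C (vsqid C g') (vsq C s f)) \<in> Act ?U f f'' c"
      unfolding act
      by (rule UN_I[OF ne]) (simp only: prod.case pclass_refl)
    ultimately have "?I (Act ?U f f'' c) = {vsq C f'' (vsq C (vsq C s' s) f)}"
      by (metis empty_iff image_is_empty subset_singletonD)
    then have "pmu X u u' h k (Act ?U f f'' c) = vsq C f'' (vsq C (vsq C s' s) f)" for h k
      unfolding X_def rep_simps(13) by (metis the_elem_eq)
    moreover have "pmu X u u' (sbot C f) (stop C f'') c = vsq C s' s"
      unfolding X_def c by (rule pmu_representable[OF t u u' s s'])
    ultimately show "pmu X u u' (Dom (pcat X x) f) (Cod (pcat X x'') f'') (Act ?U f f'' c) =
       Act (pprof X (vcmp C u' u)) (fa func_id f) (fa func_id f'')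
         (pmu X u u' (Cod (pcat X x) f) (Dom (pcat X x'') f'') c)"
      unfolding X_def rep_simps(6,7,11) func_id_def func.simps by (simp only:)
  qed
qed

text \<open>Whiskering a square \<open>s\<close> over \<open>v\<close> by globular squares and then restricting along
\<open>\<alpha>\<close> can be interchanged once \<open>\<alpha>\<close> is written as \<open>\<alpha> \<bullet> e\<^sub>f\<close>, respectively as
\<open>e\<^sub>f\<^sub>' \<bullet> \<alpha>\<close>.\<close>

lemma representable_psq_nat:
  assumes t: "t \<in> Ob C" and \<alpha>: "\<alpha> \<in> squares C u f f' v"
  defines "X \<equiv> representable C t"
  shows "prof_nat (pcat X (vdom C v)) (pcat X (vcod C v)) (pfun X f) (pfun X f')
        (pprof X v) (pprof X u) (psq X \<alpha>)"
  unfolding prof_nat_def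
proof (intro conjI ballI)
  fix g g' s assume "s \<in> El (pprof X v) g g'"
  then show "psq X \<alpha> g g' s \<in> El (pprof X u) (fo (pfun X f) g) (fo (pfun X f') g')"
    by (simp add: X_def representable_simps hsq_boundary[OF \<alpha>])
next
  fix k k' s assume "k \<in> Arr (pcat X (vdom C v))" "k' \<in> Arr (pcat X (vcod C v))"
    "s \<in> El (pprof X v) (Cod (pcat X (vdom C v)) k) (Dom (pcat X (vcod C v)) k')"
  then have k: "k \<in> squares C (vid C (vdom C v)) (stop C k) (sbot C k) (vid C t)"
    and k': "k' \<in> squares C (vid C (vcod C v)) (stop C k') (sbot C k') (vid C t)"
    and s: "s \<in> squares C v (sbot C k) (stop C k') (vid C t)"
    by (simp_all only: X_def rep_simps)
  have f: "vsqid C f \<in> squares C (vid C (vdom C u)) f f (vid C (vdom C v))"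
    by (rule vsqid_boundary[OF squares_top[OF \<alpha>]])
  have f': "vsqid C f' \<in> squares C (vid C (vcod C u)) f' f' (vid C (vcod C v))"
    by (rule vsqid_boundary[OF squares_bot[OF \<alpha>]])
  have v: "v \<in> vhom C (vdom C v) (vcod C v)" by (rule Ver_vhom[OF squares_right[OF \<alpha>]])
  have sk: "vsq C s k \<in> squares C v (stop C k) (stop C k') (vid C t)"
    using vsq_over_vid[OF t k s] by (simp add: vcmp_vid[OF v])
  have "hsq C (vsq C s k) \<alpha> = hsq C (vsq C s k) (vsq C \<alpha> (vsqid C f))"
    by (simp add: vsq_vsqid[OF \<alpha>])
  also have "\<dots> = vsq C (hsq C s \<alpha>) (hsq C k (vsqid C f))"
    by (rule interchange[OF f k \<alpha> s, symmetric])
  finally have 1: "hsq C (vsq C s k) \<alpha> = vsq C (hsq C s \<alpha>) (hsq C k (vsqid C f))" .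
  have "hsq C (vsq C k' (vsq C s k)) \<alpha> = hsq C (vsq C k' (vsq C s k)) (vsq C (vsqid C f') \<alpha>)"
    by (simp add: vsqid_vsq[OF \<alpha>])
  also have "\<dots> = vsq C (hsq C k' (vsqid C f')) (hsq C (vsq C s k) \<alpha>)"
    by (rule interchange[OF \<alpha> sk f' k', symmetric])
  finally show "psq X \<alpha> (Dom (pcat X (vdom C v)) k) (Cod (pcat X (vcod C v)) k')
        (Act (pprof X v) k k' s) =
       Act (pprof X u) (fa (pfun X f) k) (fa (pfun X f') k')
        (psq X \<alpha> (Cod (pcat X (vdom C v)) k) (Dom (pcat X (vcod C v)) k') s)"
    unfolding X_def representable_simps 1 .
qed

theorem lax_double_presheaf_representable:
  assumes t: "t \<in> Ob C"
  shows "lax_double_presheaf C (representable C t)"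
proof (intro lax_double_presheaf.intro)
  show "double_category C" by (rule double_category_axioms)
next
  fix x assume "x \<in> Ob C" then show "category (pcat (representable C t) x)"
    by (rule category_representable[OF t])
next
  fix f x y assume "f \<in> hhom C x y"
  then show "cat_functor (pcat (representable C t) y) (pcat (representable C t) x)
      (pfun (representable C t) f)"
    by (rule cat_functor_representable[OF t])
next
  fix u x x' assume "u \<in> vhom C x x'"
  then show "profunctor (pcat (representable C t) x) (pcat (representable C t) x')
      (pprof (representable C t) u)"
    by (rule profunctor_representable[OF t])
next
  fix \<alpha> u f f' v assume "\<alpha> \<in> squares C u f f' v"
  then show "prof_nat (pcat (representable C t) (vdom C v)) (pcat (representable C t) (vcod C v))
        (pfun (representable C t) f) (pfun (representable C t) f')
        (pprof (representable C t) v) (pprof (representable C t) u) (psq (representable C t) \<alpha>)"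
    by (rule representable_psq_nat[OF t])
next
  fix u x x' u' x'' assume "u \<in> vhom C x x'" "u' \<in> vhom C x' x''"
  then show "prof_nat (pcat (representable C t) x) (pcat (representable C t) x'') func_id func_id
        (prof_comp (pcat (representable C t) x) (pcat (representable C t) x')
          (pcat (representable C t) x'') (pprof (representable C t) u')
          (pprof (representable C t) u))
        (pprof (representable C t) (vcmp C u' u)) (pmu (representable C t) u u')"
    by (rule representable_pmu_nat[OF t])
next
  fix f x y g z assume f: "f \<in> hhom C x y" and g: "g \<in> hhom C y z"
  have "hsq C \<eta> (vsqid C (hcmp C g f)) = hsq C (hsq C \<eta> (vsqid C g)) (vsqid C f)"
    if "\<eta> \<in> squares C (vid C z) h h' (vid C t)" for \<eta> h h'
    using hsq_assoc[OF vsqid_boundary[OF f] vsqid_boundary[OF g] that] vsqid_hcmp[OF f g] by simp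
  then show "func_eq (pcat (representable C t) z) (pfun (representable C t) (hcmp C g f))
        (func_comp (pfun (representable C t) f) (pfun (representable C t) g))"
    by (auto simp: func_eq_def func_comp_def rep_simps hcmp_assoc[OF f g])
next
  fix x assume x: "x \<in> Ob C"
  have "hsq C \<eta> (vsqid C (hid C x)) = \<eta>" if "\<eta> \<in> squares C (vid C x) h h' (vid C t)" for \<eta> h h'
    using hsq_hsqid[OF that] by (simp add: vsqid_hid[OF x])
  then show "func_eq (pcat (representable C t) x) (pfun (representable C t) (hid C x)) func_id"
    by (auto simp: func_eq_def func_id_def rep_simps hcmp_hid)
next
  fix \<alpha> u f f' v \<beta> g g' w c c' s
  assume "\<alpha> \<in> squares C u f f' v" "\<beta> \<in> squares C v g g' w" "s \<in> El (pprof (representable C t) w) c c'"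
  then show "psq (representable C t) (hsq C \<beta> \<alpha>) c c' s = psq (representable C t) \<alpha>
      (fo (pfun (representable C t) g) c) (fo (pfun (representable C t) g') c')
      (psq (representable C t) \<beta> c c' s)"
    unfolding rep_simps by (rule hsq_assoc)
next
  fix u x x' a a' s assume "s \<in> El (pprof (representable C t) u) a a'"
  then show "psq (representable C t) (hsqid C u) a a' s = s"
    unfolding rep_simps by (rule hsq_hsqid)
next
  fix \<alpha> u f f' v \<alpha>' u' f'' v' b b' b'' s s'
  assume \<alpha>: "\<alpha> \<in> squares C u f f' v" and \<alpha>': "\<alpha>' \<in> squares C u' f' f'' v'"
    and "s \<in> El (pprof (representable C t) v) b b'" "s' \<in> El (pprof (representable C t) v') b' b''"
  then have s: "s \<in> squares C v b b' (vid C t)" and s': "s' \<in> squares C v' b' b'' (vid C t)"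
    by (simp_all only: rep_simps)
  have v: "vcod C v = vdom C v'"
    using squares_bot[OF \<alpha>] squares_top[OF \<alpha>'] by (simp add: hhom_def)
  have u: "vcod C u = vdom C u'"
    using squares_bot[OF \<alpha>] squares_top[OF \<alpha>'] by (simp add: hhom_def)
  have v: "v \<in> vhom C (vdom C v) (vcod C v)" "v' \<in> vhom C (vcod C v) (vcod C v')"
    using squares_right[OF \<alpha>] squares_right[OF \<alpha>'] v by (auto simp: vhom_def)
  have u: "u \<in> vhom C (vdom C u) (vcod C u)" "u' \<in> vhom C (vcod C u) (vcod C u')"
    using squares_left[OF \<alpha>] squares_left[OF \<alpha>'] u by (auto simp: vhom_def)
  show "psq (representable C t) (vsq C \<alpha>' \<alpha>) b b'' (pmu (representable C t) v v' b b''
         (pclass C (representable C t) v v' b b'' b' s' s)) =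
      pmu (representable C t) u u' (fo (pfun (representable C t) f) b)
        (fo (pfun (representable C t) f'') b'')
        (pclass C (representable C t) u u' (fo (pfun (representable C t) f) b)
          (fo (pfun (representable C t) f'') b'') (fo (pfun (representable C t) f') b')
          (psq (representable C t) \<alpha>' b' b'' s') (psq (representable C t) \<alpha> b b' s))"
    unfolding pmu_representable[OF t v s s'] unfolding rep_simps(8,9,12)
      pmu_representable[OF t u hsq_boundary[OF \<alpha> s] hsq_boundary[OF \<alpha>' s']]
    by (rule interchange[OF \<alpha> s \<alpha>' s', symmetric])
next
  fix u x x' u' x'' u'' y a a' a'' b s s' s''
  assume u: "u \<in> vhom C x x'" "u' \<in> vhom C x' x''" "u'' \<in> vhom C x'' y"
    and "s \<in> El (pprof (representable C t) u) a a'" "s' \<in> El (pprof (representable C t) u') a' a''"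
      "s'' \<in> El (pprof (representable C t) u'') a'' b"
  then have s: "s \<in> squares C u a a' (vid C t)" "s' \<in> squares C u' a' a'' (vid C t)"
    "s'' \<in> squares C u'' a'' b (vid C t)"
    by (simp_all only: rep_simps)
  show "pmu (representable C t) u (vcmp C u'' u') a b (pclass C (representable C t) u
          (vcmp C u'' u') a b a'
        (pmu (representable C t) u' u'' a' b (pclass C (representable C t) u' u'' a' b a'' s'' s')) s) =
      pmu (representable C t) (vcmp C u' u) u'' a b (pclass C (representable C t)
        (vcmp C u' u) u'' a b a''
        s'' (pmu (representable C t) u u' a a'' (pclass C (representable C t) u u' a a'' a' s' s)))"
    unfolding pmu_representable[OF t u(1,2) s(1,2)] pmu_representable[OF t u(2,3) s(2,3)]
      pmu_representable[OF t u(1) vcmp_in[OF u(2,3)] s(1) vsq_over_vid[OF t s(2,3)]]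
      pmu_representable[OF t vcmp_in[OF u(1,2)] u(3) vsq_over_vid[OF t s(1,2)] s(3)]
    by (rule vsq_assoc[OF s, symmetric])
next
  fix x assume "x \<in> Ob C"
  show "prof_eq (pcat (representable C t) x) (pcat (representable C t) x)
     (pprof (representable C t) (vid C x)) (hom_prof (pcat (representable C t) x))"
    by (simp add: prof_eq_def hom_prof_def rep_simps)
next
  fix f x y k b b'
  show "psq (representable C t) (vsqid C f) b b' k = fa (pfun (representable C t) f) k"
    by (simp add: rep_simps)
next
  fix u x x' k a b a' s
  assume u: "u \<in> vhom C x x'" and "k \<in> hom (pcat (representable C t) x) a b"
    and "s \<in> El (pprof (representable C t) u) b a'"
  then have k: "k \<in> squares C (vid C x) a b (vid C t)" and s: "s \<in> squares C u b a' (vid C t)"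
    by (simp_all only: rep_simps)
  have x: "x \<in> Ob C" using vhom_obs[OF u] by simp
  show "pmu (representable C t) (vid C x) u a a' (pclass C (representable C t) (vid C x) u a a' b s k) =
      Act (pprof (representable C t) u) k (Idt (pcat (representable C t) x') a') s"
    unfolding pmu_representable[OF t vid_in[OF x] u k s]
    using vsqid_vsq[OF vsq_over_vid[OF t k s]] by (simp only: rep_simps)
next
  fix u x x' a k' b' a' s
  assume u: "u \<in> vhom C x x'" and "k' \<in> hom (pcat (representable C t) x') b' a'"
    and "s \<in> El (pprof (representable C t) u) a b'"
  then have k: "k' \<in> squares C (vid C x') b' a' (vid C t)" and s: "s \<in> squares C u a b' (vid C t)"
    by (simp_all only: rep_simps)
  have x: "x' \<in> Ob C" using vhom_obs[OF u] by simp
  show "pmu (representable C t) u (vid C x') a a' (pclass C (representable C t) u (vid C x') a a' b' k' s) =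
      Act (pprof (representable C t) u) (Idt (pcat (representable C t) x) a) k' s"
    unfolding pmu_representable[OF t u vid_in[OF x] s k]
    using vsq_vsqid[OF s] by (simp only: rep_simps)
qed

end

section \<open>The Grothendieck construction is a double category\<close>

text \<open>The defining axioms speak of four categories of arrows.  Stated for cells with a given boundary, the
same laws can be checked one by one on the concrete tuples that form the cells of a Grothendieck
construction.\<close>

lemma double_categoryI:
  assumes hor: "\<And>f x y. f \<in> hhom C x y \<Longrightarrow> x \<in> Ob C \<and> y \<in> Ob C"
      "\<And>f x y g z. f \<in> hhom C x y \<Longrightarrow> g \<in> hhom C y z \<Longrightarrow> hcmp C g f \<in> hhom C x z"
      "\<And>f x y g z h w. f \<in> hhom C x y \<Longrightarrow> g \<in> hhom C y z \<Longrightarrow> h \<in> hhom C z w \<Longrightarrow>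
        hcmp C h (hcmp C g f) = hcmp C (hcmp C h g) f"
      "\<And>x. x \<in> Ob C \<Longrightarrow> hid C x \<in> hhom C x x"
      "\<And>f x y. f \<in> hhom C x y \<Longrightarrow> hcmp C f (hid C x) = f"
      "\<And>f x y. f \<in> hhom C x y \<Longrightarrow> hcmp C (hid C y) f = f"
    and ver: "\<And>u x y. u \<in> vhom C x y \<Longrightarrow> x \<in> Ob C \<and> y \<in> Ob C"
      "\<And>u x y v z. u \<in> vhom C x y \<Longrightarrow> v \<in> vhom C y z \<Longrightarrow> vcmp C v u \<in> vhom C x z"
      "\<And>u x y v z w z'. u \<in> vhom C x y \<Longrightarrow> v \<in> vhom C y z \<Longrightarrow> w \<in> vhom C z z' \<Longrightarrow>
        vcmp C w (vcmp C v u) = vcmp C (vcmp C w v) u"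
      "\<And>x. x \<in> Ob C \<Longrightarrow> vid C x \<in> vhom C x x"
      "\<And>u x y. u \<in> vhom C x y \<Longrightarrow> vcmp C u (vid C x) = u"
      "\<And>u x y. u \<in> vhom C x y \<Longrightarrow> vcmp C (vid C y) u = u"
    and boundary: "\<And>\<alpha> u f f' v. \<alpha> \<in> squares C u f f' v \<Longrightarrow> \<exists>x y x' y'.
        u \<in> vhom C x x' \<and> v \<in> vhom C y y' \<and> f \<in> hhom C x y \<and> f' \<in> hhom C x' y'"
    and hsq: "\<And>\<alpha> u f f' v \<beta> g g' w. \<alpha> \<in> squares C u f f' v \<Longrightarrow> \<beta> \<in> squares C v g g' w \<Longrightarrow>
        hsq C \<beta> \<alpha> \<in> squares C u (hcmp C g f) (hcmp C g' f') w"
      "\<And>u x x'. u \<in> vhom C x x' \<Longrightarrow> hsqid C u \<in> squares C u (hid C x) (hid C x') u"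
      "\<And>\<alpha> u f f' v \<beta> g g' w \<gamma> h h' z. \<alpha> \<in> squares C u f f' v \<Longrightarrow> \<beta> \<in> squares C v g g' w \<Longrightarrow>
        \<gamma> \<in> squares C w h h' z \<Longrightarrow> hsq C \<gamma> (hsq C \<beta> \<alpha>) = hsq C (hsq C \<gamma> \<beta>) \<alpha>"
      "\<And>\<alpha> u f f' v. \<alpha> \<in> squares C u f f' v \<Longrightarrow> hsq C \<alpha> (hsqid C u) = \<alpha>"
      "\<And>\<alpha> u f f' v. \<alpha> \<in> squares C u f f' v \<Longrightarrow> hsq C (hsqid C v) \<alpha> = \<alpha>"
    and vsq: "\<And>\<alpha> u f f' v \<alpha>' u' f'' v'. \<alpha> \<in> squares C u f f' v \<Longrightarrow> \<alpha>' \<in> squares C u' f' f'' v' \<Longrightarrow>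
        vsq C \<alpha>' \<alpha> \<in> squares C (vcmp C u' u) f f'' (vcmp C v' v)"
      "\<And>f x y. f \<in> hhom C x y \<Longrightarrow> vsqid C f \<in> squares C (vid C x) f f (vid C y)"
      "\<And>\<alpha> u f f' v \<beta> u' f'' v' \<gamma> u'' g v''. \<alpha> \<in> squares C u f f' v \<Longrightarrow> \<beta> \<in> squares C u' f' f'' v' \<Longrightarrow>
        \<gamma> \<in> squares C u'' f'' g v'' \<Longrightarrow> vsq C \<gamma> (vsq C \<beta> \<alpha>) = vsq C (vsq C \<gamma> \<beta>) \<alpha>"
      "\<And>\<alpha> u f f' v. \<alpha> \<in> squares C u f f' v \<Longrightarrow> vsq C \<alpha> (vsqid C f) = \<alpha>"
      "\<And>\<alpha> u f f' v. \<alpha> \<in> squares C u f f' v \<Longrightarrow> vsq C (vsqid C f') \<alpha> = \<alpha>"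
    and interchange: "\<And>\<alpha> u f f' v \<beta> g g' w \<alpha>' u' f'' v' \<beta>' g'' w'.
       \<alpha> \<in> squares C u f f' v \<Longrightarrow> \<beta> \<in> squares C v g g' w \<Longrightarrow>
       \<alpha>' \<in> squares C u' f' f'' v' \<Longrightarrow> \<beta>' \<in> squares C v' g' g'' w' \<Longrightarrow>
       vsq C (hsq C \<beta>' \<alpha>') (hsq C \<beta> \<alpha>) = hsq C (vsq C \<beta>' \<beta>) (vsq C \<alpha>' \<alpha>)"
      "\<And>f x y g z. f \<in> hhom C x y \<Longrightarrow> g \<in> hhom C y z \<Longrightarrow>
        hsq C (vsqid C g) (vsqid C f) = vsqid C (hcmp C g f)"
      "\<And>u x x' u' x''. u \<in> vhom C x x' \<Longrightarrow> u' \<in> vhom C x' x'' \<Longrightarrow>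
        vsq C (hsqid C u') (hsqid C u) = hsqid C (vcmp C u' u)"
      "\<And>x. x \<in> Ob C \<Longrightarrow> vsqid C (hid C x) = hsqid C (vid C x)"
  shows "double_category C"
proof (intro double_category.intro)
  have hh: "hom (hcat C) x y = hhom C x y" for x y by (auto simp: hcat_def hom_def hhom_def)
  have Arr: "f \<in> Arr (hcat C) \<Longrightarrow> f \<in> hhom C (hdom C f) (hcod C f)" for f
    by (simp add: hcat_def hhom_def)
  have sel: "Obj (hcat C) = Ob C" "Dom (hcat C) = hdom C" "Cod (hcat C) = hcod C"
    "Cmp (hcat C) = hcmp C" "Idt (hcat C) = hid C" by (simp_all add: hcat_def)
  show "category (hcat C)"
    by (rule category.intro; (drule Arr)?; unfold hh sel; blast intro: hor dest: hor(1))
  have vh: "hom (vcat C) x y = vhom C x y" for x y by (auto simp: vcat_def hom_def vhom_def)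
  have Arr: "f \<in> Arr (vcat C) \<Longrightarrow> f \<in> vhom C (vdom C f) (vcod C f)" for f
    by (simp add: vcat_def vhom_def)
  have sel: "Obj (vcat C) = Ob C" "Dom (vcat C) = vdom C" "Cod (vcat C) = vcod C"
    "Cmp (vcat C) = vcmp C" "Idt (vcat C) = vid C" by (simp_all add: vcat_def)
  show "category (vcat C)"
    by (rule category.intro; (drule Arr)?; unfold vh sel; blast intro: ver dest: ver(1))
  have D: "u \<in> Ver C \<Longrightarrow> u \<in> vhom C (vdom C u) (vcod C u)" for u by (simp add: vhom_def)
  have hs: "\<alpha> \<in> hom (hsqcat C) u v \<longleftrightarrow> (\<exists>k k'. \<alpha> \<in> squares C u k k' v)" for \<alpha> u v
    by (auto simp: hsqcat_def hom_def squares_def)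
  have Arr: "f \<in> Arr (hsqcat C) \<Longrightarrow> f \<in> squares C (sleft C f) (stop C f) (sbot C f) (sright C f)" for f
    by (simp add: hsqcat_def squares_def)
  have sel: "Obj (hsqcat C) = Ver C" "Dom (hsqcat C) = sleft C" "Cod (hsqcat C) = sright C"
    "Cmp (hsqcat C) = hsq C" "Idt (hsqcat C) = hsqid C" by (simp_all add: hsqcat_def)
  have O: "u \<in> vhom C x y \<Longrightarrow> u \<in> Ver C" for u x y by (auto simp: vhom_def)
  show "category (hsqcat C)"
  proof (rule category.intro; unfold hs sel)
    fix f assume "f \<in> Arr (hsqcat C)"
    then show "sleft C f \<in> Ver C" "sright C f \<in> Ver C"
      using boundary[OF Arr] O by blast+
  next
    fix a assume "a \<in> Ver C"
    then show "\<exists>k k'. hsqid C a \<in> squares C a k k' a" using hsq(2)[OF D] by blast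
  next
    fix f a b g c assume "\<exists>k k'. f \<in> squares C a k k' b" "\<exists>k k'. g \<in> squares C b k k' c"
    then show "\<exists>k k'. hsq C g f \<in> squares C a k k' c" using hsq(1) by blast
  next
    fix f a b g c h d
    assume "\<exists>k k'. f \<in> squares C a k k' b" "\<exists>k k'. g \<in> squares C b k k' c" "\<exists>k k'. h \<in> squares C c k k' d"
    then show "hsq C h (hsq C g f) = hsq C (hsq C h g) f" using hsq(3) by blast
  qed (use hsq(4,5) in blast)+
  have D: "u \<in> Hor C \<Longrightarrow> u \<in> hhom C (hdom C u) (hcod C u)" for u by (simp add: hhom_def)
  have hs: "\<alpha> \<in> hom (vsqcat C) f f' \<longleftrightarrow> (\<exists>k k'. \<alpha> \<in> squares C k f f' k')" for \<alpha> f f'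
    by (auto simp: vsqcat_def hom_def squares_def)
  have Arr: "f \<in> Arr (vsqcat C) \<Longrightarrow> f \<in> squares C (sleft C f) (stop C f) (sbot C f) (sright C f)" for f
    by (simp add: vsqcat_def squares_def)
  have sel: "Obj (vsqcat C) = Hor C" "Dom (vsqcat C) = stop C" "Cod (vsqcat C) = sbot C"
    "Cmp (vsqcat C) = vsq C" "Idt (vsqcat C) = vsqid C" by (simp_all add: vsqcat_def)
  have O: "u \<in> hhom C x y \<Longrightarrow> u \<in> Hor C" for u x y by (auto simp: hhom_def)
  show "category (vsqcat C)"
  proof (rule category.intro; unfold hs sel)
    fix f assume "f \<in> Arr (vsqcat C)"
    then show "stop C f \<in> Hor C" "sbot C f \<in> Hor C"
      using boundary[OF Arr] O by blast+
  next
    fix a assume "a \<in> Hor C"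
    then show "\<exists>k k'. vsqid C a \<in> squares C k a a k'" using vsq(2)[OF D] by blast
  next
    fix f a b g c assume "\<exists>k k'. f \<in> squares C k a b k'" "\<exists>k k'. g \<in> squares C k b c k'"
    then show "\<exists>k k'. vsq C g f \<in> squares C k a c k'" using vsq(1) by blast
  next
    fix f a b g c h d
    assume "\<exists>k k'. f \<in> squares C k a b k'" "\<exists>k k'. g \<in> squares C k b c k'" "\<exists>k k'. h \<in> squares C k c d k'"
    then show "vsq C h (vsq C g f) = vsq C (vsq C h g) f" using vsq(3) by blast
  qed (use vsq(4,5) in blast)+
  fix \<alpha> assume "\<alpha> \<in> Sq C"
  then have "\<alpha> \<in> squares C (sleft C \<alpha>) (stop C \<alpha>) (sbot C \<alpha>) (sright C \<alpha>)" by (simp add: squares_def)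
  then show "hdom C (stop C \<alpha>) = vdom C (sleft C \<alpha>) \<and> hcod C (stop C \<alpha>) = vdom C (sright C \<alpha>) \<and>
      hdom C (sbot C \<alpha>) = vcod C (sleft C \<alpha>) \<and> hcod C (sbot C \<alpha>) = vcod C (sright C \<alpha>)"
    by (auto dest!: boundary simp: hhom_def vhom_def)
qed (fact assms)+

sublocale lax_double_presheaf \<subseteq> double_category C by (rule base)

context lax_double_presheaf begin

lemma fo_in: "f \<in> hhom C x y \<Longrightarrow> b \<in> Obj (pcat X y) \<Longrightarrow> fo (pfun X f) b \<in> Obj (pcat X x)"
  by (rule cat_functor.fo_in[OF functors])

lemma fo_hcmp: "f \<in> hhom C x y \<Longrightarrow> g \<in> hhom C y z \<Longrightarrow> c \<in> Obj (pcat X z) \<Longrightarrow>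
  fo (pfun X (hcmp C g f)) c = fo (pfun X f) (fo (pfun X g) c)"
  using fun_hcmp by (simp add: func_eq_def func_comp_def)

lemma fo_hid: "x \<in> Ob C \<Longrightarrow> b \<in> Obj (pcat X x) \<Longrightarrow> fo (pfun X (hid C x)) b = b"
  using fun_hid by (simp add: func_eq_def func_id_def)

lemma psq_in: "\<alpha> \<in> squares C u f f' v \<Longrightarrow> b \<in> Obj (pcat X (vdom C v)) \<Longrightarrow>
  b' \<in> Obj (pcat X (vcod C v)) \<Longrightarrow> s \<in> El (pprof X v) b b' \<Longrightarrow>
  psq X \<alpha> b b' s \<in> El (pprof X u) (fo (pfun X f) b) (fo (pfun X f') b')"
  using sq_nat by (simp add: prof_nat_def)

lemma mu_in:
  assumes u: "u \<in> vhom C x x'" and u': "u' \<in> vhom C x' x''"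
    and "a \<in> Obj (pcat X x)" "a' \<in> Obj (pcat X x')" "a'' \<in> Obj (pcat X x'')"
    and "s \<in> El (pprof X u) a a'" "s' \<in> El (pprof X u') a' a''"
  shows "pmu X u u' a a'' (pclass C X u u' a a'' a' s' s) \<in> El (pprof X (vcmp C u' u)) a a''"
proof -
  have d: "vdom C u = x" "vcod C u = x'" "vcod C u' = x''" using u u' by (auto simp: vhom_def)
  have "(a', s', s) \<in> coend_pairs (pcat X x') (pprof X u') (pprof X u) a a''"
    using assms by (simp add: coend_pairs_def)
  then have "pclass C X u u' a a'' a' s' s \<in>
      El (prof_comp (pcat X x) (pcat X x') (pcat X x'') (pprof X u') (pprof X u)) a a''"
    by (auto simp: prof_comp_def pclass_def coend_class_def d intro: quotientI)
  then show ?thesis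
    using mu_nat[OF u u'] assms by (simp add: prof_nat_def func_id_def)
qed

lemma El_vid: "x \<in> Ob C \<Longrightarrow> b \<in> Obj (pcat X x) \<Longrightarrow> b' \<in> Obj (pcat X x) \<Longrightarrow>
  El (pprof X (vid C x)) b b' = hom (pcat X x) b b'"
  using prof_vid by (simp add: prof_eq_def hom_prof_def)

lemma Idt_hom: "x \<in> Ob C \<Longrightarrow> b \<in> Obj (pcat X x) \<Longrightarrow> Idt (pcat X x) b \<in> hom (pcat X x) b b"
  by (rule category.Idt_in[OF cat])

lemma Idt_El: "x \<in> Ob C \<Longrightarrow> b \<in> Obj (pcat X x) \<Longrightarrow> Idt (pcat X x) b \<in> El (pprof X (vid C x)) b b"
  by (simp add: El_vid Idt_hom)

lemma Act_Idt: "u \<in> vhom C x x' \<Longrightarrow> b \<in> Obj (pcat X x) \<Longrightarrow> b' \<in> Obj (pcat X x') \<Longrightarrow>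
  s \<in> El (pprof X u) b b' \<Longrightarrow> Act (pprof X u) (Idt (pcat X x) b) (Idt (pcat X x') b') s = s"
  by (rule profunctor.Act_Idt[OF profunctors])

lemma mu_Idt_left: "u \<in> vhom C x x' \<Longrightarrow> b \<in> Obj (pcat X x) \<Longrightarrow> b' \<in> Obj (pcat X x') \<Longrightarrow>
  s \<in> El (pprof X u) b b' \<Longrightarrow>
  pmu X (vid C x) u b b' (pclass C X (vid C x) u b b' b s (Idt (pcat X x) b)) = s"
  using mu_unit_left[of u x x' "Idt (pcat X x) b" b b b' s] vhom_obs[of u x x'] 
  by (simp add: Idt_hom Act_Idt)

lemma mu_Idt_right: "u \<in> vhom C x x' \<Longrightarrow> b \<in> Obj (pcat X x) \<Longrightarrow> b' \<in> Obj (pcat X x') \<Longrightarrow>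
  s \<in> El (pprof X u) b b' \<Longrightarrow>
  pmu X u (vid C x') b b' (pclass C X u (vid C x') b b' b' (Idt (pcat X x') b') s) = s"
  using mu_unit_right[of u x x' b "Idt (pcat X x') b'" b' b' s] vhom_obs[of u x x'] 
  by (simp add: Idt_hom Act_Idt)

lemma psq_vsqid_Idt: "f \<in> hhom C x y \<Longrightarrow> b \<in> Obj (pcat X y) \<Longrightarrow>
  psq X (vsqid C f) b b (Idt (pcat X y) b) = Idt (pcat X x) (fo (pfun X f) b)"
  using sq_vsqid[of f x y "Idt (pcat X y) b" b b] hhom_obs[of f x y] functors[of f x y]
  by (simp add: Idt_hom cat_functor.fa_Idt)

lemma Ob_grothendieck: "(x, b) \<in> Ob (grothendieck C X) \<longleftrightarrow> x \<in> Ob C \<and> b \<in> Obj (pcat X x)"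
  by (simp add: grothendieck_def Let_def)

lemma hhom_grothendieck: "F \<in> hhom (grothendieck C X) p q \<longleftrightarrow>
  (\<exists>x b y c f. p = (x, b) \<and> q = (y, c) \<and> F = ((x, b), f, (y, c)) \<and> x \<in> Ob C \<and> y \<in> Ob C \<and>
     b \<in> Obj (pcat X x) \<and> c \<in> Obj (pcat X y) \<and> f \<in> hhom C x y \<and> b = fo (pfun X f) c)"
  by (cases p; cases q; cases F) (auto simp: grothendieck_def Let_def hhom_def)

lemma vhom_grothendieck: "U \<in> vhom (grothendieck C X) p q \<longleftrightarrow>
  (\<exists>x b y c u s. p = (x, b) \<and> q = (y, c) \<and> U = ((x, b), (u, s), (y, c)) \<and> x \<in> Ob C \<and> y \<in> Ob C \<and>
     b \<in> Obj (pcat X x) \<and> c \<in> Obj (pcat X y) \<and> u \<in> vhom C x y \<and> s \<in> El (pprof X u) b c)"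
  by (cases p; cases q; cases U) (auto simp: grothendieck_def Let_def vhom_def)

lemma squares_grothendieck: "A \<in> squares (grothendieck C X) L F F' R \<longleftrightarrow>
  (\<exists>x b x' b' u s y c y' c' v r f f' \<alpha>. L = ((x, b), (u, s), (x', b')) \<and> R = ((y, c), (v, r), (y', c')) \<and>
     F = ((x, b), f, (y, c)) \<and> F' = ((x', b'), f', (y', c')) \<and> A = (L, \<alpha>, R) \<and>
     x \<in> Ob C \<and> x' \<in> Ob C \<and> y \<in> Ob C \<and> y' \<in> Ob C \<and>
     b \<in> Obj (pcat X x) \<and> b' \<in> Obj (pcat X x') \<and> c \<in> Obj (pcat X y) \<and> c' \<in> Obj (pcat X y') \<and>
     u \<in> vhom C x x' \<and> v \<in> vhom C y y' \<and> f \<in> hhom C x y \<and> f' \<in> hhom C x' y' \<and>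
     s \<in> El (pprof X u) b b' \<and> r \<in> El (pprof X v) c c' \<and> b = fo (pfun X f) c \<and> b' = fo (pfun X f') c' \<and>
     \<alpha> \<in> squares C u f f' v \<and> s = psq X \<alpha> c c' r)"
  unfolding squares_def[of "grothendieck C X"]
  by (cases L; cases R; cases F; cases F'; cases A)
    (auto simp: grothendieck_def Let_def squares_def)

lemma grothendieck_simps:
  "hcmp (grothendieck C X) (q', g, r) (p, f, q) = (p, hcmp C g f, r)"
  "hid (grothendieck C X) (x, b) = ((x, b), hid C x, (x, b))"
  "vcmp (grothendieck C X) ((y, c), (u', s'), (x'', b'')) ((x, b), (u, s), (x', b')) =
     ((x, b), (vcmp C u' u, pmu X u u' b b'' (pclass C X u u' b b'' b' s' s)), (x'', b''))"
  "vid (grothendieck C X) (x, b) = ((x, b), (vid C x, Idt (pcat X x) b), (x, b))"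
  "hsq (grothendieck C X) (m, \<beta>, R) (L, \<alpha>, m') = (L, hsq C \<beta> \<alpha>, R)"
  "hsqid (grothendieck C X) ((x, b), (u, s), (x', b')) =
     (((x, b), (u, s), (x', b')), hsqid C u, ((x, b), (u, s), (x', b')))"
  "vsq (grothendieck C X) (L', \<alpha>', R') (L, \<alpha>, R) =
     (vcmp (grothendieck C X) L' L, vsq C \<alpha>' \<alpha>, vcmp (grothendieck C X) R' R)"
  "vsqid (grothendieck C X) (p, f, q) =
     (vid (grothendieck C X) p, vsqid C f, vid (grothendieck C X) q)"
  by (simp_all add: grothendieck_def Let_def)

end

context lax_double_presheaf begin

lemma psq_vsq: "\<alpha> \<in> squares C u f f' v \<Longrightarrow> \<alpha>' \<in> squares C u' f' f'' v' \<Longrightarrow>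
  v \<in> vhom C y y' \<Longrightarrow> v' \<in> vhom C y' y'' \<Longrightarrow>
  b \<in> Obj (pcat X y) \<Longrightarrow> b' \<in> Obj (pcat X y') \<Longrightarrow> b'' \<in> Obj (pcat X y'') \<Longrightarrow>
  s \<in> El (pprof X v) b b' \<Longrightarrow> s' \<in> El (pprof X v') b' b'' \<Longrightarrow>
  psq X (vsq C \<alpha>' \<alpha>) b b'' (pmu X v v' b b'' (pclass C X v v' b b'' b' s' s)) =
  pmu X u u' (fo (pfun X f) b) (fo (pfun X f'') b'')
    (pclass C X u u' (fo (pfun X f) b) (fo (pfun X f'') b'') (fo (pfun X f') b')
      (psq X \<alpha>' b' b'' s') (psq X \<alpha> b b' s))"
  by (rule mu_sq) (auto simp: vhom_def)

text \<open>In each law the components in \<open>C\<close> agree by the same law of \<open>C\<close>.  The components in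
\<open>X\<close> use associativity and unitality of \<open>\<mu>\<close> for vertical morphisms, functoriality of
\<open>X\<close> on squares for horizontal pasting, and naturality of \<open>\<mu>\<close> for vertical pasting.\<close>

theorem double_category_grothendieck: "double_category (grothendieck C X)"
proof -
  let ?G = "grothendieck C X"
  note G = hhom_grothendieck vhom_grothendieck squares_grothendieck grothendieck_simps
  show ?thesis
  proof (rule double_categoryI)
    fix f p q assume "f \<in> hhom ?G p q"
    then show "p \<in> Ob ?G \<and> q \<in> Ob ?G" by (auto simp: G Ob_grothendieck)
  next
    fix f p q g r assume "f \<in> hhom ?G p q" "g \<in> hhom ?G q r"
    then show "hcmp ?G g f \<in> hhom ?G p r" by (auto simp: G hcmp_in fo_hcmp)
  next
    fix f p q g r h s assume "f \<in> hhom ?G p q" "g \<in> hhom ?G q r" "h \<in> hhom ?G r s"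
    then show "hcmp ?G h (hcmp ?G g f) = hcmp ?G (hcmp ?G h g) f" by (auto simp: G hcmp_assoc)
  next
    fix p assume "p \<in> Ob ?G" then show "hid ?G p \<in> hhom ?G p p"
      by (cases p) (auto simp: Ob_grothendieck G hid_in fo_hid)
  next
    fix f p q assume "f \<in> hhom ?G p q"
    then show "hcmp ?G f (hid ?G p) = f" "hcmp ?G (hid ?G q) f = f"
      by (auto simp: G hcmp_hid hid_hcmp)
  next
    fix f p q assume "f \<in> vhom ?G p q"
    then show "p \<in> Ob ?G \<and> q \<in> Ob ?G" by (auto simp: G Ob_grothendieck)
  next
    fix f p q g r assume "f \<in> vhom ?G p q" "g \<in> vhom ?G q r"
    then show "vcmp ?G g f \<in> vhom ?G p r" by (auto simp: G vcmp_in mu_in)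
  next
    fix f p q g r h s assume "f \<in> vhom ?G p q" "g \<in> vhom ?G q r" "h \<in> vhom ?G r s"
    then show "vcmp ?G h (vcmp ?G g f) = vcmp ?G (vcmp ?G h g) f"
      by (auto simp: G vcmp_assoc mu_assoc)
  next
    fix p assume "p \<in> Ob ?G" then show "vid ?G p \<in> vhom ?G p p"
      by (cases p) (auto simp: Ob_grothendieck G vid_in Idt_El)
  next
    fix f p q assume "f \<in> vhom ?G p q"
    then show "vcmp ?G f (vid ?G p) = f" "vcmp ?G (vid ?G q) f = f"
      by (auto simp: G vcmp_vid vid_vcmp mu_Idt_left mu_Idt_right)
  next
    fix \<alpha> u f f' v assume "\<alpha> \<in> squares ?G u f f' v"
    then show "\<exists>p q p' q'. u \<in> vhom ?G p p' \<and> v \<in> vhom ?G q q' \<and> f \<in> hhom ?G p q \<and> f' \<in> hhom ?G p' q'"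
      by (force simp: G)
  next
    fix \<alpha> u f f' v \<beta> g g' w assume "\<alpha> \<in> squares ?G u f f' v" "\<beta> \<in> squares ?G v g g' w"
    then show "hsq ?G \<beta> \<alpha> \<in> squares ?G u (hcmp ?G g f) (hcmp ?G g' f') w"
      by (auto simp: G hcmp_in fo_hcmp hsq_boundary vhom_def intro!: sq_hsq[symmetric])
  next
    fix u p p' assume "u \<in> vhom ?G p p'"
    then show "hsqid ?G u \<in> squares ?G u (hid ?G p) (hid ?G p') u"
      by (auto simp: G hid_in fo_hid hsqid_boundary sq_hsqid)
  next
    fix \<alpha> u f f' v \<beta> g g' w \<gamma> h h' z
    assume "\<alpha> \<in> squares ?G u f f' v" "\<beta> \<in> squares ?G v g g' w" "\<gamma> \<in> squares ?G w h h' z"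
    then show "hsq ?G \<gamma> (hsq ?G \<beta> \<alpha>) = hsq ?G (hsq ?G \<gamma> \<beta>) \<alpha>"
      by (auto simp: G intro: hsq_assoc)
  next
    fix \<alpha> u f f' v assume "\<alpha> \<in> squares ?G u f f' v"
    then show "hsq ?G \<alpha> (hsqid ?G u) = \<alpha>" "hsq ?G (hsqid ?G v) \<alpha> = \<alpha>"
      by (auto simp: G intro: hsq_hsqid hsqid_hsq)
  next
    fix \<alpha> u f f' v \<alpha>' u' f'' v'
    assume "\<alpha> \<in> squares ?G u f f' v" "\<alpha>' \<in> squares ?G u' f' f'' v'"
    then show "vsq ?G \<alpha>' \<alpha> \<in> squares ?G (vcmp ?G u' u) f f'' (vcmp ?G v' v)"
      by (auto simp: G vcmp_in mu_in vsq_boundary psq_vsq)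
  next
    fix f p q assume "f \<in> hhom ?G p q"
    then show "vsqid ?G f \<in> squares ?G (vid ?G p) f f (vid ?G q)"
      by (auto simp: G vid_in Idt_El vsqid_boundary psq_vsqid_Idt)
  next
    fix \<alpha> u f f' v \<beta> u' f'' v' \<gamma> u'' g v''
    assume "\<alpha> \<in> squares ?G u f f' v" "\<beta> \<in> squares ?G u' f' f'' v'" "\<gamma> \<in> squares ?G u'' f'' g v''"
    then show "vsq ?G \<gamma> (vsq ?G \<beta> \<alpha>) = vsq ?G (vsq ?G \<gamma> \<beta>) \<alpha>"
      by (auto simp: G vcmp_assoc mu_assoc intro: vsq_assoc)
  next
    fix \<alpha> u f f' v assume "\<alpha> \<in> squares ?G u f f' v"
    then show "vsq ?G \<alpha> (vsqid ?G f) = \<alpha>" "vsq ?G (vsqid ?G f') \<alpha> = \<alpha>"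
      by (auto simp: G vcmp_vid vid_vcmp mu_Idt_left mu_Idt_right intro: vsq_vsqid vsqid_vsq)
  next
    fix \<alpha> u f f' v \<beta> g g' w \<alpha>' u' f'' v' \<beta>' g'' w'
    assume "\<alpha> \<in> squares ?G u f f' v" "\<beta> \<in> squares ?G v g g' w"
      "\<alpha>' \<in> squares ?G u' f' f'' v'" "\<beta>' \<in> squares ?G v' g' g'' w'"
    then show "vsq ?G (hsq ?G \<beta>' \<alpha>') (hsq ?G \<beta> \<alpha>) = hsq ?G (vsq ?G \<beta>' \<beta>) (vsq ?G \<alpha>' \<alpha>)"
      by (auto simp: G intro: interchange)
  next
    fix f p q g r assume "f \<in> hhom ?G p q" "g \<in> hhom ?G q r"
    then show "hsq ?G (vsqid ?G g) (vsqid ?G f) = vsqid ?G (hcmp ?G g f)"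
      by (auto simp: G vsqid_hcmp)
  next
    fix u p p' u' p'' assume "u \<in> vhom ?G p p'" "u' \<in> vhom ?G p' p''"
    then show "vsq ?G (hsqid ?G u') (hsqid ?G u) = hsqid ?G (vcmp ?G u' u)"
      by (auto simp: G hsqid_vcmp)
  next
    fix p assume "p \<in> Ob ?G" then show "vsqid ?G (hid ?G p) = hsqid ?G (vid ?G p)"
      by (cases p) (auto simp: Ob_grothendieck G vsqid_hid)
  qed
qed

end

section \<open>Slices are Grothendieck constructions\<close>

text \<open>The axioms only constrain composites of composable cells, so changing the values of the
compositions elsewhere preserves them.\<close>

lemma double_category_cong:
  assumes "double_category D"
    and vc: "\<And>u v x y z. u \<in> vhom D x y \<Longrightarrow> v \<in> vhom D y z \<Longrightarrow> vc v u = vcmp D v u"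
    and vs: "\<And>\<alpha> \<alpha>' u f f' v u' f'' v'. \<alpha> \<in> squares D u f f' v \<Longrightarrow> \<alpha>' \<in> squares D u' f' f'' v' \<Longrightarrow>
      vs \<alpha>' \<alpha> = vsq D \<alpha>' \<alpha>"
  shows "double_category (D\<lparr>vcmp := vc, vsq := vs\<rparr>)"
proof -
  interpret double_category D by fact
  let ?D = "D\<lparr>vcmp := vc, vsq := vs\<rparr>"
  have eqs: "hhom ?D = hhom D" "vhom ?D = vhom D" "squares ?D = squares D"
    by (auto simp: hhom_def vhom_def squares_def fun_eq_iff)
  have bnd: "\<exists>x y x' y'. u \<in> vhom D x x' \<and> v \<in> vhom D y y' \<and> f \<in> hhom D x y \<and> f' \<in> hhom D x' y'"
    if "\<alpha> \<in> squares D u f f' v" for \<alpha> u f f' v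
    using squares_left[OF that] squares_right[OF that] squares_top[OF that] squares_bot[OF that]
      Ver_vhom by blast
  have cmp: "vc u' u = vcmp D u' u" "vc v' v = vcmp D v' v"
    if "\<alpha> \<in> squares D u f f' v" "\<alpha>' \<in> squares D u' f' f'' v'" for \<alpha> u f f' v \<alpha>' u' f'' v'
    using bnd[OF that(1)] bnd[OF that(2)] by (auto simp: hhom_def intro: vc)
  have sel: "Ob ?D = Ob D" "hcmp ?D = hcmp D" "hid ?D = hid D" "vid ?D = vid D" "hsq ?D = hsq D"
    "hsqid ?D = hsqid D" "vsqid ?D = vsqid D" "vcmp ?D = vc" "vsq ?D = vs" by simp_all
  show ?thesis
  proof (rule double_categoryI; unfold eqs sel)
    fix u x y v z assume u: "u \<in> vhom D x y" and v: "v \<in> vhom D y z"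
    then show "vc v u \<in> vhom D x z" by (simp add: vc[OF u v] vcmp_in)
    show "vs (hsqid D v) (hsqid D u) = hsqid D (vc v u)"
      by (simp add: vc[OF u v] vs[OF hsqid_boundary[OF u] hsqid_boundary[OF v]] hsqid_vcmp[OF u v])
    fix w z' assume w: "w \<in> vhom D z z'"
    show "vc w (vc v u) = vc (vc w v) u"
      by (simp add: vc[OF u v] vc[OF v w] vc[OF u vcmp_in[OF v w]] vc[OF vcmp_in[OF u v] w]
        vcmp_assoc[OF u v w])
  next
    fix u x y assume u: "u \<in> vhom D x y"
    show "vc u (vid D x) = u" "vc (vid D y) u = u"
      using vhom_obs[OF u] by (simp_all add: vc[OF u vid_in] vc[OF vid_in u] vcmp_vid[OF u] vid_vcmp[OF u])
  next
    fix \<alpha> u f f' v assume \<alpha>: "\<alpha> \<in> squares D u f f' v"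
    show "vs \<alpha> (vsqid D f) = \<alpha>" "vs (vsqid D f') \<alpha> = \<alpha>"
      by (simp_all add: vs[OF vsqid_boundary[OF squares_top[OF \<alpha>]] \<alpha>]
          vs[OF \<alpha> vsqid_boundary[OF squares_bot[OF \<alpha>]]] vsq_vsqid[OF \<alpha>] vsqid_vsq[OF \<alpha>])
    fix \<alpha>' u' f'' v' assume \<alpha>': "\<alpha>' \<in> squares D u' f' f'' v'"
    show "vs \<alpha>' \<alpha> \<in> squares D (vc u' u) f f'' (vc v' v)"
      by (simp add: cmp[OF \<alpha> \<alpha>'] vs[OF \<alpha> \<alpha>'] vsq_boundary[OF \<alpha> \<alpha>'])
    fix \<gamma> u'' g v'' assume \<gamma>: "\<gamma> \<in> squares D u'' f'' g v''"
    show "vs \<gamma> (vs \<alpha>' \<alpha>) = vs (vs \<gamma> \<alpha>') \<alpha>"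
      by (simp add: vs[OF \<alpha> \<alpha>'] vs[OF \<alpha>' \<gamma>] vs[OF vsq_boundary[OF \<alpha> \<alpha>'] \<gamma>]
          vs[OF \<alpha> vsq_boundary[OF \<alpha>' \<gamma>]] vsq_assoc[OF \<alpha> \<alpha>' \<gamma>])
  next
    fix \<alpha> u f f' v \<beta> g g' w \<alpha>' u' f'' v' \<beta>' g'' w'
    assume *: "\<alpha> \<in> squares D u f f' v" "\<beta> \<in> squares D v g g' w"
      "\<alpha>' \<in> squares D u' f' f'' v'" "\<beta>' \<in> squares D v' g' g'' w'"
    show "vs (hsq D \<beta>' \<alpha>') (hsq D \<beta> \<alpha>) = hsq D (vs \<beta>' \<beta>) (vs \<alpha>' \<alpha>)"
      by (simp add: vs[OF *(1,3)] vs[OF *(2,4)] interchange[OF *]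
          vs[OF hsq_boundary[OF *(1,2)] hsq_boundary[OF *(3,4)]])
  qed (blast intro: hcmp_in hcmp_assoc hid_in hcmp_hid hid_hcmp vid_in bnd hsq_boundary
        hsqid_boundary hsq_assoc hsq_hsqid hsqid_hsq vsqid_boundary vsqid_hcmp vsqid_hid
        dest: hhom_obs vhom_obs)+
qed

text \<open>The slice is the category of elements of the representable presheaf: a vertical morphism over
\<open>u\<close> is an element \<open>\<eta>\<close> of \<open>C(u, t)\<close>.  The two constructions differ only in
the values of the vertical compositions at pairs that are not composable.\<close>

lemma (in double_category) double_category_slice:
  assumes t: "t \<in> Ob C"
  shows "double_category (slice C t)"
proof -
  interpret R: lax_double_presheaf C "representable C t" by (rule lax_double_presheaf_representable[OF t])
  let ?G = "grothendieck C (representable C t)"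
  have eq: "slice C t = ?G\<lparr>vcmp := vcmp (slice C t), vsq := vsq (slice C t)\<rparr>"
    by (rule dblcat.equality)
      (auto simp: slice_def grothendieck_def Let_def representable_simps Obj_representable fun_eq_iff)
  have "double_category (?G\<lparr>vcmp := vcmp (slice C t), vsq := vsq (slice C t)\<rparr>)"
  proof (rule double_category_cong[OF R.double_category_grothendieck])
    fix u v p q r assume "u \<in> vhom ?G p q" "v \<in> vhom ?G q r"
    then show "vcmp (slice C t) v u = vcmp ?G v u"
      by (auto simp: R.vhom_grothendieck R.grothendieck_simps slice_def Let_def
        pmu_representable[OF t] representable_simps(7))
  next
    fix \<alpha> \<alpha>' u f f' v u' f'' v'
    assume "\<alpha> \<in> squares ?G u f f' v" "\<alpha>' \<in> squares ?G u' f' f'' v'"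
    then show "vsq (slice C t) \<alpha>' \<alpha> = vsq ?G \<alpha>' \<alpha>"
      by (auto simp: R.squares_grothendieck R.grothendieck_simps slice_def Let_def
        pmu_representable[OF t] representable_simps(7))
  qed
  then show ?thesis by (simp only: eq[symmetric])
qed

section \<open>Double terminal objects\<close>

text \<open>The inverse preserves domains and codomains because the functor does and is injective on objects.\<close>

lemma cat_functor_inverse:
  assumes F: "cat_functor A B F"
    and ob: "bij_betw (fo F) (Obj A) (Obj B)" and ar: "bij_betw (fa F) (Arr A) (Arr B)"
  shows "cat_functor B A \<lparr>fo = inv_into (Obj A) (fo F), fa = inv_into (Arr A) (fa F)\<rparr>"
proof -
  interpret F: cat_functor A B F by fact
  interpret A: category A by (rule F.source)
  interpret B: category B by (rule F.target)
  let ?o = "inv_into (Obj A) (fo F)" and ?a = "inv_into (Arr A) (fa F)"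
  have o: "?o b \<in> Obj A" "fo F (?o b) = b" if "b \<in> Obj B" for b
    using that ob bij_betw_inv_into_right[OF ob that] by (auto simp: bij_betw_def intro: inv_into_into)
  have a: "?a g \<in> Arr A" "fa F (?a g) = g" if "g \<in> Arr B" for g
    using that ar bij_betw_inv_into_right[OF ar that] by (auto simp: bij_betw_def intro: inv_into_into)
  have oI: "?o (fo F x) = x" if "x \<in> Obj A" for x by (rule bij_betw_inv_into_left[OF ob that])
  have aI: "?a (fa F f) = f" if "f \<in> Arr A" for f by (rule bij_betw_inv_into_left[OF ar that])
  have a_hom: "?a g \<in> hom A (?o b) (?o c)" if g: "g \<in> hom B b c" for g b c
  proof -
    have g': "g \<in> Arr B" using g by (simp add: hom_def)
    let ?f = "?a g"
    have f: "?f \<in> hom A (Dom A ?f) (Cod A ?f)" using a(1)[OF g'] by (simp add: hom_def)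
    have "g \<in> hom B (fo F (Dom A ?f)) (fo F (Cod A ?f))" using F.fa_in[OF f] a(2)[OF g'] by simp
    then have "b = fo F (Dom A ?f)" "c = fo F (Cod A ?f)" using g by (auto simp: hom_def)
    then show ?thesis using f oI A.Dom_in A.Cod_in a(1)[OF g'] by simp
  qed
  have ArrI: "f \<in> hom A x y \<Longrightarrow> f \<in> Arr A" "g \<in> hom B b c \<Longrightarrow> g \<in> Arr B" for f x y g b c
    by (simp_all add: hom_def)
  show ?thesis
  proof (intro cat_functor.intro F.target F.source; simp only: func.simps)
    fix b assume b: "b \<in> Obj B"
    show "?o b \<in> Obj A" by (rule o[OF b])
    have "?a (Idt B (fo F (?o b))) = Idt A (?o b)"
      using F.fa_Idt[OF o(1)[OF b]] aI[OF ArrI(1)[OF A.Idt_in[OF o(1)[OF b]]]] by simp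
    then show "?a (Idt B b) = Idt A (?o b)" by (simp add: o[OF b])
  next
    fix g b c assume g: "g \<in> hom B b c"
    show "?a g \<in> hom A (?o b) (?o c)" by (rule a_hom[OF g])
    fix h d assume h: "h \<in> hom B c d"
    have "?a (fa F (Cmp A (?a h) (?a g))) = Cmp A (?a h) (?a g)"
      by (rule aI[OF ArrI(1)[OF A.Cmp_in[OF a_hom[OF g] a_hom[OF h]]]])
    then show "?a (Cmp B h g) = Cmp A (?a h) (?a g)"
      by (simp add: F.fa_Cmp[OF a_hom[OF g] a_hom[OF h]] a[OF ArrI(2)[OF g]] a[OF ArrI(2)[OF h]])
  qed
qed

lemma cat_functor_fa_Arr: "cat_functor A B F \<Longrightarrow> f \<in> Arr A \<Longrightarrow> fa F f \<in> Arr B"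
  using cat_functor.fa_in[of A B F f "Dom A f" "Cod A f"] by (simp add: hom_def)

lemma dblcat_iso_iff_bij:
  assumes P: "double_functor D E P"
  shows "dblcat_iso D E P \<longleftrightarrow> bij_betw (dfo P) (Ob D) (Ob E) \<and> bij_betw (dfh P) (Hor D) (Hor E) \<and>
    bij_betw (dfv P) (Ver D) (Ver E) \<and> bij_betw (dfs P) (Sq D) (Sq E)"
proof
  have into: "dfo P ` Ob D \<subseteq> Ob E" "dfh P ` Hor D \<subseteq> Hor E" "dfv P ` Ver D \<subseteq> Ver E" "dfs P ` Sq D \<subseteq> Sq E"
    if "double_functor D E P" for D E and P :: "('a1, 'h1, 'v1, 's1, 'a2, 'h2, 'v2, 's2) dblfun"
    using cat_functor.fo_in[OF double_functor.hor[OF that]] cat_functor.fo_in[OF double_functor.hsq[OF that]]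
      cat_functor_fa_Arr[OF double_functor.hor[OF that]] cat_functor_fa_Arr[OF double_functor.hsq[OF that]]
    by (auto simp: hcat_def hsqcat_def)
  note PI = into[OF P]
  assume "dblcat_iso D E P"
  then obtain Q where Q: "double_functor E D Q" and
    *: "\<forall>x\<in>Ob D. dfo Q (dfo P x) = x" "\<forall>f\<in>Hor D. dfh Q (dfh P f) = f"
        "\<forall>u\<in>Ver D. dfv Q (dfv P u) = u" "\<forall>\<alpha>\<in>Sq D. dfs Q (dfs P \<alpha>) = \<alpha>"
        "\<forall>x\<in>Ob E. dfo P (dfo Q x) = x" "\<forall>f\<in>Hor E. dfh P (dfh Q f) = f"
        "\<forall>u\<in>Ver E. dfv P (dfv Q u) = u" "\<forall>\<alpha>\<in>Sq E. dfs P (dfs Q \<alpha>) = \<alpha>"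
    by (auto simp: dblcat_iso_def)
  note QI = into[OF Q]
  show "bij_betw (dfo P) (Ob D) (Ob E) \<and> bij_betw (dfh P) (Hor D) (Hor E) \<and>
    bij_betw (dfv P) (Ver D) (Ver E) \<and> bij_betw (dfs P) (Sq D) (Sq E)"
    using bij_betw_byWitness[OF *(1,5) PI(1) QI(1)] bij_betw_byWitness[OF *(2,6) PI(2) QI(2)]
      bij_betw_byWitness[OF *(3,7) PI(3) QI(3)] bij_betw_byWitness[OF *(4,8) PI(4) QI(4)] by blast
next
  interpret P: double_functor D E P by fact
  assume "bij_betw (dfo P) (Ob D) (Ob E) \<and> bij_betw (dfh P) (Hor D) (Hor E) \<and>
    bij_betw (dfv P) (Ver D) (Ver E) \<and> bij_betw (dfs P) (Sq D) (Sq E)"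
  then have b: "bij_betw (dfo P) (Ob D) (Ob E)" "bij_betw (dfh P) (Hor D) (Hor E)"
    "bij_betw (dfv P) (Ver D) (Ver E)" "bij_betw (dfs P) (Sq D) (Sq E)" by auto
  define Q where "Q = \<lparr>dfo = inv_into (Ob D) (dfo P), dfh = inv_into (Hor D) (dfh P),
    dfv = inv_into (Ver D) (dfv P), dfs = inv_into (Sq D) (dfs P)\<rparr>"
  have "double_functor E D Q"
  proof (rule double_functor.intro[OF P.target P.source])
    show "cat_functor (hcat E) (hcat D) \<lparr>fo = dfo Q, fa = dfh Q\<rparr>"
      using cat_functor_inverse[OF P.hor] b by (simp add: hcat_def Q_def)
    show "cat_functor (vcat E) (vcat D) \<lparr>fo = dfo Q, fa = dfv Q\<rparr>"
      using cat_functor_inverse[OF P.ver] b by (simp add: vcat_def Q_def)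
    show "cat_functor (hsqcat E) (hsqcat D) \<lparr>fo = dfv Q, fa = dfs Q\<rparr>"
      using cat_functor_inverse[OF P.hsq] b by (simp add: hsqcat_def Q_def)
    show "cat_functor (vsqcat E) (vsqcat D) \<lparr>fo = dfh Q, fa = dfs Q\<rparr>"
      using cat_functor_inverse[OF P.vsq] b by (simp add: vsqcat_def Q_def)
  qed
  moreover have "(\<forall>x\<in>Ob D. dfo Q (dfo P x) = x) \<and> (\<forall>f\<in>Hor D. dfh Q (dfh P f) = f) \<and>
        (\<forall>u\<in>Ver D. dfv Q (dfv P u) = u) \<and> (\<forall>\<alpha>\<in>Sq D. dfs Q (dfs P \<alpha>) = \<alpha>) \<and>
        (\<forall>x\<in>Ob E. dfo P (dfo Q x) = x) \<and> (\<forall>f\<in>Hor E. dfh P (dfh Q f) = f) \<and>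
        (\<forall>u\<in>Ver E. dfv P (dfv Q u) = u) \<and> (\<forall>\<alpha>\<in>Sq E. dfs P (dfs Q \<alpha>) = \<alpha>)"
    unfolding Q_def dblfun.simps using b
    by (simp add: bij_betw_inv_into_left bij_betw_inv_into_right)
  ultimately show "dblcat_iso D E P" using P unfolding dblcat_iso_def by blast
qed

lemma (in double_category) double_functor_slice_proj:
  assumes t: "t \<in> Ob C"
  shows "double_functor (slice C t) C slice_proj"
proof -
  let ?S = "slice C t"
  have S: "category (hcat ?S)" "category (vcat ?S)" "category (hsqcat ?S)" "category (vsqcat ?S)"
    using double_category_slice[OF t] by (simp_all add: double_category_def)
  show ?thesis
  proof (rule double_functor.intro[OF double_category_slice[OF t] double_category_axioms])
    show "cat_functor (hcat ?S) (hcat C) \<lparr>fo = dfo slice_proj, fa = dfh slice_proj\<rparr>"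
      by (rule cat_functor.intro[OF S(1) hcat])
        (auto simp: hcat_def slice_def Let_def slice_proj_def hom_def hhom_def)
    show "cat_functor (vcat ?S) (vcat C) \<lparr>fo = dfo slice_proj, fa = dfv slice_proj\<rparr>"
      by (rule cat_functor.intro[OF S(2) vcat])
        (auto simp: vcat_def slice_def Let_def slice_proj_def hom_def vhom_def)
    show "cat_functor (hsqcat ?S) (hsqcat C) \<lparr>fo = dfv slice_proj, fa = dfs slice_proj\<rparr>"
      by (rule cat_functor.intro[OF S(3) hsqcat])
        (auto simp: hsqcat_def slice_def Let_def slice_proj_def hom_def vhom_def squares_def)
    show "cat_functor (vsqcat ?S) (vsqcat C) \<lparr>fo = dfh slice_proj, fa = dfs slice_proj\<rparr>"
      by (rule cat_functor.intro[OF S(4) vsqcat])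
        (auto simp: vsqcat_def slice_def Let_def slice_proj_def hom_def hhom_def squares_def)
  qed
qed

text \<open>Bijectivity of the projection on objects and on vertical morphisms says that the data making a cell
of \<open>C\<close> into a cell of the slice exist uniquely.  Horizontal morphisms and squares of the slice carry
no data beyond their boundary, only equations between cells into \<open>t\<close>, and these hold by uniqueness.\<close>

theorem (in double_category) double_terminal_iff:
  assumes t: "t \<in> Ob C"
  shows "double_terminal C t \<longleftrightarrow>
    (\<forall>e\<in>Ob C. \<exists>!g. g \<in> hhom C e t) \<and>
    (\<forall>u\<in>Ver C. \<forall>g\<in>hhom C (vdom C u) t. \<forall>g'\<in>hhom C (vcod C u) t.
       \<exists>!\<eta>. \<eta> \<in> squares C u g g' (vid C t))" (is "_ \<longleftrightarrow> ?hor \<and> ?ver")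
proof -
  let ?S = "slice C t"
  have ObS: "(e, g) \<in> Ob ?S \<longleftrightarrow> g \<in> hhom C e t" for e g
    by (auto simp: slice_def Let_def hhom_obs)
  have HorS: "((e, g), f, (d, h)) \<in> Hor ?S \<longleftrightarrow>
      g \<in> hhom C e t \<and> h \<in> hhom C d t \<and> f \<in> hhom C e d \<and> g = hcmp C h f" for e g f d h
    by (auto simp: slice_def Let_def hhom_obs)
  have VerS: "((e, g), (u, \<eta>), (e', g')) \<in> Ver ?S \<longleftrightarrow>
      g \<in> hhom C e t \<and> g' \<in> hhom C e' t \<and> u \<in> vhom C e e' \<and> \<eta> \<in> squares C u g g' (vid C t)"
    for e g u \<eta> e' g'
    by (auto simp: slice_def Let_def hhom_obs)
  have SqS: "((p, (u, \<eta>), p'), \<alpha>, (q, (v, \<theta>), q')) \<in> Sq ?S \<longleftrightarrow>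
      (p, (u, \<eta>), p') \<in> Ver ?S \<and> (q, (v, \<theta>), q') \<in> Ver ?S \<and>
      (p, stop C \<alpha>, q) \<in> Hor ?S \<and> (p', sbot C \<alpha>, q') \<in> Hor ?S \<and>
      \<alpha> \<in> squares C u (stop C \<alpha>) (sbot C \<alpha>) v \<and> \<eta> = hsq C \<theta> \<alpha>" for p u \<eta> p' \<alpha> q v \<theta> q'
    by (simp add: slice_def Let_def)
  have iso: "double_terminal C t \<longleftrightarrow>
      bij_betw (\<lambda>(e, g). e) (Ob ?S) (Ob C) \<and> bij_betw (\<lambda>(p, f, q). f) (Hor ?S) (Hor C) \<and>
      bij_betw (\<lambda>(p, (u, \<eta>), p'). u) (Ver ?S) (Ver C) \<and> bij_betw (\<lambda>(l, \<alpha>, r). \<alpha>) (Sq ?S) (Sq C)"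
    unfolding double_terminal_def dblcat_iso_iff_bij[OF double_functor_slice_proj[OF t]]
    by (simp add: t slice_proj_def)
  show ?thesis unfolding iso
  proof (intro iffI conjI; (elim conjE)?)
    assume ob: "bij_betw (\<lambda>(e, g). e) (Ob ?S) (Ob C)"
      and ver: "bij_betw (\<lambda>(p, (u, \<eta>), p'). u) (Ver ?S) (Ver C)"
    show ?hor
    proof
      fix e assume "e \<in> Ob C"
      then obtain p where "p \<in> Ob ?S" "(\<lambda>(e, g). e) p = e"
        using bij_betw_imp_surj_on[OF ob] by (metis (no_types, lifting) imageE)
      then obtain g where g: "(e, g) \<in> Ob ?S" by (cases p) auto
      have "g' = g" if "(e, g') \<in> Ob ?S" for g'
        using inj_onD[OF bij_betw_imp_inj_on[OF ob], OF _ that g] by simp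
      then show "\<exists>!g. g \<in> hhom C e t" using g by (auto simp: ObS)
    qed
    then have uniq: "g = g'" if "g \<in> hhom C e t" "g' \<in> hhom C e t" for g g' e
      using that hhom_obs by blast
    show ?ver
    proof (intro ballI)
      fix u g g' assume u: "u \<in> Ver C" and g: "g \<in> hhom C (vdom C u) t" "g' \<in> hhom C (vcod C u) t"
      obtain p where p: "p \<in> Ver ?S" "(\<lambda>(p, (u, \<eta>), p'). u) p = u"
        using bij_betw_imp_surj_on[OF ver] u by (metis (no_types, lifting) imageE)
      obtain e k w \<eta> e' k' where "p = ((e, k), (w, \<eta>), (e', k'))" by (cases p) auto
      then have "((e, k), (u, \<eta>), (e', k')) \<in> Ver ?S" using p by simp
      then have \<eta>: "\<eta> \<in> squares C u g g' (vid C t)"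
        using uniq[of k _ g] uniq[of k' _ g'] g unfolding VerS vhom_def by blast
      have "\<theta> = \<eta>" if "\<theta> \<in> squares C u g g' (vid C t)" for \<theta>
      proof -
        have "((vdom C u, g), (u, \<theta>), (vcod C u, g')) \<in> Ver ?S"
          "((vdom C u, g), (u, \<eta>), (vcod C u, g')) \<in> Ver ?S"
          using g \<eta> that Ver_vhom[OF u] by (simp_all add: VerS)
        then show ?thesis using inj_onD[OF bij_betw_imp_inj_on[OF ver]] by fastforce
      qed
      then show "\<exists>!\<eta>. \<eta> \<in> squares C u g g' (vid C t)" using \<eta> by blast
    qed
  next
    assume hor: ?hor and ver: ?ver
    have uh: "g = g'" if "g \<in> hhom C e t" "g' \<in> hhom C e t" for g g' e
      using that hor hhom_obs by blast
    have us: "\<eta> = \<theta>" if "\<eta> \<in> squares C u g g' (vid C t)" "\<theta> \<in> squares C u g g' (vid C t)" for \<eta> \<theta> u g g'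
    proof -
      have "g \<in> hhom C (vdom C u) t" "g' \<in> hhom C (vcod C u) t"
        using squares_top[OF that(1)] squares_bot[OF that(1)] vid_in[OF t] by (auto simp: vhom_def)
      then show ?thesis using ver squares_left[OF that(1)] that by blast
    qed
    \<comment> \<open>The inverse of the projection attaches to every object the morphism \<open>T\<close> and to every vertical
      morphism the square \<open>S\<close> into \<open>t\<close>.\<close>
    obtain T where T: "e \<in> Ob C \<Longrightarrow> T e \<in> hhom C e t" for e using hor by metis
    have "\<exists>\<eta>. \<eta> \<in> squares C u (T (vdom C u)) (T (vcod C u)) (vid C t)" if "u \<in> Ver C" for u
      using ver that T vhom_obs[OF Ver_vhom[OF that]] by blast
    then obtain S where S: "u \<in> Ver C \<Longrightarrow> S u \<in> squares C u (T (vdom C u)) (T (vcod C u)) (vid C t)" for u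
      by metis
    have TI: "T e = g" if "g \<in> hhom C e t" for e g
      using uh[OF T that] hhom_obs[OF that] by simp
    have SI: "S u = \<eta>" "T (vdom C u) = g" "T (vcod C u) = g'"
      if "\<eta> \<in> squares C u g g' (vid C t)" for \<eta> u g g'
    proof -
      have vt: "vdom C (vid C t) = t" "vcod C (vid C t) = t" using vid_in[OF t] by (auto simp: vhom_def)
      show *: "T (vdom C u) = g" "T (vcod C u) = g'"
        using squares_top[OF that] squares_bot[OF that] by (simp_all add: vt TI)
      show "S u = \<eta>" using us[OF S that[folded *]] squares_left[OF that] * that by simp
    qed
    show "bij_betw (\<lambda>(e, g). e) (Ob ?S) (Ob C)"
      by (rule bij_betw_byWitness[where f' = "\<lambda>e. (e, T e)"]) (auto simp: ObS T TI hhom_obs)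
    have Tcmp: "T e = hcmp C (T d) f" if "f \<in> hhom C e d" for e d f
      using TI[OF hcmp_in[OF that T]] hhom_obs[OF that] by simp
    let ?H = "\<lambda>f. ((hdom C f, T (hdom C f)), f, (hcod C f, T (hcod C f)))"
    have H: "?H f \<in> Hor ?S" if "f \<in> Hor C" for f
      unfolding HorS using Hor_hhom[OF that] hhom_obs[OF Hor_hhom[OF that]] T Tcmp by blast
    have H_eq: "?H f = ((e, g), f, (d, h)) \<and> f \<in> Hor C" if "((e, g), f, (d, h)) \<in> Hor ?S" for e g f d h
    proof -
      have "g \<in> hhom C e t" "h \<in> hhom C d t" "f \<in> hhom C e d" using that unfolding HorS by blast+
      then show ?thesis using TI[of g e] TI[of h d] by (simp add: hhom_def)
    qed
    show "bij_betw (\<lambda>(p, f, q). f) (Hor ?S) (Hor C)"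
      by (rule bij_betw_byWitness[where f' = ?H]) (auto dest: H_eq H)
    let ?V = "\<lambda>u. ((vdom C u, T (vdom C u)), (u, S u), (vcod C u, T (vcod C u)))"
    have V: "?V u \<in> Ver ?S" if "u \<in> Ver C" for u
      using Ver_vhom[OF that] vhom_obs[OF Ver_vhom[OF that]] S[OF that] by (simp add: VerS T)
    have V_eq: "?V u = ((e, g), (u, \<eta>), (e', g')) \<and> u \<in> Ver C"
      if "((e, g), (u, \<eta>), (e', g')) \<in> Ver ?S" for e g u \<eta> e' g'
    proof -
      have "u \<in> vhom C e e'" "\<eta> \<in> squares C u g g' (vid C t)" using that unfolding VerS by blast+
      then show ?thesis using SI[of \<eta> u g g'] by (simp add: vhom_def)
    qed
    show "bij_betw (\<lambda>(p, (u, \<eta>), p'). u) (Ver ?S) (Ver C)"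
      by (rule bij_betw_byWitness[where f' = ?V]) (auto dest: V_eq V)
    let ?Q = "\<lambda>\<alpha>. (?V (sleft C \<alpha>), \<alpha>, ?V (sright C \<alpha>))"
    have Q: "?Q \<alpha> \<in> Sq ?S" if "\<alpha> \<in> Sq C" for \<alpha>
    proof -
      let ?u = "sleft C \<alpha>" and ?v = "sright C \<alpha>" and ?f = "stop C \<alpha>" and ?f' = "sbot C \<alpha>"
      note \<alpha> = Sq_squares[OF that]
      note uv = squares_left[OF \<alpha>] squares_right[OF \<alpha>] and f = squares_top[OF \<alpha>] squares_bot[OF \<alpha>]
      have "?H ?f \<in> Hor ?S" "?H ?f' \<in> Hor ?S"
        by (rule H; use f in \<open>simp add: hhom_def\<close>)+
      moreover have "S ?u = hsq C (S ?v) \<alpha>" by (rule SI(1)[OF hsq_boundary[OF \<alpha> S[OF uv(2)]]])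
      ultimately show ?thesis using V[OF uv(1)] V[OF uv(2)] \<alpha> f by (simp add: SqS hhom_def)
    qed
    have Q_eq: "?Q \<alpha> = ((p, (u, \<eta>), p'), \<alpha>, (q, (v, \<theta>), q')) \<and> \<alpha> \<in> Sq C"
      if "((p, (u, \<eta>), p'), \<alpha>, (q, (v, \<theta>), q')) \<in> Sq ?S" for p u \<eta> p' \<alpha> q v \<theta> q'
    proof -
      have L: "(p, (u, \<eta>), p') \<in> Ver ?S" and R: "(q, (v, \<theta>), q') \<in> Ver ?S"
        and \<alpha>: "\<alpha> \<in> squares C u (stop C \<alpha>) (sbot C \<alpha>) v"
        using that unfolding SqS by blast+
      have "?V u = (p, (u, \<eta>), p')"
        using V_eq[of "fst p" "snd p" u \<eta> "fst p'" "snd p'"] L unfolding prod.collapse by blast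
      moreover have "?V v = (q, (v, \<theta>), q')"
        using V_eq[of "fst q" "snd q" v \<theta> "fst q'" "snd q'"] R unfolding prod.collapse by blast
      moreover note \<alpha>
      ultimately show ?thesis by (simp add: squares_def)
    qed
    show "bij_betw (\<lambda>(l, \<alpha>, r). \<alpha>) (Sq ?S) (Sq C)"
    proof (rule bij_betw_byWitness[where f' = ?Q])
      have *: "?Q ((\<lambda>(l, \<alpha>, r). \<alpha>) A) = A \<and> (\<lambda>(l, \<alpha>, r). \<alpha>) A \<in> Sq C" if "A \<in> Sq ?S" for A
      proof -
        obtain p u \<eta> p' \<alpha> q v \<theta> q' where A: "A = ((p, (u, \<eta>), p'), \<alpha>, (q, (v, \<theta>), q'))"
          by (cases A) auto
        show ?thesis using Q_eq[OF that[unfolded A]] unfolding A prod.case .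
      qed
      then show "\<forall>A\<in>Sq ?S. ?Q ((\<lambda>(l, \<alpha>, r). \<alpha>) A) = A" by blast
      show "(\<lambda>(l, \<alpha>, r). \<alpha>) ` Sq ?S \<subseteq> Sq C" using * by blast
      show "\<forall>\<alpha>\<in>Sq C. (\<lambda>(l, \<alpha>, r). \<alpha>) (?Q \<alpha>) = \<alpha>" by simp
      show "?Q ` Sq C \<subseteq> Sq ?S" using Q by blast
    qed
  qed
qed

section \<open>Invertible horizontal transformations\<close>

lemma prof_nat_Act:
  "prof_nat A A' F F' U V \<phi> \<Longrightarrow> f \<in> hom A b a \<Longrightarrow> f' \<in> hom A' a' b' \<Longrightarrow> s \<in> El U a a' \<Longrightarrow>
   \<phi> b b' (Act U f f' s) = Act V (fa F f) (fa F' f') (\<phi> a a' s)"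
  by (auto simp: prof_nat_def hom_def)

lemma (in horizontal_transformation) tver_in:
  "u \<in> vhom C x x' \<Longrightarrow> b \<in> Obj (pcat X x) \<Longrightarrow> b' \<in> Obj (pcat X x') \<Longrightarrow> s \<in> El (pprof X u) b b' \<Longrightarrow>
   tver F u b b' s \<in> El (pprof Y u) (fo (tob F x) b) (fo (tob F x') b')"
  using tver_nat[of u x x'] by (simp add: prof_nat_def)

text \<open>The inverse is taken componentwise.  Each compatibility required of it is reduced, by injectivity of
\<open>F\<close>, to the same compatibility of \<open>F\<close> itself.\<close>

theorem htrans_invertible_iff_bij:
  assumes F: "horizontal_transformation C X Y F"
  shows "htrans_invertible C X Y F \<longleftrightarrow>
    (\<forall>x\<in>Ob C. bij_betw (fo (tob F x)) (Obj (pcat X x)) (Obj (pcat Y x))) \<and>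
    (\<forall>u\<in>Ver C. \<forall>b\<in>Obj (pcat X (vdom C u)). \<forall>b'\<in>Obj (pcat X (vcod C u)).
       bij_betw (tver F u b b') (El (pprof X u) b b')
         (El (pprof Y u) (fo (tob F (vdom C u)) b) (fo (tob F (vcod C u)) b')))"
    (is "_ \<longleftrightarrow> ?ob \<and> ?ver")
proof -
  interpret F: horizontal_transformation C X Y F by fact
  interpret X: lax_double_presheaf C X by (rule F.source)
  interpret Y: lax_double_presheaf C Y by (rule F.target)
  have Fo_in: "fo (tob F x) b \<in> Obj (pcat Y x)" if "x \<in> Ob C" "b \<in> Obj (pcat X x)" for x b
    by (rule cat_functor.fo_in[OF F.tob_functor[OF that(1)] that(2)])
  show ?thesis
  proof (intro iffI conjI; (elim conjE)?)
    assume "htrans_invertible C X Y F"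
    then obtain G where G: "horizontal_transformation C Y X G"
      and GF: "htrans_eq C X (htrans_comp C G F) htrans_id"
      and FG: "htrans_eq C Y (htrans_comp C F G) htrans_id"
      by (auto simp: htrans_invertible_def)
    interpret G: horizontal_transformation C Y X G by fact
    have GFo: "fo (tob G x) (fo (tob F x) b) = b" if "x \<in> Ob C" "b \<in> Obj (pcat X x)" for x b
      using GF that by (simp add: htrans_eq_def htrans_comp_def htrans_id_def func_eq_def func_comp_def func_id_def)
    have FGo: "fo (tob F x) (fo (tob G x) b) = b" if "x \<in> Ob C" "b \<in> Obj (pcat Y x)" for x b
      using FG that by (simp add: htrans_eq_def htrans_comp_def htrans_id_def func_eq_def func_comp_def func_id_def)
    have FGv: "tver F u (fo (tob G (vdom C u)) b) (fo (tob G (vcod C u)) b') (tver G u b b' s) = s"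
      if "u \<in> Ver C" "b \<in> Obj (pcat Y (vdom C u))" "b' \<in> Obj (pcat Y (vcod C u))"
        "s \<in> El (pprof Y u) b b'" for u b b' s
      using FG that by (simp add: htrans_eq_def htrans_comp_def htrans_id_def)
    have Go_in: "fo (tob G x) b \<in> Obj (pcat X x)" if "x \<in> Ob C" "b \<in> Obj (pcat Y x)" for x b
      by (rule cat_functor.fo_in[OF G.tob_functor[OF that(1)] that(2)])
    show ?ob
    proof
      fix x assume "x \<in> Ob C"
      then show "bij_betw (fo (tob F x)) (Obj (pcat X x)) (Obj (pcat Y x))"
        by (intro bij_betw_byWitness[where f' = "fo (tob G x)"]) (auto simp: GFo FGo Fo_in Go_in)
    qed
    show ?ver
    proof (intro ballI)
      fix u b b' assume u: "u \<in> Ver C" and b: "b \<in> Obj (pcat X (vdom C u))" "b' \<in> Obj (pcat X (vcod C u))"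
      note u' = X.Ver_vhom[OF u]
      have x: "vdom C u \<in> Ob C" "vcod C u \<in> Ob C" using X.vhom_obs[OF u'] by auto
      let ?b = "fo (tob F (vdom C u)) b" and ?b' = "fo (tob F (vcod C u)) b'"
      note Fb = Fo_in[OF x(1) b(1)] Fo_in[OF x(2) b(2)]
      show "bij_betw (tver F u b b') (El (pprof X u) b b') (El (pprof Y u) ?b ?b')"
      proof (rule bij_betw_byWitness[where f' = "tver G u ?b ?b'"])
        show "\<forall>s\<in>El (pprof X u) b b'. tver G u ?b ?b' (tver F u b b' s) = s"
          using GF u b by (simp add: htrans_eq_def htrans_comp_def htrans_id_def)
        show "\<forall>s\<in>El (pprof Y u) ?b ?b'. tver F u b b' (tver G u ?b ?b' s) = s"
          using FGv[OF u Fb] unfolding GFo[OF x(1) b(1)] GFo[OF x(2) b(2)] by blast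
        show "tver F u b b' ` El (pprof X u) b b' \<subseteq> El (pprof Y u) ?b ?b'"
          using F.tver_in[OF u' b] by blast
        show "tver G u ?b ?b' ` El (pprof Y u) ?b ?b' \<subseteq> El (pprof X u) b b'"
          using G.tver_in[OF u' Fb] unfolding GFo[OF x(1) b(1)] GFo[OF x(2) b(2)] by blast
      qed
    qed
  next
    assume ob: ?ob and ver: ?ver
    have ob: "bij_betw (fo (tob F x)) (Obj (pcat X x)) (Obj (pcat Y x))" if "x \<in> Ob C" for x
      using ob that by blast
    have ver: "bij_betw (tver F u b b') (El (pprof X u) b b') (El (pprof Y u) (fo (tob F x) b) (fo (tob F x') b'))"
      if "u \<in> vhom C x x'" "b \<in> Obj (pcat X x)" "b' \<in> Obj (pcat X x')" for u x x' b b'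
      using ver that by (auto simp: vhom_def)
    \<comment> \<open>Morphisms of \<open>X x\<close> are elements of \<open>X e\<^sub>x\<close>, so bijectivity at \<open>e\<^sub>x\<close> makes \<open>F\<^sub>x\<close> fully
      faithful.\<close>
    have ar: "bij_betw (fa (tob F x)) (Arr (pcat X x)) (Arr (pcat Y x))" if x: "x \<in> Ob C" for x
    proof -
      interpret Fx: cat_functor "pcat X x" "pcat Y x" "tob F x" by (rule F.tob_functor[OF x])
      interpret Xx: category "pcat X x" by (rule Fx.source)
      interpret Yx: category "pcat Y x" by (rule Fx.target)
      have hb: "bij_betw (fa (tob F x)) (hom (pcat X x) b b') (hom (pcat Y x) (fo (tob F x) b) (fo (tob F x) b'))"
        if b: "b \<in> Obj (pcat X x)" "b' \<in> Obj (pcat X x)" for b b'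
        using ver[OF X.vid_in[OF x] b]
        unfolding X.El_vid[OF x b] Y.El_vid[OF x Fo_in[OF x b(1)] Fo_in[OF x b(2)]]
        by (rule iffD1[OF bij_betw_cong, rotated]) (rule F.tver_vid[OF x])
      have homI: "f \<in> hom A (Dom A f) (Cod A f)" if "f \<in> Arr A" for f and A :: "('x, 'y) cat"
        using that by (simp add: hom_def)
      show ?thesis unfolding bij_betw_def
      proof (intro conjI inj_onI equalityI subsetI)
        fix f g assume f: "f \<in> Arr (pcat X x)" and g: "g \<in> Arr (pcat X x)"
          and eq: "fa (tob F x) f = fa (tob F x) g"
        note d = Xx.Dom_in[OF f] Xx.Cod_in[OF f] Xx.Dom_in[OF g] Xx.Cod_in[OF g]
        have "fo (tob F x) (Dom (pcat X x) f) = fo (tob F x) (Dom (pcat X x) g)"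
          "fo (tob F x) (Cod (pcat X x) f) = fo (tob F x) (Cod (pcat X x) g)"
          using Fx.fa_in[OF homI[OF f]] Fx.fa_in[OF homI[OF g]] eq by (simp_all add: hom_def)
        then have "Dom (pcat X x) f = Dom (pcat X x) g" "Cod (pcat X x) f = Cod (pcat X x) g"
          using inj_onD[OF bij_betw_imp_inj_on[OF ob[OF x]]] d by blast+
        then have "f \<in> hom (pcat X x) (Dom (pcat X x) g) (Cod (pcat X x) g)" using homI[OF f] by simp
        then show "f = g" by (rule inj_onD[OF bij_betw_imp_inj_on[OF hb[OF d(3,4)]] eq _ homI[OF g]])
      next
        fix g assume "g \<in> fa (tob F x) ` Arr (pcat X x)"
        then show "g \<in> Arr (pcat Y x)" using cat_functor_fa_Arr[OF F.tob_functor[OF x]] by blast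
      next
        fix g assume g: "g \<in> Arr (pcat Y x)"
        obtain b b' where b: "b \<in> Obj (pcat X x)" "b' \<in> Obj (pcat X x)"
          "Dom (pcat Y x) g = fo (tob F x) b" "Cod (pcat Y x) g = fo (tob F x) b'"
          using Yx.Dom_in[OF g] Yx.Cod_in[OF g] unfolding bij_betw_imp_surj_on[OF ob[OF x], symmetric]
          by (elim imageE) rule
        then have "g \<in> fa (tob F x) ` hom (pcat X x) b b'"
          using homI[OF g] bij_betw_imp_surj_on[OF hb[OF b(1,2)]] by simp
        then show "g \<in> fa (tob F x) ` Arr (pcat X x)" by (auto simp: hom_def)
      qed
    qed
    define o' where "o' x = inv_into (Obj (pcat X x)) (fo (tob F x))" for x
    define a' where "a' x = inv_into (Arr (pcat X x)) (fa (tob F x))" for x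
    define G where "G = \<lparr>tob = \<lambda>x. \<lparr>fo = o' x, fa = a' x\<rparr>,
      tver = \<lambda>u b b'. inv_into (El (pprof X u) (o' (vdom C u) b) (o' (vcod C u) b'))
         (tver F u (o' (vdom C u) b) (o' (vcod C u) b'))\<rparr>"
    have o_in: "o' x b \<in> Obj (pcat X x)" and Fo: "fo (tob F x) (o' x b) = b"
      if "x \<in> Ob C" "b \<in> Obj (pcat Y x)" for x b
      using bij_betw_inv_into_right[OF ob[OF that(1)] that(2)] bij_betw_imp_surj_on[OF ob[OF that(1)]] that(2)
      by (auto simp: o'_def intro: inv_into_into)
    have oI: "o' x (fo (tob F x) b) = b" if "x \<in> Ob C" "b \<in> Obj (pcat X x)" for x b
      unfolding o'_def by (rule bij_betw_inv_into_left[OF ob[OF that(1)] that(2)])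
    have a_fun: "cat_functor (pcat Y x) (pcat X x) (tob G x)" if "x \<in> Ob C" for x
      using cat_functor_inverse[OF F.tob_functor ob ar] that by (simp add: G_def o'_def a'_def)
    have a_in: "a' x k \<in> hom (pcat X x) (o' x b) (o' x c)" if "x \<in> Ob C" "k \<in> hom (pcat Y x) b c" for x k b c
      using cat_functor.fa_in[OF a_fun[OF that(1)] that(2)] by (simp add: G_def)
    have Fa: "fa (tob F x) (a' x k) = k" if "x \<in> Ob C" "k \<in> Arr (pcat Y x)" for x k
      unfolding a'_def by (rule bij_betw_inv_into_right[OF ar[OF that(1)] that(2)])
    have aI: "a' x (fa (tob F x) k) = k" if "x \<in> Ob C" "k \<in> Arr (pcat X x)" for x k
      unfolding a'_def by (rule bij_betw_inv_into_left[OF ar[OF that(1)] that(2)])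
    have G_in: "tver G u b b' s \<in> El (pprof X u) (o' x b) (o' x' b')"
      and FG: "tver F u (o' x b) (o' x' b') (tver G u b b' s) = s"
      if u: "u \<in> vhom C x x'" and b: "b \<in> Obj (pcat Y x)" "b' \<in> Obj (pcat Y x')"
        and s: "s \<in> El (pprof Y u) b b'" for u x x' b b' s
    proof -
      have x: "x \<in> Ob C" "x' \<in> Ob C" using X.vhom_obs[OF u] by auto
      note B = ver[OF u o_in[OF x(1) b(1)] o_in[OF x(2) b(2)], unfolded Fo[OF x(1) b(1)] Fo[OF x(2) b(2)]]
      have d: "vdom C u = x" "vcod C u = x'" using u by (auto simp: vhom_def)
      show "tver G u b b' s \<in> El (pprof X u) (o' x b) (o' x' b')"
        using s unfolding G_def d htrans.simps bij_betw_imp_surj_on[OF B, symmetric] by (rule inv_into_into)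
      show "tver F u (o' x b) (o' x' b') (tver G u b b' s) = s"
        unfolding G_def d htrans.simps by (rule bij_betw_inv_into_right[OF B s])
    qed
    \<comment> \<open>This is how values of \<open>G\<close> are computed below: guess the value and apply \<open>F\<close> to it.\<close>
    have GI: "tver G u (fo (tob F x) c) (fo (tob F x') c') r = s"
      if u: "u \<in> vhom C x x'" and c: "c \<in> Obj (pcat X x)" "c' \<in> Obj (pcat X x')"
        and s: "s \<in> El (pprof X u) c c'" and r: "tver F u c c' s = r" for u x x' c c' s r
    proof -
      have x: "x \<in> Ob C" "x' \<in> Ob C" using X.vhom_obs[OF u] by auto
      have d: "vdom C u = x" "vcod C u = x'" using u by (auto simp: vhom_def)
      show ?thesis unfolding G_def d htrans.simps oI[OF x(1) c(1)] oI[OF x(2) c(2)] r[symmetric]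
        by (rule bij_betw_inv_into_left[OF ver[OF u c] s])
    qed
    have sel: "fo (tob G x) = o' x" "fa (tob G x) = a' x" for x by (simp_all add: G_def)
    have tob_eq: "fo (tob F x) (fo (pfun X f) b) = fo (pfun Y f) (fo (tob F y) b)"
      if "f \<in> hhom C x y" "b \<in> Obj (pcat X y)" for f x y b
      using F.tob_fun[OF that(1)] that(2) by (simp add: func_eq_def func_comp_def)
    have toba_eq: "fa (tob F x) (fa (pfun X f) k) = fa (pfun Y f) (fa (tob F y) k)"
      if "f \<in> hhom C x y" "k \<in> Arr (pcat X y)" for f x y k
      using F.tob_fun[OF that(1)] that(2) by (simp add: func_eq_def func_comp_def)
    have o_fun: "o' x (fo (pfun Y f) b) = fo (pfun X f) (o' y b)"
      if f: "f \<in> hhom C x y" and b: "b \<in> Obj (pcat Y y)" for f x y b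
    proof -
      have x: "x \<in> Ob C" "y \<in> Ob C" using X.hhom_obs[OF f] by auto
      show ?thesis
        using oI[OF x(1) X.fo_in[OF f o_in[OF x(2) b]]] tob_eq[OF f o_in[OF x(2) b]] Fo[OF x(2) b] by simp
    qed
    have "horizontal_transformation C Y X G"
    proof (rule horizontal_transformation.intro[OF F.target F.source])
      show "cat_functor (pcat Y x) (pcat X x) (tob G x)" if "x \<in> Ob C" for x by (rule a_fun[OF that])
    next
      fix u x x' assume u: "u \<in> vhom C x x'"
      have x: "x \<in> Ob C" "x' \<in> Ob C" using X.vhom_obs[OF u] by auto
      show "prof_nat (pcat Y x) (pcat Y x') (tob G x) (tob G x') (pprof Y u) (pprof X u) (tver G u)"
        unfolding prof_nat_def sel
      proof (intro conjI ballI)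
        show "tver G u b b' s \<in> El (pprof X u) (o' x b) (o' x' b')"
          if "b \<in> Obj (pcat Y x)" "b' \<in> Obj (pcat Y x')" "s \<in> El (pprof Y u) b b'" for b b' s
          by (rule G_in[OF u that])
        fix f f' s assume f: "f \<in> Arr (pcat Y x)" and f': "f' \<in> Arr (pcat Y x')"
          and s: "s \<in> El (pprof Y u) (Cod (pcat Y x) f) (Dom (pcat Y x') f')"
        let ?d = "Dom (pcat Y x) f" and ?c = "Cod (pcat Y x) f"
          and ?d' = "Dom (pcat Y x') f'" and ?c' = "Cod (pcat Y x') f'"
        have d: "?d \<in> Obj (pcat Y x)" "?c \<in> Obj (pcat Y x)"
            "?d' \<in> Obj (pcat Y x')" "?c' \<in> Obj (pcat Y x')"
          using category.Dom_in[OF Y.cat[OF x(1)] f] category.Cod_in[OF Y.cat[OF x(1)] f]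
            category.Dom_in[OF Y.cat[OF x(2)] f'] category.Cod_in[OF Y.cat[OF x(2)] f'] .
        have af: "a' x f \<in> hom (pcat X x) (o' x ?d) (o' x ?c)"
          by (rule a_in[OF x(1)]) (simp add: hom_def f)
        have af': "a' x' f' \<in> hom (pcat X x') (o' x' ?d') (o' x' ?c')"
          by (rule a_in[OF x(2)]) (simp add: hom_def f')
        let ?s = "tver G u ?c ?d' s"
        have s': "?s \<in> El (pprof X u) (o' x ?c) (o' x' ?d')" by (rule G_in[OF u d(2,3) s])
        have "tver F u (o' x ?d) (o' x' ?c') (Act (pprof X u) (a' x f) (a' x' f') ?s) =
            Act (pprof Y u) (fa (tob F x) (a' x f)) (fa (tob F x') (a' x' f'))
              (tver F u (o' x ?c) (o' x' ?d') ?s)"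
          by (rule prof_nat_Act[OF F.tver_nat[OF u] af af' s'])
        also have "\<dots> = Act (pprof Y u) f f' s"
          by (simp add: Fa[OF x(1) f] Fa[OF x(2) f'] FG[OF u d(2,3) s])
        finally show "tver G u ?d ?c' (Act (pprof Y u) f f' s) =
            Act (pprof X u) (a' x f) (a' x' f') ?s"
          using GI[OF u o_in[OF x(1) d(1)] o_in[OF x(2) d(4)]
            profunctor.Act_in[OF X.profunctors[OF u] af af' s']] Fo[OF x(1) d(1)] Fo[OF x(2) d(4)] by simp
      qed
    next
      fix f x y assume f: "f \<in> hhom C x y"
      have x: "x \<in> Ob C" "y \<in> Ob C" using X.hhom_obs[OF f] by auto
      have "a' x (fa (pfun Y f) k) = fa (pfun X f) (a' y k)" if k: "k \<in> Arr (pcat Y y)" for k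
      proof -
        have ak: "a' y k \<in> Arr (pcat X y)"
          using cat_functor_fa_Arr[OF a_fun[OF x(2)] k] by (simp add: sel)
        show ?thesis
          using aI[OF x(1) cat_functor_fa_Arr[OF X.functors[OF f] ak]] toba_eq[OF f ak] Fa[OF x(2) k] by simp
      qed
      then show "func_eq (pcat Y y) (func_comp (tob G x) (pfun Y f)) (func_comp (pfun X f) (tob G y))"
        by (simp add: func_eq_def func_comp_def sel o_fun[OF f])
    next
      fix \<alpha> u f f' v b b' s
      assume \<alpha>: "\<alpha> \<in> squares C u f f' v"
        and b: "b \<in> Obj (pcat Y (vdom C v))" "b' \<in> Obj (pcat Y (vcod C v))"
        and s: "s \<in> El (pprof Y v) b b'"
      note u = X.Ver_vhom[OF X.squares_left[OF \<alpha>]] and v = X.Ver_vhom[OF X.squares_right[OF \<alpha>]]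
      note f = X.squares_top[OF \<alpha>] X.squares_bot[OF \<alpha>]
      have y: "vdom C v \<in> Ob C" "vcod C v \<in> Ob C" using X.vhom_obs[OF v] by auto
      note ob = o_in[OF y(1) b(1)] o_in[OF y(2) b(2)]
      let ?b = "o' (vdom C v) b" and ?b' = "o' (vcod C v) b'"
      have Fb: "fo (tob F (vdom C u)) (fo (pfun X f) ?b) = fo (pfun Y f) b"
        "fo (tob F (vcod C u)) (fo (pfun X f') ?b') = fo (pfun Y f') b'"
        using tob_eq[OF f(1) ob(1)] tob_eq[OF f(2) ob(2)] Fo[OF y(1) b(1)] Fo[OF y(2) b(2)] by simp_all
      have "tver F u (fo (pfun X f) ?b) (fo (pfun X f') ?b') (psq X \<alpha> ?b ?b' (tver G v b b' s)) =
          psq Y \<alpha> b b' s"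
        using F.tver_sq[OF \<alpha> ob G_in[OF v b s]] by (simp add: Fo[OF y(1) b(1)] Fo[OF y(2) b(2)] FG[OF v b s])
      from GI[OF u X.fo_in[OF f(1) ob(1)] X.fo_in[OF f(2) ob(2)] X.psq_in[OF \<alpha> ob G_in[OF v b s]] this]
      show "tver G u (fo (pfun Y f) b) (fo (pfun Y f') b') (psq Y \<alpha> b b' s) =
          psq X \<alpha> (fo (tob G (vdom C v)) b) (fo (tob G (vcod C v)) b') (tver G v b b' s)"
        unfolding Fb sel .
    next
      fix u x x' u' x'' b b' b'' s s'
      assume u: "u \<in> vhom C x x'" "u' \<in> vhom C x' x''"
        and b: "b \<in> Obj (pcat Y x)" "b' \<in> Obj (pcat Y x')" "b'' \<in> Obj (pcat Y x'')"
        and s: "s \<in> El (pprof Y u) b b'" "s' \<in> El (pprof Y u') b' b''"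
      have x: "x \<in> Ob C" "x' \<in> Ob C" "x'' \<in> Ob C" using X.vhom_obs[OF u(1)] X.vhom_obs[OF u(2)] by auto
      note ob = o_in[OF x(1) b(1)] o_in[OF x(2) b(2)] o_in[OF x(3) b(3)]
      note Fob = Fo[OF x(1) b(1)] Fo[OF x(2) b(2)] Fo[OF x(3) b(3)]
      note Gs = G_in[OF u(1) b(1,2) s(1)] G_in[OF u(2) b(2,3) s(2)]
      note eq = F.tver_mu[OF u ob Gs, unfolded Fob FG[OF u(1) b(1,2) s(1)] FG[OF u(2) b(2,3) s(2)]]
      show "tver G (vcmp C u' u) b b'' (pmu Y u u' b b'' (pclass C Y u u' b b'' b' s' s)) =
        pmu X u u' (fo (tob G x) b) (fo (tob G x'') b'')
        (pclass C X u u' (fo (tob G x) b) (fo (tob G x'') b'') (fo (tob G x') b')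
          (tver G u' b' b'' s') (tver G u b b' s))"
        using GI[OF X.vcmp_in[OF u] ob(1,3) X.mu_in[OF u ob Gs] eq] unfolding Fob sel .
    next
      fix x k b c assume x: "x \<in> Ob C" and k: "k \<in> hom (pcat Y x) b c"
      have b: "b \<in> Obj (pcat Y x)" "c \<in> Obj (pcat Y x)" and kA: "k \<in> Arr (pcat Y x)"
        using k category.Dom_in[OF Y.cat[OF x], of k] category.Cod_in[OF Y.cat[OF x], of k]
        by (auto simp: hom_def)
      note ob = o_in[OF x b(1)] o_in[OF x b(2)] and ak = a_in[OF x k]
      have "tver F (vid C x) (o' x b) (o' x c) (a' x k) = k"
        using F.tver_vid[OF x ak] Fa[OF x kA] by simp
      from GI[OF X.vid_in[OF x] ob _ this] ak
      show "tver G (vid C x) b c k = fa (tob G x) k"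
        by (simp add: X.El_vid[OF x ob] sel Fo[OF x b(1)] Fo[OF x b(2)])
    qed
    moreover have "htrans_eq C X (htrans_comp C G F) htrans_id"
    proof -
      have "tver G u (fo (tob F (vdom C u)) b) (fo (tob F (vcod C u)) b') (tver F u b b' s) = s"
        if "u \<in> Ver C" "b \<in> Obj (pcat X (vdom C u))" "b' \<in> Obj (pcat X (vcod C u))"
          "s \<in> El (pprof X u) b b'" for u b b' s
        by (rule GI[OF X.Ver_vhom[OF that(1)] that(2-4) refl])
      then show ?thesis
        by (simp add: htrans_eq_def htrans_comp_def htrans_id_def func_eq_def func_comp_def func_id_def
          sel oI aI)
    qed
    moreover have "htrans_eq C Y (htrans_comp C F G) htrans_id"
    proof -
      have "tver F u (o' (vdom C u) b) (o' (vcod C u) b') (tver G u b b' s) = s"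
        if "u \<in> Ver C" "b \<in> Obj (pcat Y (vdom C u))" "b' \<in> Obj (pcat Y (vcod C u))"
          "s \<in> El (pprof Y u) b b'" for u b b' s
        by (rule FG[OF X.Ver_vhom[OF that(1)] that(2-4)])
      then show ?thesis
        by (simp add: htrans_eq_def htrans_comp_def htrans_id_def func_eq_def func_comp_def func_id_def
          sel Fo Fa)
    qed
    ultimately show "htrans_invertible C X Y F"
      unfolding htrans_invertible_def using F by blast
  qed
qed

section \<open>The transformation determined by an element\<close>

context lax_double_presheaf begin

text \<open>Normality enters twice: a unit law turns \<open>\<mu>\<close> into an action on \<open>X e\<^sub>x\<close>, and this
profunctor is the hom functor.\<close>

lemma mu_vid_vid:
  assumes x: "x \<in> Ob C" and k: "k \<in> hom (pcat X x) b c" and k': "k' \<in> hom (pcat X x) c d"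
  shows "pmu X (vid C x) (vid C x) b d (pclass C X (vid C x) (vid C x) b d c k' k) =
    Cmp (pcat X x) k' k"
proof -
  interpret category "pcat X x" by (rule cat[OF x])
  have d: "c \<in> Obj (pcat X x)" "d \<in> Obj (pcat X x)" "k \<in> Arr (pcat X x)"
      "Cod (pcat X x) k = c"
    using k k' Dom_in[of k'] Cod_in[of k'] by (auto simp: hom_def)
  have "Act (pprof X (vid C x)) k (Idt (pcat X x) d) k' =
      Cmp (pcat X x) (Idt (pcat X x) d) (Cmp (pcat X x) k' k)"
    using prof_vid[OF x] d k' Idt_in[OF d(2)]
    by (auto simp: prof_eq_def hom_prof_def hom_def)
  also have "\<dots> = Cmp (pcat X x) k' k" by (rule Idt_Cmp[OF Cmp_in[OF k k']])
  finally show ?thesis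
    using mu_unit_left[OF vid_in[OF x] k d(2)] k' by (simp add: El_vid[OF x] d)
qed

context
  fixes t :: 'o and a :: 'a
  assumes t: "t \<in> Ob C" and a: "a \<in> Obj (pcat X t)"
begin

text \<open>The value of \<open>\<Phi>\<close> at a square \<open>\<eta>\<close>.\<close>

abbreviation "ev \<eta> \<equiv> psq X \<eta> a a (Idt (pcat X t) a)"

lemma ev_in: "\<eta> \<in> squares C u g g' (vid C t) \<Longrightarrow>
  ev \<eta> \<in> El (pprof X u) (fo (pfun X g) a) (fo (pfun X g') a)"
  by (rule psq_in) (use vid_in[OF t] a Idt_El[OF t a] in \<open>auto simp: vhom_def\<close>)

text \<open>Since \<open>\<mu>[1\<^sub>a, 1\<^sub>a] = 1\<^sub>a\<close>, this is the naturality of \<open>\<mu>\<close> evaluated at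
\<open>[1\<^sub>a, 1\<^sub>a]\<close>.\<close>

lemma ev_vsq:
  assumes \<eta>: "\<eta> \<in> squares C u g g' (vid C t)" and \<eta>': "\<eta>' \<in> squares C u' g' g'' (vid C t)"
  shows "ev (vsq C \<eta>' \<eta>) = pmu X u u' (fo (pfun X g) a) (fo (pfun X g'') a)
    (pclass C X u u' (fo (pfun X g) a) (fo (pfun X g'') a) (fo (pfun X g') a) (ev \<eta>') (ev \<eta>))"
  using psq_vsq[OF \<eta> \<eta>' vid_in[OF t] vid_in[OF t] a a a Idt_El[OF t a] Idt_El[OF t a]]
  by (simp add: mu_Idt_left[OF vid_in[OF t] a a Idt_El[OF t a]])

lemma ev_hsq:
  assumes \<alpha>: "\<alpha> \<in> squares C u f f' v" and \<eta>: "\<eta> \<in> squares C v g g' (vid C t)"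
  shows "ev (hsq C \<eta> \<alpha>) = psq X \<alpha> (fo (pfun X g) a) (fo (pfun X g') a) (ev \<eta>)"
  by (rule sq_hsq[OF \<alpha> \<eta>]) (use vid_in[OF t] a Idt_El[OF t a] in \<open>auto simp: vhom_def\<close>)

lemma ev_hom: "x \<in> Ob C \<Longrightarrow> \<eta> \<in> squares C (vid C x) g g' (vid C t) \<Longrightarrow>
  ev \<eta> \<in> hom (pcat X x) (fo (pfun X g) a) (fo (pfun X g') a)"
proof -
  assume x: "x \<in> Ob C" and \<eta>: "\<eta> \<in> squares C (vid C x) g g' (vid C t)"
  have "g \<in> hhom C x t" "g' \<in> hhom C x t"
    using squares_top[OF \<eta>] squares_bot[OF \<eta>] vid_in[OF x] vid_in[OF t] by (auto simp: vhom_def)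
  from El_vid[OF x fo_in[OF this(1) a] fo_in[OF this(2) a]] show ?thesis using ev_in[OF \<eta>] by simp
qed

text \<open>The actions on both sides are compositions with elements over vertical identities: on the left by
definition of the representable, on the right by the unit laws of \<open>\<mu>\<close>.  So compatibility with the
actions is an instance of compatibility with vertical pasting.\<close>

lemma ev_Act:
  assumes u: "u \<in> vhom C x x'" and \<eta>: "\<eta> \<in> squares C u g g' (vid C t)"
    and \<kappa>: "\<kappa> \<in> squares C (vid C x) h g (vid C t)" and \<kappa>': "\<kappa>' \<in> squares C (vid C x') g' h' (vid C t)"
  shows "ev (vsq C \<kappa>' (vsq C \<eta> \<kappa>)) = Act (pprof X u) (ev \<kappa>) (ev \<kappa>') (ev \<eta>)"
proof -
  have x: "x \<in> Ob C" "x' \<in> Ob C" using vhom_obs[OF u] by auto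
  interpret X: category "pcat X x" by (rule cat[OF x(1)])
  interpret X': category "pcat X x'" by (rule cat[OF x(2)])
  interpret U: profunctor "pcat X x" "pcat X x'" "pprof X u" by (rule profunctors[OF u])
  note k = ev_hom[OF x(1) \<kappa>] and k' = ev_hom[OF x(2) \<kappa>']
  have ob: "fo (pfun X h) a \<in> Obj (pcat X x)" "fo (pfun X g') a \<in> Obj (pcat X x')"
      "fo (pfun X h') a \<in> Obj (pcat X x')"
    using k k' X.Dom_in[of "ev \<kappa>"] X'.Dom_in[of "ev \<kappa>'"] X'.Cod_in[of "ev \<kappa>'"]
    by (auto simp: hom_def)
  note i = X.Idt_in[OF ob(1)] and i' = X'.Idt_in[OF ob(2)]
  note s = U.Act_in[OF k i' ev_in[OF \<eta>]]
  have \<eta>\<kappa>: "vsq C \<eta> \<kappa> \<in> squares C u h g' (vid C t)"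
    using vsq_over_vid[OF t \<kappa> \<eta>] by (simp add: vcmp_vid[OF u])
  have 1: "ev (vsq C \<eta> \<kappa>) = Act (pprof X u) (ev \<kappa>) (Idt (pcat X x') (fo (pfun X g') a)) (ev \<eta>)"
    unfolding ev_vsq[OF \<kappa> \<eta>] by (rule mu_unit_left[OF u k ob(2) ev_in[OF \<eta>]])
  have "ev (vsq C \<kappa>' (vsq C \<eta> \<kappa>)) = Act (pprof X u) (Idt (pcat X x) (fo (pfun X h) a)) (ev \<kappa>')
      (Act (pprof X u) (ev \<kappa>) (Idt (pcat X x') (fo (pfun X g') a)) (ev \<eta>))"
    unfolding ev_vsq[OF \<eta>\<kappa> \<kappa>'] 1 by (rule mu_unit_right[OF u ob(1) k' s])
  also have "\<dots> = Act (pprof X u) (Cmp (pcat X x) (ev \<kappa>) (Idt (pcat X x) (fo (pfun X h) a)))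
      (Cmp (pcat X x') (ev \<kappa>') (Idt (pcat X x') (fo (pfun X g') a))) (ev \<eta>)"
    by (rule U.Act_Cmp[OF i k i' k' ev_in[OF \<eta>], symmetric])
  finally show ?thesis by (simp only: X.Cmp_Idt[OF k] X'.Cmp_Idt[OF k'])
qed

theorem horizontal_transformation_yoneda:
  "horizontal_transformation C (representable C t) X (yoneda_trans X t a)"
proof -
  let ?R = "representable C t"
  interpret R: lax_double_presheaf C ?R by (rule lax_double_presheaf_representable[OF t])
  have sel: "fo (tob (yoneda_trans X t a) x) g = fo (pfun X g) a"
    "fa (tob (yoneda_trans X t a) x) \<eta> = ev \<eta>" "tver (yoneda_trans X t a) u g g' \<eta> = ev \<eta>" for x g \<eta> u g'
    by (simp_all add: yoneda_trans_def)
  show ?thesis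
  proof (rule horizontal_transformation.intro[OF R.lax_double_presheaf_axioms lax_double_presheaf_axioms])
    fix x assume x: "x \<in> Ob C"
    show "cat_functor (pcat ?R x) (pcat X x) (tob (yoneda_trans X t a) x)"
    proof (rule cat_functor.intro[OF R.cat[OF x] cat[OF x]]; unfold sel rep_simps)
      show "fo (pfun X g) a \<in> Obj (pcat X x)" if "g \<in> hhom C x t" for g by (rule fo_in[OF that a])
      show "ev (vsqid C g) = Idt (pcat X x) (fo (pfun X g) a)" if "g \<in> hhom C x t" for g
        by (rule psq_vsqid_Idt[OF that a])
      fix \<eta> g g' assume \<eta>: "\<eta> \<in> squares C (vid C x) g g' (vid C t)"
      show "ev \<eta> \<in> hom (pcat X x) (fo (pfun X g) a) (fo (pfun X g') a)" by (rule ev_hom[OF x \<eta>])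
      fix \<eta>' g'' assume \<eta>': "\<eta>' \<in> squares C (vid C x) g' g'' (vid C t)"
      show "ev (vsq C \<eta>' \<eta>) = Cmp (pcat X x) (ev \<eta>') (ev \<eta>)"
        unfolding ev_vsq[OF \<eta> \<eta>'] by (rule mu_vid_vid[OF x ev_hom[OF x \<eta>] ev_hom[OF x \<eta>']])
    qed
  next
    fix u x x' assume u: "u \<in> vhom C x x'"
    show "prof_nat (pcat ?R x) (pcat ?R x') (tob (yoneda_trans X t a) x) (tob (yoneda_trans X t a) x')
        (pprof ?R u) (pprof X u) (tver (yoneda_trans X t a) u)"
      unfolding prof_nat_def sel
    proof (intro conjI ballI)
      show "ev \<eta> \<in> El (pprof X u) (fo (pfun X g) a) (fo (pfun X g') a)"
        if "\<eta> \<in> El (pprof ?R u) g g'" for \<eta> g g'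
        using that unfolding rep_simps by (rule ev_in)
      fix k k' \<eta> assume "k \<in> Arr (pcat ?R x)" "k' \<in> Arr (pcat ?R x')"
        "\<eta> \<in> El (pprof ?R u) (Cod (pcat ?R x) k) (Dom (pcat ?R x') k')"
      then have k: "k \<in> squares C (vid C x) (stop C k) (sbot C k) (vid C t)"
        and k': "k' \<in> squares C (vid C x') (stop C k') (sbot C k') (vid C t)"
        and \<eta>: "\<eta> \<in> squares C u (sbot C k) (stop C k') (vid C t)"
        by (simp_all only: rep_simps)
      show "ev (Act (pprof ?R u) k k' \<eta>) = Act (pprof X u) (ev k) (ev k') (ev \<eta>)"
        unfolding rep_simps by (rule ev_Act[OF u \<eta> k k'])
    qed
  next
    fix f x y assume f: "f \<in> hhom C x y"
    have y: "y \<in> Ob C" using hhom_obs[OF f] by simp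
    have "ev (hsq C \<eta> (vsqid C f)) = fa (pfun X f) (ev \<eta>)"
      if \<eta>: "\<eta> \<in> squares C (vid C y) g g' (vid C t)" for \<eta> g g'
      unfolding ev_hsq[OF vsqid_boundary[OF f] \<eta>] by (rule sq_vsqid[OF f ev_hom[OF y \<eta>]])
    then show "func_eq (pcat ?R y) (func_comp (tob (yoneda_trans X t a) x) (pfun ?R f))
        (func_comp (pfun X f) (tob (yoneda_trans X t a) y))"
      by (auto simp: func_eq_def func_comp_def sel rep_simps fo_hcmp[OF f _ a])
  next
    fix \<alpha> u f f' v g g' \<eta>
    assume "\<alpha> \<in> squares C u f f' v" "\<eta> \<in> El (pprof ?R v) g g'"
    then show "tver (yoneda_trans X t a) u (fo (pfun ?R f) g) (fo (pfun ?R f') g') (psq ?R \<alpha> g g' \<eta>) =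
      psq X \<alpha> (fo (tob (yoneda_trans X t a) (vdom C v)) g) (fo (tob (yoneda_trans X t a) (vcod C v)) g')
        (tver (yoneda_trans X t a) v g g' \<eta>)"
      unfolding sel rep_simps by (rule ev_hsq)
  next
    fix u x x' u' x'' g g' g'' s s'
    assume u: "u \<in> vhom C x x'" "u' \<in> vhom C x' x''"
      and "s \<in> El (pprof ?R u) g g'" "s' \<in> El (pprof ?R u') g' g''"
    then have s: "s \<in> squares C u g g' (vid C t)" "s' \<in> squares C u' g' g'' (vid C t)"
      by (simp_all only: rep_simps)
    show "tver (yoneda_trans X t a) (vcmp C u' u) g g'' (pmu ?R u u' g g'' (pclass C ?R u u' g g'' g' s' s)) =
      pmu X u u' (fo (tob (yoneda_trans X t a) x) g) (fo (tob (yoneda_trans X t a) x'') g'')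
        (pclass C X u u' (fo (tob (yoneda_trans X t a) x) g) (fo (tob (yoneda_trans X t a) x'') g'')
          (fo (tob (yoneda_trans X t a) x') g')
          (tver (yoneda_trans X t a) u' g' g'' s') (tver (yoneda_trans X t a) u g g' s))"
      unfolding pmu_representable[OF t u s] sel by (rule ev_vsq[OF s])
  next
    fix x k g g'
    show "tver (yoneda_trans X t a) (vid C x) g g' k = fa (tob (yoneda_trans X t a) x) k"
      unfolding sel ..
  qed
qed

theorem represented_by_iff_bij:
  "represented_by C X t a \<longleftrightarrow>
    (\<forall>x\<in>Ob C. bij_betw (\<lambda>g. fo (pfun X g) a) (hhom C x t) (Obj (pcat X x))) \<and>
    (\<forall>u\<in>Ver C. \<forall>g\<in>hhom C (vdom C u) t. \<forall>g'\<in>hhom C (vcod C u) t.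
       bij_betw ev (squares C u g g' (vid C t)) (El (pprof X u) (fo (pfun X g) a) (fo (pfun X g') a)))"
  unfolding represented_by_def htrans_invertible_iff_bij[OF horizontal_transformation_yoneda]
  by (simp add: yoneda_trans_def rep_simps)

end

end

section \<open>Representability and double terminality\<close>

lemma bij_betw_iff_ex1:
  assumes "f ` A \<subseteq> B"
  shows "bij_betw f A B \<longleftrightarrow> (\<forall>b\<in>B. \<exists>!a. a \<in> A \<and> f a = b)"
proof
  assume "bij_betw f A B"
  then show "\<forall>b\<in>B. \<exists>!a. a \<in> A \<and> f a = b" by (auto simp: bij_betw_def dest: inj_onD)
next
  assume *: "\<forall>b\<in>B. \<exists>!a. a \<in> A \<and> f a = b"
  then have "inj_on f A" using assms by (intro inj_onI) blast
  moreover have "B \<subseteq> f ` A"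
  proof
    fix b assume "b \<in> B"
    then obtain a where "a \<in> A" "f a = b" using * by (meson ex1_implies_ex)
    then show "b \<in> f ` A" by blast
  qed
  ultimately show "bij_betw f A B" using assms by (auto simp: bij_betw_def)
qed

lemma ex1_inj_image:
  assumes "inj k"
  shows "(\<exists>!y. \<exists>x. y = k x \<and> P x) \<longleftrightarrow> (\<exists>!x. P x)"
  using injD[OF assms] by (intro iffI; elim ex1E) blast+

context lax_double_presheaf begin

text \<open>The vertical identity of \<open>(t, a)\<close> is \<open>(e\<^sub>t, 1\<^sub>a)\<close>.  Hence the condition on a square of
\<open>C\<close> to lie over it is that its value on \<open>1\<^sub>a\<close> is the element on the left boundary.\<close>

theorem double_terminal_grothendieck_iff:
  assumes t: "t \<in> Ob C" and a: "a \<in> Obj (pcat X t)"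
  shows "double_terminal (grothendieck C X) (t, a) \<longleftrightarrow>
    (\<forall>x\<in>Ob C. \<forall>b\<in>Obj (pcat X x). \<exists>!g. g \<in> hhom C x t \<and> fo (pfun X g) a = b) \<and>
    (\<forall>u\<in>Ver C. \<forall>g\<in>hhom C (vdom C u) t. \<forall>g'\<in>hhom C (vcod C u) t.
      \<forall>s\<in>El (pprof X u) (fo (pfun X g) a) (fo (pfun X g') a).
        \<exists>!\<eta>. \<eta> \<in> squares C u g g' (vid C t) \<and> psq X \<eta> a a (Idt (pcat X t) a) = s)"
proof -
  let ?G = "grothendieck C X"
  interpret G: double_category ?G by (rule double_category_grothendieck)
  have "(t, a) \<in> Ob ?G" using t a by (simp add: Ob_grothendieck)
  note terminal = G.double_terminal_iff[OF this]
  have hhom: "F \<in> hhom ?G (x, b) (t, a) \<longleftrightarrow>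
      (\<exists>g. F = ((x, b), g, (t, a)) \<and> g \<in> hhom C x t \<and> fo (pfun X g) a = b)" for F x b
    using t a fo_in hhom_obs by (auto simp: hhom_grothendieck)
  have hor: "(\<exists>!F. F \<in> hhom ?G (x, b) (t, a)) \<longleftrightarrow> (\<exists>!g. g \<in> hhom C x t \<and> fo (pfun X g) a = b)" for x b
    unfolding hhom by blast
  have sq: "(\<exists>!A. A \<in> squares ?G ((x, fo (pfun X g) a), (u, s), (x', fo (pfun X g') a))
        ((x, fo (pfun X g) a), g, (t, a)) ((x', fo (pfun X g') a), g', (t, a)) (vid ?G (t, a))) \<longleftrightarrow>
      (\<exists>!\<eta>. \<eta> \<in> squares C u g g' (vid C t) \<and> psq X \<eta> a a (Idt (pcat X t) a) = s)" (is "(\<exists>!A. A \<in> ?S) \<longleftrightarrow> _")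
    if u: "u \<in> vhom C x x'" and g: "g \<in> hhom C x t" "g' \<in> hhom C x' t"
      and s: "s \<in> El (pprof X u) (fo (pfun X g) a) (fo (pfun X g') a)" for x u s x' g g'
  proof -
    have "A \<in> ?S \<longleftrightarrow> (\<exists>\<eta>. A = (((x, fo (pfun X g) a), (u, s), (x', fo (pfun X g') a)), \<eta>, vid ?G (t, a)) \<and>
        \<eta> \<in> squares C u g g' (vid C t) \<and> psq X \<eta> a a (Idt (pcat X t) a) = s)" for A
      using u g s t a vhom_obs[OF u] fo_in[OF g(1) a] fo_in[OF g(2) a] vid_in[OF t] Idt_El[OF t a]
      by (auto simp: squares_grothendieck grothendieck_simps)
    then show ?thesis by (simp only:) (rule ex1_inj_image, simp add: inj_def)
  qed
  have Ball_Ob: "(\<forall>p\<in>Ob ?G. P p) \<longleftrightarrow> (\<forall>x\<in>Ob C. \<forall>b\<in>Obj (pcat X x). P (x, b))" for P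
    by (auto simp: grothendieck_def Let_def)
  have Ver: "U \<in> Ver ?G \<longleftrightarrow> (\<exists>x b u s x' b'. U = ((x, b), (u, s), (x', b')) \<and> u \<in> vhom C x x' \<and>
      b \<in> Obj (pcat X x) \<and> b' \<in> Obj (pcat X x') \<and> s \<in> El (pprof X u) b b')" for U
    using vhom_obs by (cases U) (auto simp: grothendieck_def Let_def)
  show ?thesis (is "_ \<longleftrightarrow> ?hor \<and> ?ver")
  proof -
    have "(\<forall>p\<in>Ob ?G. \<exists>!F. F \<in> hhom ?G p (t, a)) \<longleftrightarrow> ?hor"
      unfolding Ball_Ob hor ..
    moreover have "(\<forall>U\<in>Ver ?G. \<forall>F\<in>hhom ?G (vdom ?G U) (t, a). \<forall>F'\<in>hhom ?G (vcod ?G U) (t, a).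
        \<exists>!A. A \<in> squares ?G U F F' (vid ?G (t, a))) \<longleftrightarrow> ?ver" (is "?l \<longleftrightarrow> _")
    proof
      assume l: ?l
      show ?ver
      proof (intro ballI)
        fix u g g' s assume u: "u \<in> Ver C" and g: "g \<in> hhom C (vdom C u) t" "g' \<in> hhom C (vcod C u) t"
          and s: "s \<in> El (pprof X u) (fo (pfun X g) a) (fo (pfun X g') a)"
        let ?U = "((vdom C u, fo (pfun X g) a), (u, s), (vcod C u, fo (pfun X g') a))"
        have "?U \<in> Ver ?G" using Ver_vhom[OF u] g s fo_in[OF g(1) a] fo_in[OF g(2) a] by (auto simp: Ver)
        moreover have "vdom ?G ?U = (vdom C u, fo (pfun X g) a)" "vcod ?G ?U = (vcod C u, fo (pfun X g') a)"
          by (simp_all add: grothendieck_def Let_def)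
        ultimately show "\<exists>!\<eta>. \<eta> \<in> squares C u g g' (vid C t) \<and> psq X \<eta> a a (Idt (pcat X t) a) = s"
          unfolding sq[OF Ver_vhom[OF u] g s, symmetric]
          using l g by (auto simp: hhom)
      qed
    next
      assume r: ?ver
      show ?l
      proof (intro ballI)
        fix U F F' assume U: "U \<in> Ver ?G" and F: "F \<in> hhom ?G (vdom ?G U) (t, a)"
          "F' \<in> hhom ?G (vcod ?G U) (t, a)"
        obtain x b u s x' b' where U': "U = ((x, b), (u, s), (x', b'))" "u \<in> vhom C x x'"
          "s \<in> El (pprof X u) b b'" using U by (auto simp: Ver)
        then have "vdom ?G U = (x, b)" "vcod ?G U = (x', b')"
          by (simp_all add: grothendieck_def Let_def)
        then obtain g g' where g: "F = ((x, b), g, (t, a))" "g \<in> hhom C x t" "b = fo (pfun X g) a"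
          "F' = ((x', b'), g', (t, a))" "g' \<in> hhom C x' t" "b' = fo (pfun X g') a"
          using F by (auto simp: hhom)
        have "\<exists>!\<eta>. \<eta> \<in> squares C u g g' (vid C t) \<and> psq X \<eta> a a (Idt (pcat X t) a) = s"
          using r U' g by (auto simp: vhom_def)
        then show "\<exists>!A. A \<in> squares ?G U F F' (vid ?G (t, a))"
          unfolding U'(1) g(1,3,4,6) sq[OF U'(2) g(2,5) U'(3)[unfolded g(3,6)]] .
      qed
    qed
    ultimately show ?thesis unfolding terminal by (rule conj_cong)
  qed
qed

end

theorem theorem7p2p2:
  fixes C :: "('o, 'h, 'v, 's) dblcat"
    and X :: "('o, 'h, 'v, 's, 'a, 'm) presheaf"
    and t :: 'o and a :: 'a
  assumes "double_category C"
    and "lax_double_presheaf C X"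
    and "t \<in> Ob C"
    and "a \<in> Obj (pcat X t)"
  shows "represented_by C X t a \<longleftrightarrow> double_terminal (grothendieck C X) (t, a)"
proof -
  interpret lax_double_presheaf C X by fact
  note ta = assms(3,4)
  have "bij_betw (\<lambda>g. fo (pfun X g) a) (hhom C x t) (Obj (pcat X x)) \<longleftrightarrow>
      (\<forall>b\<in>Obj (pcat X x). \<exists>!g. g \<in> hhom C x t \<and> fo (pfun X g) a = b)" for x
    by (rule bij_betw_iff_ex1) (auto intro: fo_in[OF _ ta(2)])
  moreover have "bij_betw (\<lambda>\<eta>. psq X \<eta> a a (Idt (pcat X t) a)) (squares C u g g' (vid C t))
        (El (pprof X u) (fo (pfun X g) a) (fo (pfun X g') a)) \<longleftrightarrow>
      (\<forall>s\<in>El (pprof X u) (fo (pfun X g) a) (fo (pfun X g') a).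
        \<exists>!\<eta>. \<eta> \<in> squares C u g g' (vid C t) \<and> psq X \<eta> a a (Idt (pcat X t) a) = s)" for u g g'
    by (rule bij_betw_iff_ex1) (auto intro: ev_in[OF ta])
  ultimately show ?thesis
    unfolding represented_by_iff_bij[OF ta] double_terminal_grothendieck_iff[OF ta] by simp
qed

end
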